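(* Take $W=S_n$ ($n\ge2$) and $S=\{s_1,\dots,s_{n-1}\}$, $s_i=(i,i+1)$. For any Coxeter word $\vec c$ in $S$, any integer $p>0$ coprime to $n$, and any integer $k$ with $0\le k\le n-1$, we have $$\operatorname{Kirk}_{S_n,p}^{(k)}=\sum_{v\in S_n:\ \operatorname{Asc}(v)=I_k}\big|\mathcal M^{(v)}(\vec c^{\,p})\big|.$$
   Context: A Coxeter word is a word formed by the elements of $S$, each used once, in some order; $\vec c^{\,p}$ is its $p$-fold concatenation. $\operatorname{Asc}(v)=\{s\in S:\ell(sv)>\ell(v)\}$ is the left ascent set, and $I_k=\{s_1,\dots,s_{n-1-k}\}$. Let $\mathsf V$ be the reflection representation of $S_n$ (dimension $n-1$). The rational Kirkman polynomials $\operatorname{Kirk}_{S_n,p}^{(k)}(\mathsf x)$ are defined by $$\sum_{k=0}^{n-1}t^k\operatorname{Kirk}_{S_n,p}^{(k)}(\mathsf x)=\frac1{n!}\sum_{w\in S_n}\frac{\det(1+tw\mid\mathsf V^* )\det(1-\mathsf x^pw\mid\mathsf V^* )}{\det(1-\mathsf xw\mid\mathsf V^* )},$$ and the rational Kirkman numbers are $\operatorname{Kirk}_{S_n,p}^{(k)}=\operatorname{Kirk}_{S_n,p}^{(k)}(1)$. Given a word $\vec s=(s^{(1)},\dots,s^{(m)})$ in $S$, a subword is a sequence $\vec\omega=(\omega^{(1)},\dots,\omega^{(m)})$ with $\omega^{(i)}\in\{e,s^{(i)}\}$; $\omega_{(i)}=\omega^{(1)}\cdots\omega^{(i)}$, $\omega_{(0)}=e$.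 For $v\in S_n$, $\vec\omega$ is $v$-distinguished if $v\omega_{(i)}\le v\omega_{(i-1)}s^{(i)}$ in Bruhat order for all $i$. $\mathcal D^{(v)}(\vec s)$ is the set of $v$-distinguished subwords with $\omega_{(m)}=e$, and $\mathcal M^{(v)}(\vec s)$ is the set of $\vec\omega\in\mathcal D^{(v)}(\vec s)$ for which exactly $n-1$ indices $i$ satisfy $\omega^{(i)}=e$. *)

theory Defs
  imports
    "Jordan_Normal_Form.Determinant"
    "HOL-Combinatorics.Permutations"
begin

section \<open>The symmetric group as a Coxeter group\<close>

text \<open>
  Elements of \<open>S\<^sub>n\<close> are the functions \<open>w :: nat \<Rightarrow> nat\<close> with \<open>w permutes {1..n}\<close>;
  the product is composition, \<open>u \<circ> v\<close> applying \<open>v\<close> first, and the identity is \<open>id\<close>.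
  Words, and subwords, are lists of group elements. The inverse of \<open>w\<close> is written
  \<open>inv_into UNIV w\<close>, since here \<open>inv\<close> is the group inverse of HOL-Algebra.
\<close>

definition sym_group :: "nat \<Rightarrow> (nat \<Rightarrow> nat) set" where
  "sym_group n = {w. w permutes {1..n}}"

definition simple_refl :: "nat \<Rightarrow> nat \<Rightarrow> nat" where
  "simple_refl i = transpose i (Suc i)"

definition simple_refls :: "nat \<Rightarrow> (nat \<Rightarrow> nat) set" where
  "simple_refls n = simple_refl ` {1..<n}"

definition word_prod :: "(nat \<Rightarrow> nat) list \<Rightarrow> (nat \<Rightarrow> nat)" where
  "word_prod ws = foldr (\<circ>) ws id"

definition len :: "nat \<Rightarrow> (nat \<Rightarrow> nat) \<Rightarrow> nat" where
  "len n w = (LEAST m. \<exists>ws. length ws = m \<and> set ws \<subseteq> simple_refls n \<and> word_prod ws = w)"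

definition refls :: "nat \<Rightarrow> (nat \<Rightarrow> nat) set" where
  "refls n = {w \<circ> s \<circ> inv_into UNIV w | w s. w \<in> sym_group n \<and> s \<in> simple_refls n}"

text \<open>Bruhat order: the reflexive transitive closure of \<open>u < u t\<close> for reflections \<open>t\<close>
  with \<open>\<ell>(u) < \<ell>(u t)\<close>.\<close>

definition bruhat_step :: "nat \<Rightarrow> (nat \<Rightarrow> nat) \<Rightarrow> (nat \<Rightarrow> nat) \<Rightarrow> bool" where
  "bruhat_step n u v \<longleftrightarrow> u \<in> sym_group n \<and> (\<exists>t\<in>refls n. v = u \<circ> t) \<and> len n u < len n v"

definition bruhat_le :: "nat \<Rightarrow> (nat \<Rightarrow> nat) \<Rightarrow> (nat \<Rightarrow> nat) \<Rightarrow> bool" where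
  "bruhat_le n = (bruhat_step n)\<^sup>*\<^sup>*"

definition Asc :: "nat \<Rightarrow> (nat \<Rightarrow> nat) \<Rightarrow> (nat \<Rightarrow> nat) set" where
  "Asc n v = {s \<in> simple_refls n. len n (s \<circ> v) > len n v}"

definition I_set :: "nat \<Rightarrow> nat \<Rightarrow> (nat \<Rightarrow> nat) set" where
  "I_set n k = simple_refl ` {1..n - 1 - k}"

definition coxeter_word :: "nat \<Rightarrow> (nat \<Rightarrow> nat) list \<Rightarrow> bool" where
  "coxeter_word n c \<longleftrightarrow> distinct c \<and> set c = simple_refls n"

definition word_power :: "(nat \<Rightarrow> nat) list \<Rightarrow> nat \<Rightarrow> (nat \<Rightarrow> nat) list" where
  "word_power c p = concat (replicate p c)"


section \<open>Distinguished subwords\<close>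

definition is_subword :: "(nat \<Rightarrow> nat) list \<Rightarrow> (nat \<Rightarrow> nat) list \<Rightarrow> bool" where
  "is_subword \<omega> ss \<longleftrightarrow> length \<omega> = length ss \<and> (\<forall>i<length ss. \<omega> ! i \<in> {id, ss ! i})"

definition partial_prod :: "(nat \<Rightarrow> nat) list \<Rightarrow> nat \<Rightarrow> (nat \<Rightarrow> nat)" where
  "partial_prod \<omega> i = word_prod (take i \<omega>)"

text \<open>List positions start at \<open>0\<close>, so \<open>\<omega> ! i\<close> is the letter with index \<open>i + 1\<close>.\<close>

definition distinguished ::
    "nat \<Rightarrow> (nat \<Rightarrow> nat) \<Rightarrow> (nat \<Rightarrow> nat) list \<Rightarrow> (nat \<Rightarrow> nat) list \<Rightarrow> bool" where
  "distinguished n v ss \<omega> \<longleftrightarrow> (\<forall>i<length ss.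
     bruhat_le n (v \<circ> partial_prod \<omega> (Suc i)) (v \<circ> partial_prod \<omega> i \<circ> ss ! i))"

definition D_set :: "nat \<Rightarrow> (nat \<Rightarrow> nat) \<Rightarrow> (nat \<Rightarrow> nat) list \<Rightarrow> (nat \<Rightarrow> nat) list set" where
  "D_set n v ss = {\<omega>. is_subword \<omega> ss \<and> distinguished n v ss \<omega> \<and>
                      partial_prod \<omega> (length ss) = id}"

definition M_set :: "nat \<Rightarrow> (nat \<Rightarrow> nat) \<Rightarrow> (nat \<Rightarrow> nat) list \<Rightarrow> (nat \<Rightarrow> nat) list set" where
  "M_set n v ss = {\<omega> \<in> D_set n v ss. card {i. i < length ss \<and> \<omega> ! i = id} = n - 1}"


section \<open>The reflection representation\<close>

text \<open>
  \<open>V\<close> is the space of vectors \<open>x = (x\<^sub>1, \<dots>, x\<^sub>n)\<close> with coordinate sum \<open>0\<close>, on which \<open>w\<close> acts by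
  \<open>(w x)\<^sub>a = x\<^bsub>w\<^sup>-\<^sup>1 a\<^esub>\<close>. Its basis is \<open>\<alpha>\<^sub>i = e\<^sub>i - e\<^bsub>i+1\<^esub>\<close>, \<open>1 \<le> i < n\<close>, and the coefficient
  of \<open>\<alpha>\<^sub>j\<close> in \<open>x\<close> is \<open>x\<^sub>1 + \<dots> + x\<^sub>j\<close> (lemma \<open>root_expansion\<close>). All matrix entries are integers,
  so the coefficient ring is left arbitrary.
\<close>

definition simple_root :: "nat \<Rightarrow> nat \<Rightarrow> 'a :: comm_ring_1" where
  "simple_root i = (\<lambda>a. of_bool (a = i) - of_bool (a = Suc i))"

definition perm_act :: "(nat \<Rightarrow> nat) \<Rightarrow> (nat \<Rightarrow> 'a) \<Rightarrow> (nat \<Rightarrow> 'a)" where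
  "perm_act w x = (\<lambda>a. x (inv_into UNIV w a))"

definition root_coeff :: "(nat \<Rightarrow> 'a :: comm_ring_1) \<Rightarrow> nat \<Rightarrow> 'a" where
  "root_coeff x j = (\<Sum>a=1..j. x a)"

lemma root_expansion:
  fixes x :: "nat \<Rightarrow> 'a :: comm_ring_1"
  assumes supp: "\<And>a. a \<notin> {1..n} \<Longrightarrow> x a = 0" and sum0: "(\<Sum>a=1..n. x a) = 0"
  shows "x a = (\<Sum>j\<in>{1..<n}. root_coeff x j * simple_root j a)"
proof -
  have "(\<Sum>j\<in>{1..<n}. root_coeff x j * simple_root j a) =
     (\<Sum>j\<in>{1..<n}. if j = a then root_coeff x j else 0) -
     (\<Sum>j\<in>{1..<n}. if Suc j = a then root_coeff x j else 0)"
    unfolding sum_subtractf [symmetric]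
    by (intro sum.cong) (auto simp: simple_root_def)
  also have "(\<Sum>j\<in>{1..<n}. if j = a then root_coeff x j else 0) =
      (if a \<in> {1..<n} then root_coeff x a else 0)"
    by simp
  also have "(\<Sum>j\<in>{1..<n}. if Suc j = a then root_coeff x j else 0) =
      (if a \<in> {2..n} then root_coeff x (a - 1) else 0)"
  proof -
    have "(\<Sum>j\<in>{1..<n}. if Suc j = a then root_coeff x j else 0) =
          (\<Sum>j\<in>{1..<n}. if j = a - 1 \<and> a \<noteq> 0 then root_coeff x j else 0)"
      by (intro sum.cong) auto
    also have "\<dots> = (if a \<in> {2..n} then root_coeff x (a - 1) else 0)"
      by (cases "a = 0") auto
    finally show ?thesis .
  qed
  also have "(if a \<in> {1..<n} then root_coeff x a else 0) -
      (if a \<in> {2..n} then root_coeff x (a - 1) else 0) = x a"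
  proof (cases "a \<in> {1..n}")
    case False
    then show ?thesis using supp[of a] by auto
  next
    case True
    then obtain b where b: "a = Suc b" by (cases a) auto
    have "root_coeff x a = root_coeff x b + x a"
      by (simp add: root_coeff_def b)
    moreover have "root_coeff x n = 0" using sum0 by (simp add: root_coeff_def)
    moreover have "root_coeff x 0 = 0" by (simp add: root_coeff_def)
    ultimately show ?thesis using True b
      by (cases "a = n"; cases "b = 0") (auto simp: algebra_simps dest: minus_unique)
  qed
  finally show ?thesis by simp
qed

text \<open>Column \<open>i\<close> holds the coordinates of \<open>w \<alpha>\<^bsub>i+1\<^esub>\<close>, as rows and columns are numbered from \<open>0\<close>.\<close>

definition refl_mat :: "nat \<Rightarrow> (nat \<Rightarrow> nat) \<Rightarrow> 'a :: comm_ring_1 mat" where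
  "refl_mat n w = mat (n - 1) (n - 1)
     (\<lambda>(j, i). root_coeff (perm_act w (simple_root (Suc i))) (Suc j))"

text \<open>The matrix of \<open>w\<close> on the dual space, in the dual basis.\<close>

definition dual_refl_mat :: "nat \<Rightarrow> (nat \<Rightarrow> nat) \<Rightarrow> 'a :: comm_ring_1 mat" where
  "dual_refl_mat n w = transpose_mat (refl_mat n (inv_into UNIV w))"

text \<open>\<open>det_dual n a w\<close> is \<open>det(1 + a w | V\<^sup>*)\<close>.\<close>

definition det_dual :: "nat \<Rightarrow> 'a :: comm_ring_1 \<Rightarrow> (nat \<Rightarrow> nat) \<Rightarrow> 'a" where
  "det_dual n a w = det (1\<^sub>m (n - 1) + a \<cdot>\<^sub>m dual_refl_mat n w)"


section \<open>Rational Kirkman polynomials and numbers\<close>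

text \<open>The field of rational functions in \<open>x\<close> is \<open>real poly fract\<close>; polynomials over it are
  polynomials in \<open>t\<close>.\<close>

definition ratfun_x :: "real poly fract" where
  "ratfun_x = to_fract [:0, 1:]"

definition kirk_gen :: "nat \<Rightarrow> nat \<Rightarrow> real poly fract poly" where
  "kirk_gen n p = smult (1 / of_nat (fact n))
     (\<Sum>w\<in>sym_group n. smult (det_dual n (- (ratfun_x ^ p)) w / det_dual n (- ratfun_x) w)
                             (det_dual n [:0, 1:] w))"

text \<open>The coefficients of \<open>kirk_gen n p\<close> are a priori rational functions of \<open>x\<close>. For \<open>p\<close> coprime
  to \<open>n\<close> they are polynomials, since every quotient \<open>det(1 - x\<^sup>p w) / det(1 - x w)\<close> is one.\<close>

definition kirk_poly :: "nat \<Rightarrow> nat \<Rightarrow> nat \<Rightarrow> real poly" where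
  "kirk_poly n p k = (THE P. to_fract P = coeff (kirk_gen n p) k)"

definition kirk_number :: "nat \<Rightarrow> nat \<Rightarrow> nat \<Rightarrow> real" where
  "kirk_number n p k = poly (kirk_poly n p k) 1"

end

theory Submission
  imports
    Defs
    "HOL-Combinatorics.Cycles"
    "HOL-Computational_Algebra.Formal_Power_Series"
begin

text \<open>Both sides of the identity are expressed through one weighted count: compositions of \<open>n\<close> into \<open>p\<close>
parts (zero allowed), a composition with \<open>j\<close> nonzero parts having weight \<open>(1 + t) ^ j\<close>.

The subword side. Let \<open>T\<^sub>i\<close> act on functions of a permutation \<open>v\<close> by
\<open>(T\<^sub>i g) v = g (v s\<^sub>i) + z g v\<close>, the second term being present only if \<open>v i < v (i + 1)\<close>. These
operators satisfy the braid relations and \<open>T\<^sub>i\<^sup>2 = 1 + z T\<^sub>i\<close>: they give a regular representation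
of the Hecke algebra. In the expansion of a product of operators each letter is either kept or
deleted, and deletion is possible exactly when the subword stays \<open>v\<close>-distinguished; so the number
of elements of \<open>M\<^sup>(\<^sup>v\<^sup>)\<close> is the coefficient of \<open>z ^ (n - 1)\<close> in a diagonal entry (\<open>card_M_set\<close>). The
\<open>v\<close> with \<open>Asc v = I_k\<close> are the standardizations of the \<open>k\<close>-element subsets of \<open>{1..n - 1}\<close>. Hence the
generating function of the right-hand sides, multiplied by \<open>1 + t\<close>, is the coefficient of
\<open>z ^ (n - 1)\<close> in a sum of diagonal entries over all subsets of \<open>{1..n}\<close>, the coloured trace
(\<open>ctrace_eq_ascents\<close>). It is invariant under cyclic rotation of words (\<open>ctrace_comm\<close>). Rotations and
Hecke relations first replace the Coxeter word by \<open>s\<^sub>1 \<dots> s\<^bsub>n-1\<^esub>\<close> (\<open>ctrace_coxeter\<close>), and then the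
power of that word by a monomial in the Jucys--Murphy elements times a single copy of it, the
exponent of the \<open>l\<close>-th one being \<open>\<lceil>l p / n\<rceil> - \<lceil>(l - 1) p / n\<rceil>\<close> (\<open>ctrace_coxeter_power\<close>).
For arbitrary exponents, the relation \<open>T\<^sub>i\<^sup>2 = 1 + z T\<^sub>i\<close> yields a skein recursion (\<open>lead_skein\<close>), which is also satisfied by a weighted count of lattice paths (\<open>lead_eq_paths\<close>). For the
exponents above the paths are the rational Dyck paths, and the cycle lemma turns them into all
compositions (\<open>lead_cexp\<close>).

The Kirkman side. Up to the factor \<open>1 + a\<close>, \<open>det (1 + a w)\<close> on the reflection representation is
the determinant for the permutation matrix, that is, a signed sum over the \<open>w\<close>-stable subsets, and
also a product over the cycles of \<open>w\<close>. From the product, the quotient of the two determinants in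
the definition is a polynomial with value \<open>p ^ (c - 1)\<close> at \<open>1\<close>, where \<open>c\<close> is the number of cycles of
\<open>w\<close> (\<open>det_quotient\<close>); and \<open>p ^ c\<close> counts the \<open>w\<close>-invariant colourings with \<open>p\<close> colours. From the
stable subsets, the sum over all \<open>w\<close> is evaluated by adding one point at a time, which gives
products of a falling and a rising factorial of \<open>p\<close> (\<open>sum_inv_coeff\<close>). These are the coefficients of
the composition count as well (\<open>sum_comps_wt\<close>).\<close>

section \<open>Deletion operators\<close>

definition zvar :: "real poly" where "zvar = [:0, 1:]"

text \<open>The relation \<open>r\<close> on the values of \<open>u\<close> decides where a letter may be deleted. It is \<open><\<close> for
permutations; other relations serve to work with colourings and with restricted deletions.\<close>

definition hop :: "('a \<Rightarrow> 'a \<Rightarrow> bool) \<Rightarrow> nat \<Rightarrow> ((nat \<Rightarrow> 'a) \<Rightarrow> real poly) \<Rightarrow> (nat \<Rightarrow> 'a) \<Rightarrow> real poly" where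
  "hop r i g u = g (u \<circ> simple_refl i) + (if r (u i) (u (Suc i)) then zvar * g u else 0)"

definition hops :: "('a \<Rightarrow> 'a \<Rightarrow> bool) \<Rightarrow> nat list \<Rightarrow> ((nat \<Rightarrow> 'a) \<Rightarrow> real poly) \<Rightarrow> (nat \<Rightarrow> 'a) \<Rightarrow> real poly" where
  "hops r ws g = foldr (hop r) ws g"

definition delta :: "'b \<Rightarrow> 'b \<Rightarrow> real poly" where
  "delta v u = of_bool (u = v)"

lemma hops_Nil [simp]: "hops r [] g = g"
  and hops_Cons: "hops r (i # ws) g = hop r i (hops r ws g)"
  and hops_append: "hops r (xs @ ys) g = hops r xs (hops r ys g)"
  by (simp_all add: hops_def)

lemma simple_refl_invol [simp]: "simple_refl i \<circ> simple_refl i = id"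
  by (simp add: simple_refl_def)

lemma simple_refl_invol' [simp]: "simple_refl i (simple_refl i x) = x"
  by (simp add: simple_refl_def)

lemma comp_simple_refl_twice [simp]: "u \<circ> simple_refl i \<circ> simple_refl i = u"
  by (simp add: comp_assoc)

lemma bij_simple_refl [simp]: "bij (simple_refl i)"
  by (simp add: simple_refl_def)

lemma simple_refl_apply [simp]:
  "simple_refl i i = Suc i" "simple_refl i (Suc i) = i"
  "x \<noteq> i \<Longrightarrow> x \<noteq> Suc i \<Longrightarrow> simple_refl i x = x"
  by (simp_all add: simple_refl_def)

lemma simple_refl_permutes: "i \<in> {1..<n} \<Longrightarrow> simple_refl i permutes {1..n}"
  unfolding simple_refl_def by (rule permutes_swap_id) auto

lemma bij_comp_simple_refl [simp]: "bij (u \<circ> simple_refl i) \<longleftrightarrow> bij u"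
  by (metis bij_comp bij_simple_refl comp_simple_refl_twice)

lemma hop_add: "hop r i (\<lambda>u. g u + h u) = (\<lambda>u. hop r i g u + hop r i h u)"
  by (simp add: hop_def algebra_simps fun_eq_iff)
lemma hop_cmult: "hop r i (\<lambda>u. c * g u) = (\<lambda>u. c * hop r i g u)"
  by (simp add: hop_def algebra_simps fun_eq_iff)

lemma hops_add: "hops r ws (\<lambda>u. g u + h u) = (\<lambda>u. hops r ws g u + hops r ws h u)"
  by (induction ws) (simp_all add: hops_Cons hop_add)
lemma hops_cmult: "hops r ws (\<lambda>u. c * g u) = (\<lambda>u. c * hops r ws g u)"
  by (induction ws) (simp_all add: hops_Cons hop_cmult)

text \<open>Operators only evaluate their argument on the orbit of \<open>u\<close>, so equality may be checked on any
closed set of functions.\<close>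

lemma hops_cong_closed:
  fixes g h :: "(nat \<Rightarrow> 'a) \<Rightarrow> real poly" and P :: "(nat \<Rightarrow> 'a) \<Rightarrow> bool"
  assumes "\<And>u. P u \<Longrightarrow> g u = h u" "\<And>i (u :: nat \<Rightarrow> 'a). i \<in> set ws \<Longrightarrow> P u \<Longrightarrow> P (u \<circ> simple_refl i)" "P u"
  shows "hops r ws g u = hops r ws h u"
  using assms(2,3)
proof (induction ws arbitrary: u)
  case Nil then show ?case using assms(1) by simp
next
  case (Cons i ws)
  have "P (u \<circ> simple_refl i)" by (rule Cons.prems(1)) (use Cons.prems in simp_all)
  moreover have "hops r ws g v = hops r ws h v" if "P v" for v
    by (rule Cons.IH) (use Cons.prems that in auto)
  ultimately show ?case using Cons.prems(2) by (simp add: hops_Cons hop_def)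
qed

section \<open>The Hecke algebra relations\<close>

text \<open>Away from bijections the value is set to zero: then the defining relations hold as identities of
operators on all functions, and words with equal operators may replace each other anywhere in a
longer word.\<close>

definition W :: "nat list \<Rightarrow> ((nat \<Rightarrow> nat) \<Rightarrow> real poly) \<Rightarrow> (nat \<Rightarrow> nat) \<Rightarrow> real poly" where
  "W ws g u = (if bij u then hops (<) ws g u else 0)"

lemma W_append: "W (xs @ ys) = W xs \<circ> W ys"
proof (intro ext)
  fix g and u :: "nat \<Rightarrow> nat"
  have "hops (<) xs (hops (<) ys g) u = hops (<) xs (W ys g) u" if "bij u"
    by (rule hops_cong_closed[where P=bij]) (use that in \<open>auto simp: W_def\<close>)
  then show "W (xs @ ys) g u = (W xs \<circ> W ys) g u"
    by (auto simp: W_def hops_append)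
qed

lemma W_add: "W ws (\<lambda>u. g u + h u) = (\<lambda>u. W ws g u + W ws h u)"
  by (auto simp: W_def hops_add fun_eq_iff)
lemma W_cmult: "W ws (\<lambda>u. c * g u) = (\<lambda>u. c * W ws g u)"
  by (auto simp: W_def hops_cmult fun_eq_iff)

text \<open>Exactly one of \<open>u\<close> and \<open>u s\<^sub>i\<close> admits a deletion, so deleting one letter and keeping the other contributes
\<open>z g (u s\<^sub>i)\<close> once; deleting both contributes \<open>z\<^sup>2 g u\<close> if \<open>u\<close> admits it.\<close>

lemma W_square: "W [i, i] = (\<lambda>g u. W [] g u + zvar * W [i] g u)"
proof (intro ext)
  fix g and u :: "nat \<Rightarrow> nat"
  show "W [i, i] g u = W [] g u + zvar * W [i] g u"
  proof (cases "bij u")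
    case True
    then have "u i \<noteq> u (Suc i)" by (metis bij_pointE n_not_Suc_n)
    then have "u i < u (Suc i) \<or> u (Suc i) < u i" by arith
    then show ?thesis using True
      by (auto simp: W_def hops_Cons hop_def algebra_simps)
  qed (simp add: W_def)
qed

lemma W_skein: "W (xs @ [i, i] @ ys) g u = W (xs @ ys) g u + zvar * W (xs @ [i] @ ys) g u"
proof -
  have "W [] (W ys g) = W ys g" by (metis W_append append_Nil comp_apply)
  then show ?thesis
    by (simp only: W_append comp_apply W_square W_add W_cmult)
qed

lemma simple_refl_commute:
  "Suc i < j \<Longrightarrow> simple_refl i \<circ> simple_refl j = simple_refl j \<circ> simple_refl i"
  by (auto simp: simple_refl_def fun_eq_iff transpose_def)

lemma simple_refl_braid:
  "simple_refl i \<circ> simple_refl (Suc i) \<circ> simple_refl i =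
   simple_refl (Suc i) \<circ> simple_refl i \<circ> simple_refl (Suc i)"
  by (auto simp: simple_refl_def fun_eq_iff transpose_def)

lemma W_commute:
  assumes "Suc i < j"
  shows "W [i, j] = W [j, i]"
proof (intro ext)
  fix g and u :: "nat \<Rightarrow> nat"
  have e: "u \<circ> simple_refl i \<circ> simple_refl j = u \<circ> simple_refl j \<circ> simple_refl i"
    using simple_refl_commute[OF assms] by (metis comp_assoc)
  show "W [i, j] g u = W [j, i] g u"
    using assms by (auto simp: W_def hops_Cons hop_def e algebra_simps)
qed

lemma W_braid: "W [i, Suc i, i] = W [Suc i, i, Suc i]"
proof (intro ext)
  fix g and u :: "nat \<Rightarrow> nat"
  let ?s = "simple_refl i" and ?t = "simple_refl (Suc i)"
  have e: "u \<circ> ?s \<circ> ?t \<circ> ?s = u \<circ> ?t \<circ> ?s \<circ> ?t"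
    using simple_refl_braid[of i] by (metis comp_assoc)
  show "W [i, Suc i, i] g u = W [Suc i, i, Suc i] g u"
  proof (cases "bij u")
    case True
    then have "u i \<noteq> u (Suc i)" "u i \<noteq> u (Suc (Suc i))" "u (Suc i) \<noteq> u (Suc (Suc i))"
      by (metis bij_pointE n_not_Suc_n Suc_n_not_n lessI less_SucI less_irrefl)+
    then show ?thesis using True
      by (auto simp: W_def hops_Cons hop_def e algebra_simps)
  qed (simp add: W_def)
qed

section \<open>Commuting left operators\<close>

text \<open>The counterpart of \<open>hop\<close> for multiplication from the left. Left and right multiplication commute,
and so do the two families of operators; this transports identities between words from one
permutation to all others.\<close>

definition lhop :: "nat \<Rightarrow> ((nat \<Rightarrow> nat) \<Rightarrow> real poly) \<Rightarrow> (nat \<Rightarrow> nat) \<Rightarrow> real poly" where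
  "lhop j g v = g (simple_refl j \<circ> v) +
     (if inv_into UNIV v j < inv_into UNIV v (Suc j) then zvar * g v else 0)"

lemma inv_simple_refl [simp]: "inv_into UNIV (simple_refl i) = simple_refl i"
  by (rule inv_unique_comp) simp_all

lemma inv_comp_simple_refl:
  assumes "bij u"
  shows "inv_into UNIV (u \<circ> simple_refl i) x = simple_refl i (inv_into UNIV u x)"
  using o_inv_distrib[OF assms bij_simple_refl[of i]]
  by simp

lemma inv_simple_refl_comp:
  assumes "bij u"
  shows "inv_into UNIV (simple_refl i \<circ> u) x = inv_into UNIV u (simple_refl i x)"
  using o_inv_distrib[OF bij_simple_refl[of i] assms]
  by simp

lemma simple_refl_less_iff:
  assumes "x \<noteq> y" "{x, y} \<noteq> {i, Suc i}"
  shows "simple_refl i x < simple_refl i y \<longleftrightarrow> x < y"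
  using assms by (auto simp: simple_refl_def transpose_def)

text \<open>The two deletion conditions only interact if the values \<open>j\<close>, \<open>j + 1\<close> of \<open>v\<close> sit at the positions \<open>i\<close>,
\<open>i + 1\<close>; then left and right multiplication coincide.\<close>

lemma lhop_hop:
  assumes "bij v"
  shows "lhop j (hop (<) i g) v = hop (<) i (lhop j g) v"
proof -
  let ?x = "inv_into UNIV v j" and ?y = "inv_into UNIV v (Suc j)"
  have xy: "v ?x = j" "v ?y = Suc j" using assms by (simp_all add: bij_is_surj surj_f_inv_f)
  have ne: "?x \<noteq> ?y" using xy by auto
  have vne: "v i \<noteq> v (Suc i)" using assms by (metis bij_pointE n_not_Suc_n)
  have iv: "\<And>z. inv_into UNIV v (v z) = z" using assms by (simp add: bij_is_inj)
  show ?thesis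
  proof (cases "{?x, ?y} = {i, Suc i}")
    case True
    then consider "?x = i" "?y = Suc i" | "?x = Suc i" "?y = i" by (auto simp: doubleton_eq_iff)
    then show ?thesis
    proof cases
      case 1
      then have v: "v i = j" "v (Suc i) = Suc j" using xy by auto
      have "simple_refl j \<circ> v = v \<circ> simple_refl i"
      proof
        fix z show "(simple_refl j \<circ> v) z = (v \<circ> simple_refl i) z"
          using v bij_is_inj[OF assms, THEN inj_eq, of z i] bij_is_inj[OF assms, THEN inj_eq, of z "Suc i"]
          by (cases "z = i"; cases "z = Suc i") simp_all
      qed
      moreover from this have "simple_refl j \<circ> (v \<circ> simple_refl i) = v"
        by (metis comp_assoc comp_simple_refl_twice)
      ultimately show ?thesis using v 1 assms
        by (simp add: lhop_def hop_def inv_comp_simple_refl comp_assoc)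
    next
      case 2
      then have v: "v (Suc i) = j" "v i = Suc j" using xy by auto
      have "simple_refl j \<circ> v = v \<circ> simple_refl i"
      proof
        fix z show "(simple_refl j \<circ> v) z = (v \<circ> simple_refl i) z"
          using v bij_is_inj[OF assms, THEN inj_eq, of z i] bij_is_inj[OF assms, THEN inj_eq, of z "Suc i"]
          by (cases "z = i"; cases "z = Suc i") simp_all
      qed
      moreover from this have "simple_refl j \<circ> (v \<circ> simple_refl i) = v"
        by (metis comp_assoc comp_simple_refl_twice)
      ultimately show ?thesis using v 2 assms
        by (simp add: lhop_def hop_def inv_comp_simple_refl comp_assoc)
    qed
  next
    case False
    have d: "simple_refl i ?x < simple_refl i ?y \<longleftrightarrow> ?x < ?y"
      by (rule simple_refl_less_iff) (use ne False in auto)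
    have d': "simple_refl j (v i) < simple_refl j (v (Suc i)) \<longleftrightarrow> v i < v (Suc i)"
    proof (rule simple_refl_less_iff)
      show "{v i, v (Suc i)} \<noteq> {j, Suc j}" using False iv by (metis doubleton_eq_iff)
    qed (use vne in auto)
    show ?thesis using assms d d'
      by (simp add: lhop_def hop_def inv_comp_simple_refl comp_assoc algebra_simps)
  qed
qed

lemma lhop_hops: "bij v \<Longrightarrow> lhop j (hops (<) ws g) v = hops (<) ws (lhop j g) v"
proof (induction ws arbitrary: g v)
  case (Cons i ws)
  have "lhop j (hops (<) (i # ws) g) v = hop (<) i (lhop j (hops (<) ws g)) v"
    using Cons.prems by (simp add: hops_Cons lhop_hop)
  also have "\<dots> = hops (<) (i # ws) (lhop j g) v"
  proof -
    have "bij (v \<circ> simple_refl i)" using Cons.prems by simp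
    from Cons.IH[OF Cons.prems, of g] Cons.IH[OF this, of g] show ?thesis by (simp only: hop_def hops_Cons)
  qed
  finally show ?case .
qed simp

lemma lhop_delta:
  "lhop j (delta v) = (\<lambda>u. delta (simple_refl j \<circ> v) u +
     (if inv_into UNIV v j < inv_into UNIV v (Suc j) then zvar else 0) * delta v u)"
proof
  fix u
  have "simple_refl j \<circ> u = v \<longleftrightarrow> u = simple_refl j \<circ> v"
    by (metis comp_assoc id_comp simple_refl_invol)
  then show "lhop j (delta v) u = delta (simple_refl j \<circ> v) u +
     (if inv_into UNIV v j < inv_into UNIV v (Suc j) then zvar else 0) * delta v u"
    by (cases "u = v") (simp_all add: lhop_def delta_def)
qed

text \<open>Evaluating \<open>lhop_hops\<close> at a delta function: both sides contain the diagonal entry with the same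
coefficient, and what remains is this symmetry of neighbouring entries.\<close>

lemma hops_delta_symmetric:
  assumes "bij v"
  shows "hops (<) ws (delta v) (simple_refl j \<circ> v) = hops (<) ws (delta (simple_refl j \<circ> v)) v"
proof -
  define c where "c = (if inv_into UNIV v j < inv_into UNIV v (Suc j) then zvar else 0)"
  have "lhop j (delta v) = (\<lambda>u. delta (simple_refl j \<circ> v) u + c * delta v u)"
    using lhop_delta by (simp add: c_def)
  then have "hops (<) ws (lhop j (delta v)) v = hops (<) ws (delta (simple_refl j \<circ> v)) v + c * hops (<) ws (delta v) v"
    by (simp only: hops_add hops_cmult)
  moreover have "lhop j (hops (<) ws (delta v)) v = hops (<) ws (delta v) (simple_refl j \<circ> v) + c * hops (<) ws (delta v) v"
    by (simp add: lhop_def c_def)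
  ultimately show ?thesis using lhop_hops[OF assms] by simp
qed

section \<open>Two-colourings and the coloured trace\<close>

text \<open>A linear order: the points outside \<open>B\<close> come first, in their natural order, and are followed by the
points of \<open>B\<close> in reverse order.\<close>

definition col_less :: "nat set \<Rightarrow> nat \<Rightarrow> nat \<Rightarrow> bool" where
  "col_less B x y \<longleftrightarrow> (if x \<in> B then y \<in> B \<and> y < x else y \<in> B \<or> x < y)"

text \<open>The rank of \<open>x\<close> among \<open>{1..n}\<close> with respect to \<open>col_less B\<close>.\<close>

definition stdz :: "nat \<Rightarrow> nat set \<Rightarrow> nat \<Rightarrow> nat" where
  "stdz n B x = (if x \<in> {1..n} then if x \<in> B then Suc n - card (B \<inter> {1..x}) else card ({1..x} - B) else x)"

lemma stdz_bounds:
  assumes "x \<in> {1..n}"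
  shows "stdz n B x \<in> {1..n}"
proof (cases "x \<in> B")
  case True
  have "card (B \<inter> {1..x}) \<le> card {1..x}" by (intro card_mono) auto
  moreover have "card (B \<inter> {1..x}) > 0" using True assms by (auto simp: card_gt_0_iff)
  ultimately show ?thesis using assms True by (auto simp: stdz_def)
next
  case False
  have "card ({1..x} - B) \<le> card {1..x}" by (intro card_mono) auto
  moreover have "card ({1..x} - B) > 0" using False assms by (auto simp: card_gt_0_iff)
  ultimately show ?thesis using assms False by (auto simp: stdz_def)
qed

lemma stdz_mono:
  assumes "x \<in> {1..n}" "y \<in> {1..n}" "col_less B x y"
  shows "stdz n B x < stdz n B y"
proof (cases "x \<in> B")
  case True
  with assms have y: "y \<in> B" "y < x" by (auto simp: col_less_def)
  have "card (B \<inter> {1..y}) < card (B \<inter> {1..x})"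
  proof (intro psubset_card_mono psubsetI)
    have "x \<in> B \<inter> {1..x}" "x \<notin> B \<inter> {1..y}" using True y assms by auto
    then show "B \<inter> {1..y} \<noteq> B \<inter> {1..x}" by blast
  qed (use y in auto)
  moreover have "card (B \<inter> {1..x}) \<le> card {1..x}" by (intro card_mono) auto
  ultimately show ?thesis using assms True y by (auto simp: stdz_def)
next
  case False
  show ?thesis
  proof (cases "y \<in> B")
    case True
    have 1: "card ({1..x} - B) \<le> card ({1..n} - B)" by (intro card_mono) (use assms in auto)
    have 2: "card (B \<inter> {1..y}) \<le> card (B \<inter> {1..n})" by (intro card_mono) (use assms in auto)
    have 3: "card ({1..n} - B) + card (B \<inter> {1..n}) = n"
      using card_Diff_subset_Int[of "{1..n}" B] card_mono[of "{1..n}" "B \<inter> {1..n}"]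
      by (simp add: Int_commute)
    show ?thesis using 1 2 3 True False assms by (auto simp: stdz_def)
  next
    case y: False
    have "card ({1..x} - B) < card ({1..y} - B)"
    proof (intro psubset_card_mono psubsetI)
      have "y \<in> {1..y} - B" "y \<notin> {1..x} - B" using False y assms by (auto simp: col_less_def)
      then show "{1..x} - B \<noteq> {1..y} - B" by blast
      show "{1..x} - B \<subseteq> {1..y} - B" using False y assms by (auto simp: col_less_def)
    qed simp
    then show ?thesis using assms False y by (auto simp: stdz_def)
  qed
qed

lemma col_less_total: "x \<noteq> y \<Longrightarrow> col_less B x y \<or> col_less B y x"
  and col_less_asym: "col_less B x y \<Longrightarrow> \<not> col_less B y x"
  by (auto simp: col_less_def split: if_splits)

lemma stdz_less_iff:
  assumes "x \<in> {1..n}" "y \<in> {1..n}"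
  shows "stdz n B x < stdz n B y \<longleftrightarrow> col_less B x y"
proof (cases "x = y")
  case False
  then show ?thesis
    using stdz_mono[OF assms] stdz_mono[OF assms(2,1)] col_less_total[OF False, of B] by fastforce
qed (auto simp: col_less_def)

lemma stdz_permutes: "stdz n B permutes {1..n}"
proof (rule bij_imp_permutes)
  have "inj_on (stdz n B) {1..n}"
    by (rule inj_onI) (metis stdz_less_iff col_less_total less_irrefl)
  moreover have "stdz n B ` {1..n} \<subseteq> {1..n}" using stdz_bounds by blast
  ultimately show "bij_betw (stdz n B) {1..n} {1..n}"
    by (simp add: bij_betw_def endo_inj_surj)
qed (auto simp: stdz_def)

text \<open>Used to recognize a permutation as a standardization.\<close>

lemma permutes_order_unique:
  fixes v w :: "nat \<Rightarrow> nat"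
  assumes "v permutes {1..n}" "w permutes {1..n}"
    and "\<And>x y. x \<in> {1..n} \<Longrightarrow> y \<in> {1..n} \<Longrightarrow> x \<noteq> y \<Longrightarrow> v x < v y \<longleftrightarrow> w x < w y"
  shows "v = w"
proof
  have *: "u x = card {y \<in> {1..n}. \<not> u x < u y}" if u: "u permutes {1..n}" and "x \<in> {1..n}" for u :: "nat \<Rightarrow> nat" and x
  proof -
    have "card {y \<in> {1..n}. \<not> u x < u y} = card (u ` {y \<in> {1..n}. \<not> u x < u y})"
      by (rule card_image[symmetric]) (rule inj_on_subset[OF permutes_inj[OF u]], simp)
    also have "u ` {y \<in> {1..n}. \<not> u x < u y} = {z \<in> u ` {1..n}. \<not> u x < z}" by auto
    also have "\<dots> = {1..u x}"
      using permutes_image[OF u] permutes_in_image[OF u, of x] that by auto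
    finally show ?thesis by simp
  qed
  fix x
  show "v x = w x"
  proof (cases "x \<in> {1..n}")
    case True
    have "{y \<in> {1..n}. \<not> v x < v y} = {y \<in> {1..n}. \<not> w x < w y}"
      using assms(3)[OF True] by (metis less_irrefl)
    then show ?thesis using *[OF assms(1) True] *[OF assms(2) True] by simp
  qed (use assms(1,2) permutes_not_in in metis)
qed

lemma stdz_swap_mixed:
  assumes i: "i \<in> {1..<n}" and x: "i \<in> B \<longleftrightarrow> Suc i \<notin> B"
  shows "stdz n B \<circ> simple_refl i = stdz n (simple_refl i ` B)"
proof (rule permutes_order_unique)
  show "stdz n B \<circ> simple_refl i permutes {1..n}"
    using permutes_compose[OF simple_refl_permutes[OF i] stdz_permutes] .
next
  fix a b assume ab: "a \<in> {1..n}" "b \<in> {1..n}" "a \<noteq> b"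
  have mem: "z \<in> simple_refl i ` B \<longleftrightarrow> simple_refl i z \<in> B" for z
    by (metis imageE image_eqI simple_refl_invol')
  have in': "simple_refl i a \<in> {1..n}" "simple_refl i b \<in> {1..n}"
    using ab permutes_in_image[OF simple_refl_permutes[OF i]] by auto
  have "col_less B (simple_refl i a) (simple_refl i b) \<longleftrightarrow> col_less (simple_refl i ` B) a b"
  proof (cases "{a, b} = {i, Suc i}")
    case True
    then have "a = i \<and> b = Suc i \<or> a = Suc i \<and> b = i" by (auto simp: doubleton_eq_iff)
    then show ?thesis using x by (auto simp: col_less_def mem)
  next
    case False
    have "simple_refl i a < simple_refl i b \<longleftrightarrow> a < b" "simple_refl i b < simple_refl i a \<longleftrightarrow> b < a"
      using simple_refl_less_iff[of a b i] simple_refl_less_iff[of b a i] False ab by (auto simp: insert_commute)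
    then show ?thesis by (simp add: col_less_def mem)
  qed
  then show "((stdz n B \<circ> simple_refl i) a < (stdz n B \<circ> simple_refl i) b) =
       (stdz n (simple_refl i ` B) a < stdz n (simple_refl i ` B) b)"
    using stdz_less_iff in' ab by simp
qed (rule stdz_permutes)

text \<open>Two neighbours of the same colour are neighbours in the order \<open>col_less B\<close> too, so swapping the
positions has the same effect as swapping the values.\<close>

lemma stdz_swap_pure:
  assumes i: "i \<in> {1..<n}" and x: "i \<in> B \<longleftrightarrow> Suc i \<in> B"
  obtains j where "stdz n B \<circ> simple_refl i = simple_refl j \<circ> stdz n B"
proof -
  let ?v = "stdz n B"
  have "?v (Suc i) = Suc (?v i) \<or> ?v i = Suc (?v (Suc i))"
  proof (cases "i \<in> B")
    case True
    have "B \<inter> {1..Suc i} = insert (Suc i) (B \<inter> {1..i})" using True x by auto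
    then have "card (B \<inter> {1..Suc i}) = Suc (card (B \<inter> {1..i}))" by simp
    moreover have "card (B \<inter> {1..Suc i}) \<le> card {1..Suc i}" by (intro card_mono) auto
    ultimately show ?thesis using i True x by (auto simp: stdz_def)
  next
    case False
    have "{1..Suc i} - B = insert (Suc i) ({1..i} - B)" using False x by auto
    then have "card ({1..Suc i} - B) = Suc (card ({1..i} - B))" by simp
    then show ?thesis using i False x by (auto simp: stdz_def)
  qed
  then obtain j where j: "{?v i, ?v (Suc i)} = {j, Suc j}" by (metis insert_commute)
  have inj: "?v a = ?v b \<longleftrightarrow> a = b" for a b
    using permutes_inj[OF stdz_permutes] by (metis injD)
  have "(?v \<circ> simple_refl i) z = (simple_refl j \<circ> ?v) z" for z
  proof (cases "z = i \<or> z = Suc i")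
    case True
    then show ?thesis using j by (auto simp: doubleton_eq_iff)
  next
    case False
    then have "?v z \<noteq> ?v i" "?v z \<noteq> ?v (Suc i)" by (auto simp: inj)
    then have "?v z \<noteq> j" "?v z \<noteq> Suc j" using j by (metis insertCI insertE singletonD)+
    then show ?thesis using False by simp
  qed
  then show thesis using that by blast
qed

text \<open>A trace on the Hecke algebra, obtained as a sum of diagonal entries over those
permutations only that are standardizations of a colouring.\<close>

definition ctrace :: "nat \<Rightarrow> real \<Rightarrow> (((nat \<Rightarrow> nat) \<Rightarrow> real poly) \<Rightarrow> (nat \<Rightarrow> nat) \<Rightarrow> real poly) \<Rightarrow> real poly" where
  "ctrace n t \<phi> = (\<Sum>B\<in>Pow {1..n}. smult (t ^ card B) (\<phi> (delta (stdz n B)) (stdz n B)))"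

lemma bij_stdz [simp]: "bij (stdz n B)" using stdz_permutes permutes_bij by blast

text \<open>If \<open>i\<close> and \<open>i + 1\<close> have different colours, \<open>B \<mapsto> s\<^sub>i B\<close> pairs the terms of the two sums. If they have
the same colour, right multiplication by \<open>s\<^sub>i\<close> is left multiplication by some \<open>s\<^sub>j\<close>, and the terms
agree by the symmetry of neighbouring entries.\<close>

lemma ctrace_swap:
  assumes i: "i \<in> {1..<n}"
  shows "(\<Sum>B\<in>Pow {1..n}. smult (t ^ card B) (hops (<) ws (delta (stdz n B)) (stdz n B \<circ> simple_refl i))) =
         (\<Sum>B\<in>Pow {1..n}. smult (t ^ card B) (hops (<) ws (delta (stdz n B \<circ> simple_refl i)) (stdz n B)))"
    (is "sum ?f _ = sum ?g _")
proof -
  \<comment> \<open>The colourings that distinguish \<open>i\<close> from \<open>i + 1\<close>.\<close>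
  define M where "M = {B \<in> Pow {1..n}. i \<in> B \<longleftrightarrow> Suc i \<notin> B}"
  have M: "M \<subseteq> Pow {1..n}" by (auto simp: M_def)
  have mem: "z \<in> simple_refl i ` B \<longleftrightarrow> simple_refl i z \<in> B" for z B
    by (metis imageE image_eqI simple_refl_invol')
  have in': "simple_refl i ` B \<in> M" if "B \<in> M" for B
  proof -
    have "simple_refl i ` B \<subseteq> {1..n}"
      using that permutes_image[OF simple_refl_permutes[OF i]] by (auto simp: M_def)
    then show ?thesis using that by (auto simp: M_def mem)
  qed
  have invol: "simple_refl i ` simple_refl i ` B = B" for B
    by (simp add: image_comp)
  have cardB: "card (simple_refl i ` B) = card B" for B
    by (rule card_image) (meson bij_is_inj bij_simple_refl inj_on_subset subset_UNIV)
  have "sum ?f M = sum ?g M"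
  proof (rule sum.reindex_bij_witness[where i="\<lambda>B. simple_refl i ` B" and j="\<lambda>B. simple_refl i ` B"])
    fix B assume B: "B \<in> M"
    then have "stdz n B \<circ> simple_refl i = stdz n (simple_refl i ` B)"
      by (intro stdz_swap_mixed[OF i]) (auto simp: M_def)
    moreover from this have "stdz n (simple_refl i ` B) \<circ> simple_refl i = stdz n B"
      by (metis comp_simple_refl_twice)
    ultimately show "?g (simple_refl i ` B) = ?f B" by (simp add: cardB)
  qed (auto simp: in' invol)
  moreover have "sum ?f (Pow {1..n} - M) = sum ?g (Pow {1..n} - M)"
  proof (rule sum.cong)
    fix B assume B: "B \<in> Pow {1..n} - M"
    then have "i \<in> B \<longleftrightarrow> Suc i \<in> B" by (auto simp: M_def)
    from stdz_swap_pure[OF i this] obtain j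
      where j: "stdz n B \<circ> simple_refl i = simple_refl j \<circ> stdz n B" by blast
    show "?f B = ?g B" unfolding j by (simp add: hops_delta_symmetric)
  qed simp
  ultimately show ?thesis
    using sum.subset_diff[OF M, of ?f] sum.subset_diff[OF M, of ?g] by simp
qed

lemma hop_delta:
  "hop (<) i (delta v) = (\<lambda>w. delta (v \<circ> simple_refl i) w + (if v i < v (Suc i) then zvar else 0) * delta v w)"
proof
  fix w
  have "w \<circ> simple_refl i = v \<longleftrightarrow> w = v \<circ> simple_refl i"
    by (metis comp_simple_refl_twice)
  then show "hop (<) i (delta v) w = delta (v \<circ> simple_refl i) w + (if v i < v (Suc i) then zvar else 0) * delta v w"
    by (cases "w = v") (simp_all add: hop_def delta_def)
qed

lemma ctrace_rotate1:
  assumes i: "i \<in> {1..<n}"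
  shows "ctrace n t (W (i # ws)) = ctrace n t (W (ws @ [i]))"
proof -
  let ?c = "\<lambda>v :: nat \<Rightarrow> nat. if v i < v (Suc i) then zvar else 0"
  have 1: "W (i # ws) (delta v) v = hops (<) ws (delta v) (v \<circ> simple_refl i) + ?c v * hops (<) ws (delta v) v"
    if "bij v" for v
    using that by (simp add: W_def hops_Cons hop_def)
  have 2: "W (ws @ [i]) (delta v) v = hops (<) ws (delta (v \<circ> simple_refl i)) v + ?c v * hops (<) ws (delta v) v"
    if "bij v" for v
  proof -
    have "W (ws @ [i]) (delta v) v = hops (<) ws (hop (<) i (delta v)) v"
      using that by (simp add: W_def hops_append hops_Cons)
    also have "\<dots> = hops (<) ws (delta (v \<circ> simple_refl i)) v + ?c v * hops (<) ws (delta v) v"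
      by (simp only: hop_delta hops_add hops_cmult)
    finally show ?thesis .
  qed
  show ?thesis
    unfolding ctrace_def by (simp only: 1 2 bij_stdz smult_add_right sum.distrib ctrace_swap[OF i])
qed

lemma ctrace_comm:
  assumes "set xs \<subseteq> {1..<n}"
  shows "ctrace n t (W (xs @ ys)) = ctrace n t (W (ys @ xs))"
  using assms
proof (induction xs arbitrary: ys)
  case (Cons i xs)
  then have "ctrace n t (W ((i # xs) @ ys)) = ctrace n t (W ((xs @ ys) @ [i]))"
    using ctrace_rotate1[of i n t "xs @ ys"] by simp
  also have "\<dots> = ctrace n t (W (ys @ (i # xs)))"
    using Cons.IH[of "ys @ [i]"] Cons.prems by simp
  finally show ?case .
qed simp

section \<open>Length and the Bruhat order\<close>

definition invset :: "(nat \<Rightarrow> nat) \<Rightarrow> (nat \<times> nat) set" where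
  "invset f = {(x, y). x < y \<and> f y < f x}"

lemma invset_id [simp]: "invset id = {}"
  by (auto simp: invset_def)

lemma finite_invset:
  assumes "f permutes {1..n}"
  shows "finite (invset f)"
proof (rule finite_subset)
  show "invset f \<subseteq> {1..n} \<times> {1..n}"
  proof
    fix p assume "p \<in> invset f"
    then obtain x y where p: "p = (x, y)" "x < y" "f y < f x" by (auto simp: invset_def)
    have "y \<in> {1..n}"
      using p permutes_not_in[OF assms, of y] permutes_not_in[OF assms, of x] permutes_in_image[OF assms, of x]
      by (cases "x \<in> {1..n}"; cases "y \<in> {1..n}") auto
    moreover have "x \<noteq> 0" using p permutes_not_in[OF assms, of 0] by (cases "x = 0") auto
    ultimately show "p \<in> {1..n} \<times> {1..n}" using p by auto
  qed
qed simp

lemma invset_step: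
  assumes f: "f permutes {1..n}" and up: "f i < f (Suc i)"
  shows "card (invset (f \<circ> simple_refl i)) = Suc (card (invset f))"
proof -
  let ?s = "simple_refl i"
  have eq: "invset (f \<circ> ?s) = insert (i, Suc i) (map_prod ?s ?s ` invset f)"
  proof (rule Set.set_eqI)
    fix p :: "nat \<times> nat" obtain x y where p: "p = (x, y)" by (cases p)
    have img: "(x, y) \<in> map_prod ?s ?s ` invset f \<longleftrightarrow> (?s x, ?s y) \<in> invset f"
    proof
      assume "(?s x, ?s y) \<in> invset f"
      then have "map_prod ?s ?s (?s x, ?s y) \<in> map_prod ?s ?s ` invset f" by (rule imageI)
      then show "(x, y) \<in> map_prod ?s ?s ` invset f" by simp
    qed auto
    show "p \<in> invset (f \<circ> ?s) \<longleftrightarrow> p \<in> insert (i, Suc i) (map_prod ?s ?s ` invset f)"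
    proof (cases "{x, y} = {i, Suc i}")
      case True
      then consider "x = i" "y = Suc i" | "x = Suc i" "y = i" by (auto simp: doubleton_eq_iff)
      then show ?thesis unfolding p insert_iff img by cases (use up in \<open>simp_all add: invset_def\<close>)
    next
      case False
      then have "p \<noteq> (i, Suc i)" using p by auto
      then show ?thesis unfolding insert_iff p img using False simple_refl_less_iff[of x y i]
        by (cases "x = y") (auto simp: invset_def)
    qed
  qed
  have "(i, Suc i) \<notin> map_prod ?s ?s ` invset f"
  proof
    assume "(i, Suc i) \<in> map_prod ?s ?s ` invset f"
    then obtain a b where "(a, b) \<in> invset f" "?s a = i" "?s b = Suc i" by auto
    moreover from this have "a = Suc i" "b = i" by (metis simple_refl_apply simple_refl_invol')+
    ultimately show False by (auto simp: invset_def)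
  qed
  moreover have "card (map_prod ?s ?s ` invset f) = card (invset f)"
    by (rule card_image, rule inj_onI, clarsimp, metis simple_refl_invol')
  moreover have "finite (map_prod ?s ?s ` invset f)" using finite_invset[OF f] by simp
  ultimately show ?thesis unfolding eq by simp
qed

lemma invset_step_down:
  assumes f: "f permutes {1..n}" and i: "i \<in> {1..<n}" and down: "f (Suc i) < f i"
  shows "card (invset f) = Suc (card (invset (f \<circ> simple_refl i)))"
proof -
  have "f \<circ> simple_refl i permutes {1..n}" using permutes_compose[OF simple_refl_permutes[OF i] f] .
  from invset_step[OF this, of i] down show ?thesis by simp
qed

lemma permutes_descent:
  assumes f: "f permutes {1..n}" and "f \<noteq> id"
  obtains i where "i \<in> {1..<n}" "f (Suc i) < f i"
proof -
  have "\<exists>i \<in> {1..<n}. f (Suc i) < f i"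
  proof (rule ccontr)
    assume "\<not> ?thesis"
    then have up: "f i < f (Suc i)" if "i \<in> {1..<n}" for i
      using that permutes_inj[OF f, THEN inj_eq, of i "Suc i"] by (metis linorder_neqE_nat n_not_Suc_n)
    have mono: "f x < f y" if "x < y" "1 \<le> x" "y \<le> n" for x y
      using that
    proof (induction y)
      case (Suc y)
      then show ?case using up[of y] by (cases "x = y") auto
    qed simp
    have "f = id"
      by (rule permutes_order_unique[OF f permutes_id])
        (metis mono atLeastAtMost_iff id_apply linorder_neqE_nat order_less_asym)
    then show False using assms by simp
  qed
  then show thesis using that by blast
qed

lemma word_prod_simps [simp]:
  "word_prod [] = id" "word_prod (w # ws) = w \<circ> word_prod ws"
  by (simp_all add: word_prod_def)

lemma word_prod_append: "word_prod (xs @ ys) = word_prod xs \<circ> word_prod ys"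
  by (induction xs) (simp_all add: comp_assoc)

lemma word_prod_permutes:
  assumes "set ws \<subseteq> simple_refls n"
  shows "word_prod ws permutes {1..n}"
  using assms
proof (induction ws)
  case (Cons w ws)
  then obtain i where "i \<in> {1..<n}" "w = simple_refl i" by (auto simp: simple_refls_def)
  then have "w permutes {1..n}" using simple_refl_permutes by blast
  moreover have "word_prod ws permutes {1..n}" using Cons by simp
  ultimately have "w \<circ> word_prod ws permutes {1..n}" by (intro permutes_compose)
  then show ?case by (simp only: word_prod_simps)
qed (simp add: permutes_id)

lemma invset_le_length:
  assumes "set ws \<subseteq> simple_refls n"
  shows "card (invset (word_prod ws)) \<le> length ws"
  using assms
proof (induction ws rule: rev_induct)
  case (snoc s ws)
  then obtain i where i: "i \<in> {1..<n}" "s = simple_refl i" by (auto simp: simple_refls_def)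
  let ?f = "word_prod ws"
  have f: "?f permutes {1..n}" using snoc.prems by (intro word_prod_permutes) auto
  have "?f i \<noteq> ?f (Suc i)" using permutes_inj[OF f, THEN inj_eq, of i "Suc i"] by simp
  then consider "?f i < ?f (Suc i)" | "?f (Suc i) < ?f i" by linarith
  then have "card (invset (?f \<circ> s)) \<le> Suc (card (invset ?f))"
    using invset_step[OF f, of i] invset_step_down[OF f i(1)] i(2) by cases auto
  moreover have "card (invset ?f) \<le> length ws" using snoc by simp
  moreover have "word_prod (ws @ [s]) = ?f \<circ> s" by (simp only: word_prod_append word_prod_simps o_id)
  ultimately show ?case by (metis Suc_le_mono le_trans length_append_singleton)
qed simp

lemma reduced_word_exists:
  assumes "f permutes {1..n}"
  shows "\<exists>ws. length ws = card (invset f) \<and> set ws \<subseteq> simple_refls n \<and> word_prod ws = f"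
  using assms
proof (induction "card (invset f)" arbitrary: f rule: less_induct)
  case less
  show ?case
  proof (cases "f = id")
    case True
    then show ?thesis by (intro exI[of _ "[]"]) simp
  next
    case False
    then obtain i where i: "i \<in> {1..<n}" "f (Suc i) < f i" using permutes_descent less.prems by blast
    let ?g = "f \<circ> simple_refl i"
    have c: "card (invset f) = Suc (card (invset ?g))" using invset_step_down[OF less.prems i] .
    moreover have "?g permutes {1..n}" using permutes_compose[OF simple_refl_permutes[OF i(1)] less.prems] .
    ultimately obtain ws where ws: "length ws = card (invset ?g)" "set ws \<subseteq> simple_refls n" "word_prod ws = ?g"
      using less.hyps[of ?g] by auto
    have "simple_refl i \<in> simple_refls n" using i by (simp add: simple_refls_def)
    then show ?thesis using ws c by (intro exI[of _ "ws @ [simple_refl i]"]) (simp add: word_prod_append)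
  qed
qed

text \<open>Each letter changes the number of inversions by at most one, and a permutation other than the
identity has a descent, at which a letter can be split off.\<close>

lemma len_eq_card_invset:
  assumes "f permutes {1..n}"
  shows "len n f = card (invset f)"
  unfolding len_def
proof (rule Least_equality)
  show "\<exists>ws. length ws = card (invset f) \<and> set ws \<subseteq> simple_refls n \<and> word_prod ws = f"
    by (rule reduced_word_exists[OF assms])
qed (use invset_le_length in blast)

lemma card_invset_inv:
  assumes f: "f permutes {1..n}"
  shows "card (invset (inv_into UNIV f)) = card (invset f)"
proof -
  have 1: "inv_into UNIV f (f x) = x" "f (inv_into UNIV f x) = x" for x
    using permutes_inverses[OF f] by auto
  have "invset (inv_into UNIV f) = (\<lambda>(x, y). (f y, f x)) ` invset f"
  proof (intro Set.set_eqI iffI)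
    fix p assume "p \<in> invset (inv_into UNIV f)"
    then obtain a b where "p = (a, b)" "a < b" "inv_into UNIV f b < inv_into UNIV f a" by (auto simp: invset_def)
    then show "p \<in> (\<lambda>(x, y). (f y, f x)) ` invset f"
      by (intro image_eqI[of _ _ "(inv_into UNIV f b, inv_into UNIV f a)"]) (auto simp: invset_def 1)
  qed (auto simp: invset_def 1)
  moreover have "inj_on (\<lambda>(x, y). (f y, f x)) (invset f)"
    by (intro inj_onI) (auto dest!: injD[OF permutes_inj[OF f]])
  ultimately show ?thesis by (simp add: card_image)
qed

lemma len_right_less_iff:
  assumes f: "f permutes {1..n}" and i: "i \<in> {1..<n}"
  shows "len n f < len n (f \<circ> simple_refl i) \<longleftrightarrow> f i < f (Suc i)"
proof -
  have g: "f \<circ> simple_refl i permutes {1..n}" using permutes_compose[OF simple_refl_permutes[OF i] f] .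
  have "f i \<noteq> f (Suc i)" using permutes_inj[OF f, THEN inj_eq, of i "Suc i"] by simp
  then consider "f i < f (Suc i)" | "f (Suc i) < f i" by linarith
  then show ?thesis
    using invset_step[OF f, of i] invset_step_down[OF f i]
    unfolding len_eq_card_invset[OF f] len_eq_card_invset[OF g] by cases linarith+
qed

lemma len_left_less_iff:
  assumes f: "f permutes {1..n}" and i: "i \<in> {1..<n}"
  shows "len n f < len n (simple_refl i \<circ> f) \<longleftrightarrow> inv_into UNIV f i < inv_into UNIV f (Suc i)"
proof -
  have g: "simple_refl i \<circ> f permutes {1..n}" using permutes_compose[OF f simple_refl_permutes[OF i]] .
  have h: "inv_into UNIV f permutes {1..n}" using permutes_inv[OF f] .
  have h': "inv_into UNIV f \<circ> simple_refl i permutes {1..n}" using permutes_compose[OF simple_refl_permutes[OF i] h] .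
  have e: "inv_into UNIV (simple_refl i \<circ> f) = inv_into UNIV f \<circ> simple_refl i"
    using o_inv_distrib[OF bij_simple_refl permutes_bij[OF f]] by simp
  have "len n f = len n (inv_into UNIV f)"
    using card_invset_inv[OF f] by (simp add: len_eq_card_invset[OF f] len_eq_card_invset[OF h])
  moreover have "len n (simple_refl i \<circ> f) = len n (inv_into UNIV f \<circ> simple_refl i)"
    using card_invset_inv[OF g] e by (simp add: len_eq_card_invset[OF g] len_eq_card_invset[OF h'])
  ultimately show ?thesis using len_right_less_iff[OF h i] by simp
qed

text \<open>The permutations \<open>u\<close> and \<open>u s\<^sub>i\<close> differ by a reflection, and a chain of Bruhat steps increases the
length; so the lengths decide.\<close>

lemma bruhat_le_simple_iff:
  assumes u: "u permutes {1..n}" and i: "i \<in> {1..<n}"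
  shows "bruhat_le n u (u \<circ> simple_refl i) \<longleftrightarrow> u i < u (Suc i)"
proof
  assume "bruhat_le n u (u \<circ> simple_refl i)"
  moreover have "x = y \<or> len n x < len n y" if "(bruhat_step n)\<^sup>*\<^sup>* x y" for x y
    using that by (induction rule: rtranclp_induct) (auto simp: bruhat_step_def)
  moreover have "u \<noteq> u \<circ> simple_refl i"
  proof
    assume "u = u \<circ> simple_refl i"
    then have "u i = u (Suc i)" by (metis comp_apply simple_refl_apply(1))
    then show False using permutes_inj[OF u, THEN inj_eq, of i "Suc i"] by simp
  qed
  ultimately show "u i < u (Suc i)"
    using len_right_less_iff[OF u i] by (auto simp: bruhat_le_def)
next
  assume "u i < u (Suc i)"
  moreover have "simple_refl i \<in> refls n"
    unfolding refls_def using i permutes_id[of "{1..n}"]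
    by (intro CollectI exI[of _ id] exI[of _ "simple_refl i"]) (auto simp: sym_group_def simple_refls_def)
  ultimately have "bruhat_step n u (u \<circ> simple_refl i)"
    using len_right_less_iff[OF u i] u by (auto simp: bruhat_step_def sym_group_def)
  then show "bruhat_le n u (u \<circ> simple_refl i)" by (simp add: bruhat_le_def)
qed

section \<open>Distinguished subwords as expansions of operators\<close>

text \<open>Distinguished subwords with arbitrary end point \<open>v'\<close> and number \<open>m\<close> of deletions, the form in which the
first letter can be split off.\<close>

definition Mgen :: "nat \<Rightarrow> (nat \<Rightarrow> nat) \<Rightarrow> (nat \<Rightarrow> nat) list \<Rightarrow> (nat \<Rightarrow> nat) \<Rightarrow> nat \<Rightarrow> (nat \<Rightarrow> nat) list set" where
  "Mgen n v ss v' m = {\<omega>. is_subword \<omega> ss \<and> distinguished n v ss \<omega> \<and>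
     v \<circ> partial_prod \<omega> (length ss) = v' \<and> card {i. i < length ss \<and> \<omega> ! i = id} = m}"

lemma simple_refl_neq_id [simp]: "simple_refl i \<noteq> id" "id \<noteq> simple_refl i"
  by (metis id_apply n_not_Suc_n simple_refl_apply(1))+

lemma partial_prod_Cons [simp]:
  "partial_prod \<omega> 0 = id"
  "partial_prod (w # \<omega>) (Suc m) = w \<circ> partial_prod \<omega> m"
  by (simp_all add: partial_prod_def)

lemma is_subword_Cons: "is_subword (w # \<omega>) (s # ss) \<longleftrightarrow> w \<in> {id, s} \<and> is_subword \<omega> ss"
  by (auto simp: is_subword_def All_less_Suc2)

lemma distinguished_Cons:
  "distinguished n v (s # ss) (w # \<omega>) \<longleftrightarrow> bruhat_le n (v \<circ> w) (v \<circ> s) \<and> distinguished n (v \<circ> w) ss \<omega>"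
  by (simp add: distinguished_def All_less_Suc2 comp_assoc)

lemma card_id_Cons:
  "card {i. i < Suc m \<and> (w # \<omega>) ! i = id} = (if w = id then 1 else 0) + card {i. i < m \<and> \<omega> ! i = id}"
proof -
  have "{i. i < Suc m \<and> (w # \<omega>) ! i = id} = (if w = id then {0} else {}) \<union> Suc ` {i. i < m \<and> \<omega> ! i = id}"
    by (auto simp: less_Suc_eq_0_disj)
  moreover have "card (Suc ` {i. i < m \<and> \<omega> ! i = id}) = card {i. i < m \<and> \<omega> ! i = id}"
    by (rule card_image) simp
  ultimately show ?thesis by (auto simp: card_insert_if)
qed

text \<open>Keeping a letter is always distinguished, as the two sides of the Bruhat condition are equal;
deleting it is distinguished iff \<open>v \<le> v s\<^sub>i\<close>. This is the recursion that defines \<open>hop\<close>.\<close>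

lemma Mgen_Cons:
  assumes v: "v permutes {1..n}" and i: "i \<in> {1..<n}"
  shows "Mgen n v (simple_refl i # ss) v' m =
    (#) (simple_refl i) ` Mgen n (v \<circ> simple_refl i) ss v' m \<union>
    (if v i < v (Suc i) then (#) id ` (case m of 0 \<Rightarrow> {} | Suc m' \<Rightarrow> Mgen n v ss v' m') else {})"
proof (rule Set.set_eqI)
  fix \<omega>
  show "\<omega> \<in> Mgen n v (simple_refl i # ss) v' m \<longleftrightarrow> \<omega> \<in> (#) (simple_refl i) ` Mgen n (v \<circ> simple_refl i) ss v' m \<union>
    (if v i < v (Suc i) then (#) id ` (case m of 0 \<Rightarrow> {} | Suc m' \<Rightarrow> Mgen n v ss v' m') else {})"
  proof (cases \<omega>)
    case Nil
    then show ?thesis by (auto simp: Mgen_def is_subword_def)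
  next
    case (Cons w \<omega>')
    have r: "bruhat_le n x x" for x by (simp add: bruhat_le_def)
    have m: "w # \<omega>' \<in> Mgen n v (simple_refl i # ss) v' m \<longleftrightarrow> w \<in> {id, simple_refl i} \<and>
      bruhat_le n (v \<circ> w) (v \<circ> simple_refl i) \<and> \<omega>' \<in> Mgen n (v \<circ> w) ss v' (card {i. i < length ss \<and> \<omega>' ! i = id}) \<and>
      m = (if w = id then 1 else 0) + card {i. i < length ss \<and> \<omega>' ! i = id}"
      unfolding Mgen_def mem_Collect_eq is_subword_Cons distinguished_Cons list.size add_0_right add_Suc_right partial_prod_Cons card_id_Cons comp_assoc
      by auto
    have c: "\<omega>' \<in> Mgen n u ss v' m' \<Longrightarrow> card {i. i < length ss \<and> \<omega>' ! i = id} = m'" for u m'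
      by (simp add: Mgen_def)
    show ?thesis unfolding Cons m
    proof (cases "w = id")
      case True
      then show "(w \<in> {id, simple_refl i} \<and>
      bruhat_le n (v \<circ> w) (v \<circ> simple_refl i) \<and> \<omega>' \<in> Mgen n (v \<circ> w) ss v' (card {i. i < length ss \<and> \<omega>' ! i = id}) \<and>
      m = (if w = id then 1 else 0) + card {i. i < length ss \<and> \<omega>' ! i = id}) \<longleftrightarrow> 
       w # \<omega>' \<in> (#) (simple_refl i) ` Mgen n (v \<circ> simple_refl i) ss v' m \<union>
    (if v i < v (Suc i) then (#) id ` (case m of 0 \<Rightarrow> {} | Suc m' \<Rightarrow> Mgen n v ss v' m') else {})"
        using c[of v] by (cases m) (auto simp: bruhat_le_simple_iff[OF v i])
    next
      case False
      then show "(w \<in> {id, simple_refl i} \<and>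
      bruhat_le n (v \<circ> w) (v \<circ> simple_refl i) \<and> \<omega>' \<in> Mgen n (v \<circ> w) ss v' (card {i. i < length ss \<and> \<omega>' ! i = id}) \<and>
      m = (if w = id then 1 else 0) + card {i. i < length ss \<and> \<omega>' ! i = id}) \<longleftrightarrow> 
       w # \<omega>' \<in> (#) (simple_refl i) ` Mgen n (v \<circ> simple_refl i) ss v' m \<union>
    (if v i < v (Suc i) then (#) id ` (case m of 0 \<Rightarrow> {} | Suc m' \<Rightarrow> Mgen n v ss v' m') else {})"
        using c[of "v \<circ> w"] r by auto
    qed
  qed
qed

lemma card_Mgen:
  assumes "v permutes {1..n}" "set ws \<subseteq> {1..<n}"
  shows "finite (Mgen n v (map simple_refl ws) v' m) \<and>
    real (card (Mgen n v (map simple_refl ws) v' m)) = coeff (hops (<) ws (delta v') v) m"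
  using assms
proof (induction ws arbitrary: v m)
  case Nil
  have "Mgen n v [] v' m = (if v = v' \<and> m = 0 then {[]} else {})"
    by (auto simp: Mgen_def is_subword_def distinguished_def)
  then show ?case by (auto simp: delta_def coeff_1)
next
  case (Cons i ws)
  then have i: "i \<in> {1..<n}" and ws: "set ws \<subseteq> {1..<n}" by auto
  have vs: "v \<circ> simple_refl i permutes {1..n}" using permutes_compose[OF simple_refl_permutes[OF i] Cons.prems(1)] .
  let ?A = "(#) (simple_refl i) ` Mgen n (v \<circ> simple_refl i) (map simple_refl ws) v' m"
  let ?B = "if v i < v (Suc i) then (#) id ` (case m of 0 \<Rightarrow> {} | Suc m' \<Rightarrow> Mgen n v (map simple_refl ws) v' m') else {}"
  have A: "finite ?A" "real (card ?A) = coeff (hops (<) ws (delta v') (v \<circ> simple_refl i)) m"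
  proof -
    note IH = Cons.IH[OF vs ws, of m]
    from IH show "finite ?A" by (intro finite_imageI) (rule conjunct1)
    have "card ?A = card (Mgen n (v \<circ> simple_refl i) (map simple_refl ws) v' m)"
      by (rule card_image) simp
    then show "real (card ?A) = coeff (hops (<) ws (delta v') (v \<circ> simple_refl i)) m"
      using conjunct2[OF IH] by (simp only:)
  qed
  have B: "finite ?B \<and> real (card ?B) = coeff (if v i < v (Suc i) then zvar * hops (<) ws (delta v') v else 0) m"
    using Cons.IH[OF Cons.prems(1) ws] by (cases m) (simp_all add: card_image zvar_def)
  have "?A \<inter> ?B = {}" by auto
  then have "card (?A \<union> ?B) = card ?A + card ?B" using A B card_Un_disjoint by blast
  then show ?case using A B
    by (simp only: list.map Mgen_Cons[OF Cons.prems(1) i] hops_Cons hop_def coeff_add finite_Un of_nat_add)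
qed

lemma card_M_set:
  assumes "v permutes {1..n}" "set ws \<subseteq> {1..<n}"
  shows "real (card (M_set n v (map simple_refl ws))) = coeff (W ws (delta v) v) (n - 1)"
proof -
  have "v \<circ> f = v \<longleftrightarrow> f = id" for f :: "nat \<Rightarrow> nat"
    using permutes_inj[OF assms(1)] by (auto simp: fun_eq_iff inj_eq)
  then have "M_set n v (map simple_refl ws) = Mgen n v (map simple_refl ws) v (n - 1)"
    by (auto simp: M_set_def D_set_def Mgen_def)
  then show ?thesis using card_Mgen[OF assms, of v "n - 1"] permutes_bij[OF assms(1)] by (simp add: W_def)
qed

section \<open>Ascent sets\<close>

lemma inj_simple_refl: "simple_refl i = simple_refl j \<longleftrightarrow> i = j"
proof
  assume "simple_refl i = simple_refl j"
  then have "simple_refl j i = Suc i" by (metis simple_refl_apply(1))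
  then show "i = j" by (cases "i = Suc j"; cases "i = j") auto
qed auto

lemma Asc_eq_iff:
  assumes v: "v permutes {1..n}" and k: "k < n"
  shows "Asc n v = I_set n k \<longleftrightarrow> (\<forall>j\<in>{1..<n}. inv_into UNIV v j < inv_into UNIV v (Suc j) \<longleftrightarrow> j < n - k)"
proof -
  have "Asc n v = simple_refl ` {j \<in> {1..<n}. inv_into UNIV v j < inv_into UNIV v (Suc j)}"
    unfolding Asc_def simple_refls_def using len_left_less_iff[OF v] by blast
  moreover have "I_set n k = simple_refl ` {j \<in> {1..<n}. j < n - k}"
    unfolding I_set_def by (rule arg_cong[where f="image simple_refl"]) (use k in auto)
  moreover have "inj simple_refl" by (auto simp: inj_def inj_simple_refl)
  ultimately have "Asc n v = I_set n k \<longleftrightarrow>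
     {j \<in> {1..<n}. inv_into UNIV v j < inv_into UNIV v (Suc j)} = {j \<in> {1..<n}. j < n - k}"
    by (simp only: inj_image_eq_iff)
  also have "\<dots> \<longleftrightarrow> (\<forall>j\<in>{1..<n}. inv_into UNIV v j < inv_into UNIV v (Suc j) \<longleftrightarrow> j < n - k)"
    by blast
  finally show ?thesis .
qed

lemma stdz_gt_iff:
  assumes B: "B \<subseteq> {1..n}" and x: "x \<in> {1..n}"
  shows "n - card B < stdz n B x \<longleftrightarrow> x \<in> B"
proof (cases "x \<in> B")
  case True
  have "card (B \<inter> {1..x}) \<le> card B" using B finite_subset by (intro card_mono) auto
  moreover have "card B \<le> card {1..n}" using B by (intro card_mono) auto
  ultimately show ?thesis using True x by (auto simp: stdz_def)
next
  case False
  have "card ({1..x} - B) \<le> card ({1..n} - B)" using x by (intro card_mono) auto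
  also have "\<dots> = n - card B" using B by (subst card_Diff_subset) (auto intro: finite_subset)
  finally show ?thesis using False x by (auto simp: stdz_def)
qed

text \<open>The inverse of \<open>stdz n B\<close> lists the points outside \<open>B\<close> increasingly, ending with \<open>n\<close>, and then those of
\<open>B\<close> decreasingly; so the ascents are an initial segment.\<close>

lemma Asc_stdz:
  assumes B: "B \<subseteq> {1..<n}" and n: "0 < n"
  shows "Asc n (stdz n B) = I_set n (card B)"
proof -
  let ?v = "stdz n B" and ?k = "card B"
  have B': "B \<subseteq> {1..n}" using B by auto
  have k: "?k < n" using card_mono[OF _ B] n by simp
  have nB: "n \<notin> B" using B by auto
  show ?thesis unfolding Asc_eq_iff[OF stdz_permutes k]
  proof
    fix j assume j: "j \<in> {1..<n}"
    let ?x = "inv_into UNIV ?v j" and ?y = "inv_into UNIV ?v (Suc j)"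
    have xy: "?v ?x = j" "?v ?y = Suc j" by (simp_all add: bij_is_surj surj_f_inv_f)
    have in': "?x \<in> {1..n}" "?y \<in> {1..n}"
      using permutes_in_image[OF permutes_inv[OF stdz_permutes[of n B]], of j]
        permutes_in_image[OF permutes_inv[OF stdz_permutes[of n B]], of "Suc j"] j by auto
    have cl: "col_less B ?x ?y" using stdz_less_iff[OF in', of B] xy by simp
    have xB: "?x \<in> B \<longleftrightarrow> n - ?k < j" "?y \<in> B \<longleftrightarrow> n - ?k < Suc j"
      using stdz_gt_iff[OF B' in'(1)] stdz_gt_iff[OF B' in'(2)] unfolding xy by auto
    have vn: "?v n = n - ?k"
    proof -
      have "?v n = card ({1..n} - B)" using nB n by (simp add: stdz_def)
      then show ?thesis using B' by (subst (asm) card_Diff_subset) (auto intro: finite_subset)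
    qed
    show "?x < ?y \<longleftrightarrow> j < n - ?k"
    proof (cases "j = n - ?k")
      case True
      then have "?x = n" using vn xy permutes_inj[OF stdz_permutes] by (metis injD)
      then show ?thesis using True in' by auto
    next
      case False
      then show ?thesis using xB cl by (auto simp: col_less_def split: if_splits)
    qed
  qed
qed

text \<open>If \<open>Asc v = I_k\<close>, then the inverse of \<open>v\<close> rises up to the argument \<open>n - k\<close> and falls afterwards; \<open>B\<close>
consists of the entries after the peak.\<close>

lemma Asc_imp_stdz:
  assumes v: "v permutes {1..n}" and k: "k < n" and A: "Asc n v = I_set n k"
  shows "\<exists>B. B \<subseteq> {1..<n} \<and> card B = k \<and> v = stdz n B"
proof -
  let ?i = "inv_into UNIV v"
  have iv: "?i (v x) = x" "v (?i x) = x" for x using permutes_inverses[OF v] by auto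
  have st: "?i j < ?i (Suc j) \<longleftrightarrow> j < n - k" if "j \<in> {1..<n}" for j
    using A that unfolding Asc_eq_iff[OF v k] by blast
  have ne: "?i j \<noteq> ?i (Suc j)" for j by (metis iv(2) n_not_Suc_n)
  have up: "?i a < ?i b" if "a < b" "1 \<le> a" "b \<le> n - k" for a b
    using that
  proof (induction b)
    case (Suc b)
    have "?i b < ?i (Suc b)" using Suc.prems st[of b] by auto
    with Suc show ?case by (cases "a = b") auto
  qed simp
  have down: "?i b < ?i a" if "a < b" "n - k \<le> a" "b \<le> n" for a b
    using that
  proof (induction b)
    case (Suc b)
    have "1 \<le> b" "b < n" using Suc.prems k by arith+
    then have "?i (Suc b) < ?i b" using Suc.prems st[of b] ne[of b] by auto
    with Suc show ?case by (cases "a = b") auto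
  qed simp
  have in': "v x \<in> {1..n} \<longleftrightarrow> x \<in> {1..n}" "?i x \<in> {1..n} \<longleftrightarrow> x \<in> {1..n}" for x
    using permutes_in_image[OF v] permutes_in_image[OF permutes_inv[OF v]] by auto
  \<comment> \<open>The peak of the inverse is the value \<open>n\<close>, attained at \<open>n - k\<close>; so \<open>n\<close> does not belong to \<open>B\<close>.\<close>
  define B where "B = {x \<in> {1..n}. n - k < v x}"
  have vn: "v n = n - k"
  proof -
    have "?i (n - k) \<ge> ?i b" if "b \<in> {1..n}" for b
      using up[of b "n - k"] down[of "n - k" b] that k by (cases b "n - k" rule: linorder_cases) auto
    from this[of "v n"] have "?i (n - k) \<ge> n" using in'(1)[of n] k by (simp add: iv)
    moreover have "?i (n - k) \<in> {1..n}"
    proof -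
      have "n - k \<in> {1..n}" using k by auto
      then show ?thesis by (simp only: in'(2))
    qed
    ultimately have "?i (n - k) = n" by simp
    then show ?thesis using iv(2) by metis
  qed
  have "v ` B = {n - k<..n}"
  proof -
    have "z \<in> v ` B" if "z \<in> {n - k<..n}" for z
      by (rule image_eqI[of _ _ "?i z"]) (use that in'(2)[of z] in \<open>auto simp: B_def iv\<close>)
    moreover have "v x \<in> {n - k<..n}" if "x \<in> B" for x
      using that in'(1)[of x] by (simp add: B_def)
    ultimately show ?thesis by (intro subset_antisym subsetI) auto
  qed
  then have "card B = k" using card_image[OF inj_on_subset[OF permutes_inj[OF v]], of B] k by simp
  moreover have "B \<subseteq> {1..<n}" 
  proof
    fix x assume x: "x \<in> B"
    then have "x \<noteq> n" using vn by (auto simp: B_def)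
    with x show "x \<in> {1..<n}" by (auto simp: B_def)
  qed
  moreover have "v = stdz n B"
  proof (rule permutes_order_unique[OF v stdz_permutes])
    fix x y assume xy: "x \<in> {1..n}" "y \<in> {1..n}" "x \<noteq> y"
    have "v x < v y \<longleftrightarrow> col_less B x y"
    proof -
      have vv: "v x \<in> {1..n}" "v y \<in> {1..n}" "v x \<noteq> v y"
        using in'(1) xy injD[OF permutes_inj[OF v], of x y] by auto
      consider "v x \<le> n - k" "v y \<le> n - k" | "v x \<le> n - k" "n - k < v y"
        | "n - k < v x" "v y \<le> n - k" | "n - k < v x" "n - k < v y" by linarith
      then show ?thesis
      proof cases
        case 1
        then have B: "x \<notin> B" "y \<notin> B" by (simp_all add: B_def)
        have "v x < v y \<Longrightarrow> x < y" "v y < v x \<Longrightarrow> y < x"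
          using up[of "v x" "v y"] up[of "v y" "v x"] vv 1 by (simp_all add: iv)
        then show ?thesis using B vv(3) by (simp add: col_less_def) linarith
      next
        case 4
        then have B: "x \<in> B" "y \<in> B" using xy(1,2) by (simp_all add: B_def)
        have "v x < v y \<Longrightarrow> y < x" "v y < v x \<Longrightarrow> x < y"
          using down[of "v x" "v y"] down[of "v y" "v x"] vv 4 by (simp_all add: iv)
        then show ?thesis using B vv(3) by (simp add: col_less_def) linarith
      next
        case 2
        then have "x \<notin> B" "y \<in> B" "v x < v y" using xy(1,2) by (simp_all add: B_def)
        then show ?thesis by (simp add: col_less_def)
      next
        case 3
        then have "x \<in> B" "y \<notin> B" "\<not> v x < v y" using xy(1,2) by (simp_all add: B_def)
        then show ?thesis by (simp add: col_less_def)
      qed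
    qed
    then show "v x < v y \<longleftrightarrow> stdz n B x < stdz n B y" using stdz_less_iff xy by blast
  qed
  ultimately show ?thesis by blast
qed

lemma sum_Asc_eq:
  assumes k: "k < n"
  shows "(\<Sum>v\<in>{v \<in> sym_group n. Asc n v = I_set n k}. f v) =
    (\<Sum>B\<in>{B \<in> Pow {1..<n}. card B = k}. f (stdz n B))"
proof -
  have n: "0 < n" using k by simp
  have "bij_betw (stdz n) {B \<in> Pow {1..<n}. card B = k} {v \<in> sym_group n. Asc n v = I_set n k}"
  proof (rule bij_betw_imageI)
    show "inj_on (stdz n) {B \<in> Pow {1..<n}. card B = k}"
    proof (rule inj_onI)
      fix B B' assume a: "B \<in> {B \<in> Pow {1..<n}. card B = k}" "B' \<in> {B \<in> Pow {1..<n}. card B = k}" "stdz n B = stdz n B'"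
      have "C = {x \<in> {1..n}. n - k < stdz n C x}" if "C \<in> {B \<in> Pow {1..<n}. card B = k}" for C
      proof -
        have "C \<subseteq> {1..n}" "card C = k" using that by auto
        then show ?thesis using stdz_gt_iff[of C n] by auto
      qed
      from this[OF a(1)] this[OF a(2)] show "B = B'" unfolding a(3) by (rule trans[OF _ sym])
    qed
    show "stdz n ` {B \<in> Pow {1..<n}. card B = k} = {v \<in> sym_group n. Asc n v = I_set n k}"
    proof (intro subset_antisym subsetI)
      fix v assume "v \<in> {v \<in> sym_group n. Asc n v = I_set n k}"
      then have "v permutes {1..n}" "Asc n v = I_set n k" by (simp_all add: sym_group_def)
      from Asc_imp_stdz[OF this(1) k this(2)]
      show "v \<in> stdz n ` {B \<in> Pow {1..<n}. card B = k}" by blast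
    next
      fix v assume "v \<in> stdz n ` {B \<in> Pow {1..<n}. card B = k}"
      then obtain B where "B \<subseteq> {1..<n}" "card B = k" "v = stdz n B" by blast
      then show "v \<in> {v \<in> sym_group n. Asc n v = I_set n k}"
        using Asc_stdz[OF _ n] stdz_permutes by (simp add: sym_group_def)
    qed
  qed
  from sum.reindex_bij_betw[OF this, of f] show ?thesis by simp
qed

text \<open>The point \<open>n\<close> is the last one outside \<open>B\<close> or the first one in \<open>B\<close>, which is the same place in the order.\<close>

lemma stdz_insert_last:
  assumes B: "B \<subseteq> {1..<n}"
  shows "stdz n (insert n B) = stdz n B"
proof (rule permutes_order_unique[OF stdz_permutes stdz_permutes])
  fix x y assume xy: "x \<in> {1..n}" "y \<in> {1..n}" "x \<noteq> y"
  then have "col_less (insert n B) x y \<longleftrightarrow> col_less B x y"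
    using B by (cases "x = n"; cases "y = n") (auto simp: col_less_def)
  then show "stdz n (insert n B) x < stdz n (insert n B) y \<longleftrightarrow> stdz n B x < stdz n B y"
    using stdz_less_iff xy by blast
qed

text \<open>By \<open>stdz_insert_last\<close> the subsets of \<open>{1..n}\<close> come in pairs with equal standardizations, whence the
factor \<open>1 + t\<close>.\<close>

lemma ctrace_eq_ascents:
  assumes n: "0 < n" and ws: "set ws \<subseteq> {1..<n}"
  shows "coeff (ctrace n t (W ws)) (n - 1) = (1 + t) * (\<Sum>k<n. t ^ k *
     real (\<Sum>v\<in>{v \<in> sym_group n. Asc n v = I_set n k}. card (M_set n v (map simple_refl ws))))"
proof -
  define f where "f B = real (card (M_set n (stdz n B) (map simple_refl ws)))" for B
  have f: "coeff (W ws (delta (stdz n B)) (stdz n B)) (n - 1) = f B" for B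
    unfolding f_def by (rule card_M_set[symmetric, OF stdz_permutes ws])
  have P: "Pow {1..n} = Pow {1..<n} \<union> insert n ` Pow {1..<n}"
  proof -
    have "{1..n} = insert n {1..<n}" using n by auto
    then show ?thesis by (simp add: Pow_insert)
  qed
  have fi: "f (insert n B) = f B" "card (insert n B) = Suc (card B)" if "B \<in> Pow {1..<n}" for B
  proof -
    have "finite B" "n \<notin> B" using that finite_subset by auto
    then show "f (insert n B) = f B" "card (insert n B) = Suc (card B)"
      using that by (auto simp: f_def stdz_insert_last)
  qed
  have "coeff (ctrace n t (W ws)) (n - 1) = (\<Sum>B\<in>Pow {1..n}. t ^ card B * f B)"
    by (simp add: ctrace_def coeff_sum f[simplified])
  also have "\<dots> = (\<Sum>B\<in>Pow {1..<n}. t ^ card B * f B) + (\<Sum>B\<in>insert n ` Pow {1..<n}. t ^ card B * f B)"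
    unfolding P by (rule sum.union_disjoint) auto
  also have "(\<Sum>B\<in>insert n ` Pow {1..<n}. t ^ card B * f B) = (\<Sum>B\<in>Pow {1..<n}. t * (t ^ card B * f B))"
  proof (subst sum.reindex)
    show "inj_on (insert n) (Pow {1..<n})" 
    proof (rule inj_onI)
      fix x y assume "x \<in> Pow {1..<n}" "y \<in> Pow {1..<n}" and e: "insert n x = insert n y"
      then have "n \<notin> x" "n \<notin> y" by auto
      with e show "x = y" by (simp add: insert_ident)
    qed
  qed (simp add: fi ac_simps)
  also have "(\<Sum>B\<in>Pow {1..<n}. t ^ card B * f B) + \<dots> = (1 + t) * (\<Sum>B\<in>Pow {1..<n}. t ^ card B * f B)"
    by (simp add: sum_distrib_left sum.distrib[symmetric] algebra_simps)
  also have "(\<Sum>B\<in>Pow {1..<n}. t ^ card B * f B) =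
      (\<Sum>k<n. \<Sum>B\<in>{B \<in> Pow {1..<n}. card B = k}. t ^ card B * f B)"
  proof (rule sum.group[symmetric])
    have "card B < n" if "B \<subseteq> {1..<n}" for B using card_mono[OF _ that] n by simp
    then show "card ` Pow {1..<n} \<subseteq> {..<n}" by auto
  qed auto
  also have "\<dots> = (\<Sum>k<n. t ^ k * (\<Sum>B\<in>{B \<in> Pow {1..<n}. card B = k}. f B))"
    by (simp add: sum_distrib_left)
  also have "\<dots> = (\<Sum>k<n. t ^ k *
     real (\<Sum>v\<in>{v \<in> sym_group n. Asc n v = I_set n k}. card (M_set n v (map simple_refl ws))))"
    by (rule sum.cong) (simp_all add: sum_Asc_eq f_def)
  finally show ?thesis .
qed

section \<open>Jucys--Murphy words\<close>

lemma W_cong: "W ys = W ys' \<Longrightarrow> W (xs @ ys @ zs) = W (xs @ ys' @ zs)"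
  by (simp only: W_append)

lemma W_commute_words:
  assumes "\<And>k. k \<in> set ys \<Longrightarrow> W ([k] @ xs) = W (xs @ [k])"
  shows "W (ys @ xs) = W (xs @ ys)"
  using assms
proof (induction ys)
  case (Cons k ys)
  have "W ((k # ys) @ xs) = W ([k] @ (ys @ xs) @ [])" by simp
  also have "\<dots> = W ([k] @ (xs @ ys) @ [])" using Cons by (intro W_cong) auto
  also have "\<dots> = W ([] @ ([k] @ xs) @ ys)" by simp
  also have "\<dots> = W ([] @ (xs @ [k]) @ ys)" using Cons.prems by (intro W_cong) auto
  finally show ?case by simp
qed simp

text \<open>The word \<open>s\<^bsub>m-1\<^esub> \<dots> s\<^sub>1 s\<^sub>1 \<dots> s\<^bsub>m-1\<^esub>\<close> of the Jucys--Murphy element \<open>J\<^sub>m\<close>. These elements commute with each other, and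
\<open>J\<^sub>m\<close> commutes with every generator except those with indices \<open>m - 1\<close> and \<open>m\<close>.\<close>

fun jw :: "nat \<Rightarrow> nat list" where
  "jw (Suc (Suc m)) = Suc m # jw (Suc m) @ [Suc m]"
| "jw _ = []"

lemma set_jw: "set (jw m) \<subseteq> {1..<m}"
  by (induction m rule: jw.induct) auto

lemma W_commute': "Suc i < j \<or> Suc j < i \<Longrightarrow> W ([i] @ [j]) = W ([j] @ [i])"
  using W_commute[of i j] W_commute[of j i] by auto

lemma jw_commute_above: "m < k \<Longrightarrow> W ([k] @ jw m) = W (jw m @ [k])"
proof (rule W_commute_words[symmetric])
  fix l assume "m < k" "l \<in> set (jw m)"
  with set_jw[of m] have "Suc l < k" by auto
  then show "W ([l] @ [k]) = W ([k] @ [l])" by (intro W_commute') auto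
qed

text \<open>By induction on \<open>m\<close>: the outer letters commute with \<open>s\<^sub>k\<close> unless \<open>k = m - 2\<close>. In that case a braid relation turns
\<open>s\<^sub>k\<close> into \<open>s\<^bsub>k+1\<^esub>\<close>, which commutes with the inner part, and another one turns it back.\<close>

lemma jw_commute_below: "1 \<le> k \<Longrightarrow> Suc k < m \<Longrightarrow> W ([k] @ jw m) = W (jw m @ [k])"
proof (induction m rule: jw.induct)
  case (1 m)
  let ?M = "Suc m"
  show ?case
  proof (cases "k = m")
    case False
    then have "Suc k < ?M" using 1 by simp
    have c: "W ([k] @ [?M]) = W ([?M] @ [k])" by (rule W_commute') (use \<open>Suc k < ?M\<close> in auto)
    have "W ([k] @ jw (Suc ?M)) = W ([] @ ([k] @ [?M]) @ jw ?M @ [?M])" by simp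
    also have "\<dots> = W ([?M] @ ([k] @ jw ?M) @ [?M])" by (subst W_cong[OF c]) simp
    also have "\<dots> = W ([?M] @ (jw ?M @ [k]) @ [?M])"
      by (rule W_cong, rule "1.IH") (use 1 \<open>Suc k < ?M\<close> in auto)
    also have "\<dots> = W (([?M] @ jw ?M) @ ([k] @ [?M]) @ [])" by simp
    also have "\<dots> = W (jw (Suc ?M) @ [k])" by (subst W_cong[OF c]) simp
    finally show ?thesis .
  next
    case True
    then obtain l where l: "m = Suc l" using 1 by (cases m) auto
    have c: "W ([?M] @ jw m) = W (jw m @ [?M])" by (rule jw_commute_above) simp
    have b: "W [m, ?M, m] = W [?M, m, ?M]" by (rule W_braid)
    have "W ([k] @ jw (Suc ?M)) = W ([] @ [m, ?M, m] @ (jw m @ [m, ?M]))" by (simp add: l True)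
    also have "\<dots> = W ([?M, m] @ ([?M] @ jw m) @ [m, ?M])" by (subst W_cong[OF b]) simp
    also have "\<dots> = W (([?M, m] @ jw m) @ [?M, m, ?M] @ [])" by (subst W_cong[OF c]) simp
    also have "\<dots> = W (([?M, m] @ jw m) @ [m, ?M, m] @ [])" by (subst W_cong[OF b]) simp
    also have "\<dots> = W (jw (Suc ?M) @ [k])" by (simp add: l True)
    finally show ?thesis .
  qed
qed auto

lemma jw_commute: "W (jw m @ jw l) = W (jw l @ jw m)"
proof -
  have *: "W (jw m @ jw l) = W (jw l @ jw m)" if "m < l" for m l
    by (rule W_commute_words, rule jw_commute_below) (use set_jw[of m] that in auto)
  show ?thesis using *[of m l] *[of l m] by (cases m l rule: linorder_cases) auto
qed

definition jp :: "(nat \<Rightarrow> nat) \<Rightarrow> nat \<Rightarrow> nat list" where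
  "jp a l = concat (replicate (a l) (jw l))"

text \<open>The monomial in the Jucys--Murphy elements with exponents \<open>a\<close>.\<close>

definition jpow :: "nat \<Rightarrow> (nat \<Rightarrow> nat) \<Rightarrow> nat list" where
  "jpow n a = concat (map (jp a) [1..<Suc n])"

lemma jpow_0 [simp]: "jpow 0 a = []" and jpow_Suc: "jpow (Suc n) a = jpow n a @ jp a (Suc n)"
  by (simp_all add: jpow_def)

lemma set_jp: "set (jp a l) \<subseteq> {1..<l}" using set_jw[of l] by (auto simp: jp_def)

lemma set_jpow: "set (jpow n a) \<subseteq> {1..<n}"
  by (induction n) (use set_jp in \<open>fastforce simp: jpow_Suc\<close>)+

lemma jp_commute: "W (jw m @ jp a l) = W (jp a l @ jw m)"
proof -
  have "W (jw m @ concat (replicate k (jw l))) = W (concat (replicate k (jw l)) @ jw m)" for k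
  proof (induction k)
    case (Suc k)
    have "W (jw m @ concat (replicate (Suc k) (jw l))) = W ([] @ (jw m @ jw l) @ concat (replicate k (jw l)))" by simp
    also have "\<dots> = W (jw l @ (jw m @ concat (replicate k (jw l))) @ [])" by (subst W_cong[OF jw_commute]) simp
    also have "\<dots> = W (jw l @ (concat (replicate k (jw l)) @ jw m) @ [])" by (rule W_cong[OF Suc])
    finally show ?case by simp
  qed simp
  then show ?thesis by (simp add: jp_def)
qed

lemma jpow_commute: "W (jw m @ jpow n a) = W (jpow n a @ jw m)"
proof (induction n)
  case (Suc n)
  have "W (jw m @ jpow (Suc n) a) = W ([] @ (jw m @ jpow n a) @ jp a (Suc n))" by (simp add: jpow_Suc)
  also have "\<dots> = W (jpow n a @ (jw m @ jp a (Suc n)) @ [])" by (subst W_cong[OF Suc]) simp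
  also have "\<dots> = W (jpow n a @ (jp a (Suc n) @ jw m) @ [])" by (rule W_cong[OF jp_commute])
  finally show ?case by (simp add: jpow_Suc)
qed simp

lemma jpow_cong: "(\<And>l. l \<in> {1..n} \<Longrightarrow> a l = b l) \<Longrightarrow> jpow n a = jpow n b"
  unfolding jpow_def jp_def by (rule arg_cong[where f=concat], rule map_cong) auto

lemma jpow_upd: "l \<in> {1..n} \<Longrightarrow> W (jpow n (a(l := Suc (a l)))) = W (jpow n a @ jw l)"
proof (induction n)
  case (Suc n)
  show ?case
  proof (cases "l = Suc n")
    case True
    have "jpow n (a(l := Suc (a l))) = jpow n a" by (rule jpow_cong) (simp add: True)
    moreover have "W (jw l @ jp a l) = W (jp a l @ jw l)" by (rule jp_commute)
    from W_cong[OF this, of "jpow n a" "[]"]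
    have "W (jpow n a @ jw l @ jp a l) = W (jpow n a @ jp a l @ jw l)" by simp
    moreover have "jp (a(l := Suc (a l))) (Suc n) = jw l @ jp a l" by (simp add: True jp_def)
    ultimately show ?thesis by (simp only: jpow_Suc True append_assoc)
  next
    case False
    then have l: "l \<in> {1..n}" using Suc.prems by auto
    have "jp (a(l := Suc (a l))) (Suc n) = jp a (Suc n)" using False by (simp add: jp_def)
    then have "W (jpow (Suc n) (a(l := Suc (a l)))) = W ([] @ jpow n (a(l := Suc (a l))) @ jp a (Suc n))"
      by (simp add: jpow_Suc)
    also have "\<dots> = W (jpow n a @ (jw l @ jp a (Suc n)) @ [])" by (subst W_cong[OF Suc.IH[OF l]]) simp
    also have "\<dots> = W (jpow n a @ (jp a (Suc n) @ jw l) @ [])" by (rule W_cong[OF jp_commute])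
    finally show ?thesis by (simp only: jpow_Suc append_assoc append_Nil2)
  qed
qed simp

section \<open>The skein recursion\<close>

lemma ctrace_linear:
  assumes "\<And>g u. W A g u = W A1 g u + zvar * W A2 g u"
  shows "ctrace n t (W A) = ctrace n t (W A1) + zvar * ctrace n t (W A2)"
  unfolding ctrace_def assms by (simp add: smult_add_right sum.distrib sum_distrib_left)

text \<open>Let \<open>C = L s\<^sub>i R\<close> be the standard Coxeter word. Since \<open>J\<^bsub>i+1\<^esub> = s\<^sub>i J\<^sub>i s\<^sub>i\<close> commutes with \<open>L\<close>, one has
\<open>J\<^bsub>i+1\<^esub> C = L s\<^sub>i J\<^sub>i s\<^sub>i s\<^sub>i R\<close>. Expanding the square gives \<open>C J\<^sub>i\<close>, as \<open>J\<^sub>i\<close> commutes with \<open>R\<close>, and \<open>z\<close> times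
\<open>J\<^bsub>i+1\<^esub> L R\<close>; in the first term \<open>J\<^sub>i\<close> is rotated to the front.\<close>

lemma ctrace_skein:
  assumes i: "1 \<le> i" "i < n"
  shows "ctrace n t (W (jpow n (a(Suc i := Suc (a (Suc i)))) @ [1..<n])) =
    ctrace n t (W (jpow n (a(i := Suc (a i))) @ [1..<n])) +
    zvar * ctrace n t (W (jpow n (a(Suc i := Suc (a (Suc i)))) @ [1..<i] @ [Suc i..<n]))"
proof -
  let ?K = "jpow n a" and ?L = "[1..<i]" and ?R = "[Suc i..<n]"
  have up: "[1..<n] = ?L @ [i] @ ?R" using i by (metis append_Cons append_Nil le_less upt_add_eq_append upt_conv_Cons le_add_diff_inverse less_imp_le)
  have jS: "jw (Suc i) = [i] @ jw i @ [i]" using i by (cases i) auto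
  have L: "W (jw (Suc i) @ ?L) = W (?L @ jw (Suc i))"
    by (rule W_commute_words[symmetric], rule jw_commute_below) auto
  have R: "W (jw i @ ?R) = W (?R @ jw i)"
    by (rule W_commute_words[symmetric], rule jw_commute_above) auto
  have KS: "W (jpow n (a(Suc i := Suc (a (Suc i))))) = W (?K @ jw (Suc i))"
    by (rule jpow_upd) (use i in auto)
  have Ki: "W (jpow n (a(i := Suc (a i)))) = W (jw i @ ?K)"
    by (subst jpow_upd) (use i jpow_commute in auto)
  have "W (jpow n (a(Suc i := Suc (a (Suc i)))) @ [1..<n]) = W ([] @ jpow n (a(Suc i := Suc (a (Suc i)))) @ ?L @ [i] @ ?R)"
    by (simp only: up append_Nil)
  also have "\<dots> = W (?K @ (jw (Suc i) @ ?L) @ [i] @ ?R)"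
    by (subst W_cong[OF KS]) simp
  also have "\<dots> = W ((?K @ ?L @ [i] @ jw i) @ [i, i] @ ?R)"
    by (subst W_cong[OF L]) (simp add: jS)
  finally have A: "W (jpow n (a(Suc i := Suc (a (Suc i)))) @ [1..<n]) = W ((?K @ ?L @ [i] @ jw i) @ [i, i] @ ?R)" .
  have "W ((?K @ ?L @ [i] @ jw i) @ ?R) = W ((?K @ ?L @ [i]) @ (jw i @ ?R) @ [])" by simp
  also have "\<dots> = W ((?K @ [1..<n]) @ jw i)" by (subst W_cong[OF R]) (simp only: up append_assoc append_Nil2)
  finally have A1: "W ((?K @ ?L @ [i] @ jw i) @ ?R) = W ((?K @ [1..<n]) @ jw i)" .
  have "W ((?K @ ?L @ [i] @ jw i) @ [i] @ ?R) = W (?K @ (?L @ jw (Suc i)) @ ?R)" by (simp add: jS)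
  also have "\<dots> = W ([] @ (?K @ jw (Suc i)) @ ?L @ ?R)" by (subst W_cong[OF L[symmetric]]) simp
  also have "\<dots> = W (jpow n (a(Suc i := Suc (a (Suc i)))) @ ?L @ ?R)" by (subst W_cong[OF KS[symmetric]]) simp
  finally have A2: "W ((?K @ ?L @ [i] @ jw i) @ [i] @ ?R) = W (jpow n (a(Suc i := Suc (a (Suc i)))) @ ?L @ ?R)" .
  have "ctrace n t (W (jpow n (a(Suc i := Suc (a (Suc i)))) @ [1..<n])) =
     ctrace n t (W ((?K @ [1..<n]) @ jw i)) + zvar * ctrace n t (W (jpow n (a(Suc i := Suc (a (Suc i)))) @ ?L @ ?R))"
    by (rule ctrace_linear) (simp only: A W_skein A1 A2)
  also have "ctrace n t (W ((?K @ [1..<n]) @ jw i)) = ctrace n t (W (jw i @ ?K @ [1..<n]))"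
    by (rule ctrace_comm[symmetric]) (use set_jw[of i] i in auto)
  also have "W (jw i @ ?K @ [1..<n]) = W (jpow n (a(i := Suc (a i))) @ [1..<n])"
    using W_cong[OF Ki, of "[]" "[1..<n]"] by simp
  finally show ?thesis .
qed

section \<open>The lowest coefficient and the number of cycles\<close>

text \<open>\<open>branch ws u E v\<close>: from \<open>u\<close>, some choice of kept and deleted letters of \<open>ws\<close> ends in \<open>v\<close>; \<open>E\<close> lists the pairs
of values at the two positions of each deleted letter, regarded as edges of a graph on the values.\<close>

inductive branch :: "nat list \<Rightarrow> (nat \<Rightarrow> nat) \<Rightarrow> (nat \<times> nat) list \<Rightarrow> (nat \<Rightarrow> nat) \<Rightarrow> bool" where
  branch_Nil: "branch [] u [] u"
| branch_keep: "branch ws (u \<circ> simple_refl i) E v \<Longrightarrow> branch (i # ws) u E v"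
| branch_drop: "branch ws u E v \<Longrightarrow> branch (i # ws) u ((u i, u (Suc i)) # E) v"

lemma zvar_mult_coeff: "coeff (zvar * p) k = (case k of 0 \<Rightarrow> 0 | Suc m \<Rightarrow> coeff p m)"
  by (cases k) (simp_all add: zvar_def)

lemma coeff_hop:
  "coeff (hop r i g u) k = coeff (g (u \<circ> simple_refl i)) k +
    (if r (u i) (u (Suc i)) then (case k of 0 \<Rightarrow> 0 | Suc m \<Rightarrow> coeff (g u) m) else 0)"
  by (simp add: hop_def zvar_mult_coeff)

lemma coeff_hops_nonzero:
  "coeff (hops r ws (delta v) u) k \<noteq> 0 \<Longrightarrow> \<exists>E. branch ws u E v \<and> length E = k"
proof (induction ws arbitrary: u k)
  case Nil
  then have "u = v" "k = 0" by (cases "u = v"; auto simp: delta_def coeff_1 split: if_splits)+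
  then show ?case by (auto intro: branch_Nil)
next
  case (Cons i ws)
  show ?case
  proof (cases "coeff (hops r ws (delta v) (u \<circ> simple_refl i)) k = 0")
    case False
    then obtain E where "branch ws (u \<circ> simple_refl i) E v" "length E = k" using Cons.IH by blast
    then show ?thesis by (blast intro: branch_keep)
  next
    case True
    then obtain m where m: "k = Suc m" "coeff (hops r ws (delta v) u) m \<noteq> 0"
      using Cons.prems by (cases k) (auto simp: hops_Cons coeff_hop split: if_splits)
    then obtain E where "branch ws u E v" "length E = m" using Cons.IH by blast
    then show ?thesis using m(1) branch_drop by (intro exI[of _ "(u i, u (Suc i)) # E"]) simp
  qed
qed

text \<open>Deletions that occur in no branch with the right number of deletions may be forbidden.\<close>

lemma coeff_hops_restrict:
  assumes "\<And>E. branch ws u E v \<Longrightarrow> length E = k \<Longrightarrow> \<forall>(x, y)\<in>set E. q x y"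
  shows "coeff (hops (\<lambda>x y. r x y \<and> q x y) ws (delta v) u) k = coeff (hops r ws (delta v) u) k"
  using assms
proof (induction ws arbitrary: u k)
  case (Cons i ws)
  let ?r = "\<lambda>x y. r x y \<and> q x y"
  have 1: "coeff (hops ?r ws (delta v) (u \<circ> simple_refl i)) k = coeff (hops r ws (delta v) (u \<circ> simple_refl i)) k"
    by (rule Cons.IH) (use Cons.prems branch_keep in blast)
  show ?case
  proof (cases k)
    case 0
    then show ?thesis using 1 by (simp only: hops_Cons coeff_hop) simp
  next
    case (Suc m)
    have 2: "coeff (hops ?r ws (delta v) u) m = coeff (hops r ws (delta v) u) m"
    proof (rule Cons.IH)
      fix E assume "branch ws u E v" "length E = m"
      from Cons.prems[OF branch_drop[OF this(1)]] this(2) Suc show "\<forall>(x, y)\<in>set E. q x y" by auto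
    qed
    have 3: "coeff (hops r ws (delta v) u) m = 0" if "\<not> q (u i) (u (Suc i))"
    proof (rule ccontr)
      assume "coeff (hops r ws (delta v) u) m \<noteq> 0"
      then obtain E where E: "branch ws u E v" "length E = m" using coeff_hops_nonzero by blast
      from Cons.prems[OF branch_drop[OF E(1)]] E(2) Suc that show False by auto
    qed
    show ?thesis using 1 2 3 by (simp only: hops_Cons coeff_hop Suc nat.case) auto
  qed
qed simp

definition wprod :: "nat list \<Rightarrow> nat \<Rightarrow> nat" where
  "wprod ws = foldr (\<lambda>i f. simple_refl i \<circ> f) ws id"

lemma wprod_Nil [simp]: "wprod [] = id" and wprod_Cons: "wprod (i # ws) = simple_refl i \<circ> wprod ws"
  by (simp_all add: wprod_def)

lemma wprod_append: "wprod (xs @ ys) = wprod xs \<circ> wprod ys"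
  by (induction xs) (simp_all add: wprod_Cons comp_assoc)

definition tprod :: "(nat \<times> nat) list \<Rightarrow> nat \<Rightarrow> nat" where
  "tprod E = foldr (\<lambda>(x, y) f. transpose x y \<circ> f) E id"

text \<open>Deleting a letter is the same as keeping it and then exchanging the two values back.\<close>

lemma branch_tprod:
  assumes "branch ws u E v" "inj u"
  shows "u \<circ> wprod ws = tprod E \<circ> v"
  using assms
proof (induction rule: branch.induct)
  case (branch_keep ws u i E v)
  have "inj (u \<circ> simple_refl i)" using branch_keep.prems by (intro inj_compose) (simp_all add: bij_is_inj)
  from branch_keep.IH[OF this] show ?case by (simp only: wprod_Cons comp_assoc)
next
  case (branch_drop ws u E v i)
  have "u \<circ> simple_refl i = transpose (u i) (u (Suc i)) \<circ> u"
    using branch_drop.prems by (auto simp: fun_eq_iff simple_refl_def transpose_def inj_eq)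
  then have "u \<circ> wprod (i # ws) = transpose (u i) (u (Suc i)) \<circ> (u \<circ> wprod ws)"
    by (simp only: wprod_Cons comp_assoc[symmetric])
  also have "\<dots> = tprod ((u i, u (Suc i)) # E) \<circ> v"
    unfolding branch_drop.IH[OF branch_drop.prems] by (simp add: tprod_def comp_assoc)
  finally show ?case .
qed (simp add: tprod_def)

lemma branch_labels:
  assumes "branch ws u E v" "u permutes {1..n}" "set ws \<subseteq> {1..<n}"
  shows "set E \<subseteq> {1..n} \<times> {1..n}"
  using assms
proof (induction rule: branch.induct)
  case (branch_keep ws u i E v)
  have "u \<circ> simple_refl i permutes {1..n}"
    by (rule permutes_compose[OF simple_refl_permutes]) (use branch_keep.prems in auto)
  then show ?case by (rule branch_keep.IH) (use branch_keep.prems in auto)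
next
  case (branch_drop ws u E v i)
  then have "i \<in> {1..n}" "Suc i \<in> {1..n}" by auto
  then have "u i \<in> {1..n}" "u (Suc i) \<in> {1..n}" using permutes_in_image[OF branch_drop.prems(1)] by blast+
  then show ?case using branch_drop by simp
qed simp

text \<open>A graph with \<open>n\<close> vertices has at least \<open>n - |E|\<close> components; \<open>f\<close> labels the vertices by their components.\<close>

lemma component_labelling:
  "\<exists>f :: nat \<Rightarrow> nat. (\<forall>(x, y)\<in>set E. f x = f y) \<and> n \<le> card (f ` {1..n}) + length E"
proof (induction E)
  case Nil
  then show ?case by (intro exI[of _ id]) simp
next
  case (Cons e E)
  obtain x y where e: "e = (x, y)" by (cases e)
  from Cons.IH obtain f :: "nat \<Rightarrow> nat" where f: "\<forall>(x, y)\<in>set E. f x = f y" "n \<le> card (f ` {1..n}) + length E"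
    by (elim exE conjE)
  \<comment> \<open>The new edge merges the component of \<open>y\<close> into that of \<open>x\<close>.\<close>
  let ?g = "\<lambda>z. if f z = f y then f x else f z"
  have "f ` {1..n} \<subseteq> insert (f y) (?g ` {1..n})" by auto
  then have "card (f ` {1..n}) \<le> card (insert (f y) (?g ` {1..n}))" by (intro card_mono) auto
  also have "\<dots> \<le> Suc (card (?g ` {1..n}))" by (rule card_insert_le_m1) auto
  finally have "n \<le> card (?g ` {1..n}) + length (e # E)" using f by simp
  moreover have "\<forall>(x, y)\<in>set (e # E). ?g x = ?g y"
  proof (intro ballI, clarify)
    fix a b assume "(a, b) \<in> set (e # E)"
    then consider "a = x" "b = y" | "(a, b) \<in> set E" using e by auto
    then show "?g a = ?g b"
    proof cases
      case 2
      then have "f a = f b" using f(1) by blast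
      then show ?thesis by (simp only:)
    qed simp
  qed
  ultimately show ?case by (intro exI[of _ ?g] conjI)
qed

lemma tprod_invariant: "\<forall>(x, y)\<in>set E. f x = f y \<Longrightarrow> f \<circ> tprod E = f"
proof (induction E)
  case (Cons e E)
  obtain x y where e: "e = (x, y)" by (cases e)
  have "f \<circ> transpose x y = f" using Cons.prems e by (auto simp: fun_eq_iff transpose_def)
  then have "f \<circ> tprod (e # E) = f \<circ> tprod E" by (simp add: tprod_def e comp_assoc[symmetric])
  with Cons show ?case by simp
qed (simp add: tprod_def)

text \<open>A closed branch writes the product of the word as a product of transpositions along the edges, so
\<open>f\<close> is constant on the cycles of that product as well.\<close>

lemma branch_component_labelling:
  assumes "branch ws id E id"
  shows "\<exists>f :: nat \<Rightarrow> nat. (\<forall>(x, y)\<in>set E. f x = f y) \<and> (\<forall>x. f (wprod ws x) = f x) \<and>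
    n \<le> card (f ` {1..n}) + length E"
proof -
  obtain f :: "nat \<Rightarrow> nat" where f: "\<forall>(x, y)\<in>set E. f x = f y" "n \<le> card (f ` {1..n}) + length E"
    using component_labelling[of E n] by (elim exE conjE)
  have "wprod ws = tprod E" using branch_tprod[OF assms] by simp
  with tprod_invariant[OF f(1)] have "f \<circ> wprod ws = f" by simp
  then have "\<forall>x. f (wprod ws x) = f x" by (metis comp_apply)
  with f show ?thesis by (intro exI[of _ f] conjI)
qed

lemma const_from_steps:
  fixes f :: "nat \<Rightarrow> nat"
  assumes "\<And>x. a \<le> x \<Longrightarrow> x < b \<Longrightarrow> f (Suc x) = f x" "x \<in> {a..b}" "y \<in> {a..b}"
  shows "f x = f y"
proof -
  have "f z = f a" if "z \<in> {a..b}" for z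
    using that
  proof (induction z)
    case (Suc z)
    show ?case
    proof (cases "Suc z = a")
      case False
      then have "z \<in> {a..b}" "f (Suc z) = f z" using Suc.prems assms(1)[of z] by auto
      then show ?thesis using Suc.IH by simp
    qed simp
  qed simp
  from this[OF assms(2)] this[OF assms(3)] show ?thesis by (rule trans[OF _ sym])
qed

lemma wprod_jw [simp]: "wprod (jw m) = id"
  by (induction m rule: jw.induct) (simp_all add: wprod_Cons wprod_append)

lemma wprod_jpow [simp]: "wprod (jpow n a) = id"
proof (induction n)
  case (Suc n)
  have "wprod (concat (replicate k (jw m))) = id" for k m
    by (induction k) (simp_all add: wprod_append)
  with Suc show ?case by (simp add: jpow_Suc wprod_append jp_def)
qed simp

lemma wprod_upt:
  shows "a \<le> x \<Longrightarrow> x < b \<Longrightarrow> wprod [a..<b] x = Suc x"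
    and "x < a \<Longrightarrow> wprod [a..<b] x = x"
    and "b < x \<Longrightarrow> wprod [a..<b] x = x"
proof -
  have *: "(a \<le> x \<longrightarrow> x < b \<longrightarrow> wprod [a..<b] x = Suc x) \<and> (x < a \<longrightarrow> wprod [a..<b] x = x) \<and> (b < x \<longrightarrow> wprod [a..<b] x = x)"
  proof (induction b arbitrary: x)
    case (Suc b)
    show ?case
    proof (cases "a \<le> b")
      case True
      then have "wprod [a..<Suc b] x = wprod [a..<b] (simple_refl b x)" for x
        by (simp add: wprod_append wprod_Cons)
      then show ?thesis using Suc.IH[of x] Suc.IH[of "Suc b"] True
        by (cases "x = b"; cases "x = Suc b") auto
    qed auto
  qed auto
  show "a \<le> x \<Longrightarrow> x < b \<Longrightarrow> wprod [a..<b] x = Suc x"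
    and "x < a \<Longrightarrow> wprod [a..<b] x = x" and "b < x \<Longrightarrow> wprod [a..<b] x = x" using * by auto
qed

text \<open>The product of the word is an \<open>n\<close>-cycle, as the Jucys--Murphy words have trivial product; at least
\<open>n - 1\<close> transpositions are needed to write it.\<close>

lemma coeff_knot_low:
  assumes "k < n - 1"
  shows "coeff (hops r (jpow n a @ [1..<n]) (delta id) id) k = 0"
proof (rule ccontr)
  assume "coeff (hops r (jpow n a @ [1..<n]) (delta id) id) k \<noteq> 0"
  then obtain E where E: "branch (jpow n a @ [1..<n]) id E id" "length E = k" using coeff_hops_nonzero by blast
  obtain f :: "nat \<Rightarrow> nat" where f: "\<forall>x. f (wprod (jpow n a @ [1..<n]) x) = f x"
    "n \<le> card (f ` {1..n}) + length E" using branch_component_labelling[OF E(1), of n] by (elim exE conjE)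
  have "f (Suc x) = f x" if "1 \<le> x" "x < n" for x
    using spec[OF f(1), of x] that by (simp add: wprod_append wprod_upt)
  then have "f x = f 1" if "x \<in> {1..n}" for x by (rule const_from_steps) (use that in auto)
  then have "f ` {1..n} \<subseteq> {f 1}" by (intro image_subsetI) (simp only: singleton_iff)
  then have "card (f ` {1..n}) \<le> card {f 1}" by (intro card_mono) auto
  then show False using f(2) E(2) assms by simp
qed

text \<open>Here the product of the word has the two cycles \<open>{1..i}\<close> and \<open>{i+1..n}\<close> and \<open>n - 2\<close> transpositions are the
minimal number, so none of them may join the two cycles.\<close>

lemma two_component_edges:
  assumes i: "1 \<le> i" "i < n" and E: "branch (jpow n a @ [1..<i] @ [Suc i..<n]) id E id" "length E = n - 2"
  shows "\<forall>(x, y)\<in>set E. (x \<le> i \<longleftrightarrow> y \<le> i)"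
proof (rule ccontr)
  let ?w = "jpow n a @ [1..<i] @ [Suc i..<n]"
  assume "\<not> ?thesis"
  then obtain x y where xy: "(x, y) \<in> set E" "x \<le> i \<longleftrightarrow> \<not> y \<le> i" by auto
  have "set ?w \<subseteq> {1..<n}" using set_jpow[of n a] i by auto
  from branch_labels[OF E(1) permutes_id this] xy have xyn: "x \<in> {1..n}" "y \<in> {1..n}" by auto
  obtain f :: "nat \<Rightarrow> nat" where f: "\<forall>(x, y)\<in>set E. f x = f y" "\<forall>x. f (wprod ?w x) = f x"
    "n \<le> card (f ` {1..n}) + length E" using branch_component_labelling[OF E(1), of n] by (elim exE conjE)
  have 1: "f (Suc z) = f z" if "1 \<le> z" "z < i" for z
    using spec[OF f(2), of z] that by (simp add: wprod_append wprod_upt)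
  have 2: "f (Suc z) = f z" if "Suc i \<le> z" "z < n" for z
    using spec[OF f(2), of z] that by (simp add: wprod_append wprod_upt)
  have c1: "f z = f z'" if "z \<in> {1..i}" "z' \<in> {1..i}" for z z' by (rule const_from_steps[of 1 i f, OF 1 that])
  have c2: "f z = f z'" if "z \<in> {Suc i..n}" "z' \<in> {Suc i..n}" for z z' by (rule const_from_steps[of "Suc i" n f, OF 2 that])
  have "f z = f x" if z: "z \<in> {1..n}" for z
  proof (cases "z \<le> i \<longleftrightarrow> x \<le> i")
    case True
    then show ?thesis using c1[of z x] c2[of z x] z xyn by (cases "z \<le> i") auto
  next
    case False
    then have "f z = f y" using c1[of z y] c2[of z y] z xyn xy(2) by (cases "z \<le> i") auto
    then show ?thesis using f(1) xy(1) by auto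
  qed
  then have "f ` {1..n} \<subseteq> {f x}" by (intro image_subsetI) (simp only: singleton_iff)
  then have "card (f ` {1..n}) \<le> card {f x}" by (intro card_mono) auto
  then show False using f(3) E(2) i by simp
qed

lemma hops_rel_cong:
  assumes "\<And>x y. x \<in> {1..n} \<Longrightarrow> y \<in> {1..n} \<Longrightarrow> x \<noteq> y \<Longrightarrow> r x y = r' x y"
    and "set ws \<subseteq> {1..<n}" "u permutes {1..n}"
  shows "hops r ws g u = hops r' ws g u"
  using assms(2,3)
proof (induction ws arbitrary: u)
  case (Cons i ws)
  then have i: "i \<in> {1..<n}" by auto
  have us: "u \<circ> simple_refl i permutes {1..n}"
    by (rule permutes_compose[OF simple_refl_permutes[OF i] Cons.prems(2)])
  have "i \<in> {1..n}" "Suc i \<in> {1..n}" using i by auto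
  then have "u i \<in> {1..n}" "u (Suc i) \<in> {1..n}" using permutes_in_image[OF Cons.prems(2)] by blast+
  moreover have "u i \<noteq> u (Suc i)" using permutes_inj[OF Cons.prems(2), THEN injD, of i "Suc i"] by auto
  ultimately have "r (u i) (u (Suc i)) = r' (u i) (u (Suc i))" by (rule assms(1))
  moreover have "hops r ws g u = hops r' ws g u" by (rule Cons.IH) (use Cons.prems in auto)
  moreover have "hops r ws g (u \<circ> simple_refl i) = hops r' ws g (u \<circ> simple_refl i)"
    by (rule Cons.IH[OF _ us]) (use Cons.prems in auto)
  ultimately show ?case by (simp only: hops_Cons hop_def)
qed simp

lemma hops_Cons':
  "hops r (i # ws) g u = hops r ws g (u \<circ> simple_refl i) + (if r (u i) (u (Suc i)) then zvar * hops r ws g u else 0)"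
  by (simp only: hops_Cons hop_def)

lemma hops_Cons_skip: "\<not> r (u i) (u (Suc i)) \<Longrightarrow> hops r (i # ws) g u = hops r ws g (u \<circ> simple_refl i)"
  by (simp only: hops_Cons' if_False add_0_right)

text \<open>Relabelling the values turns a diagonal entry at any \<open>v\<close> into one at the identity for the pulled back
relation.\<close>

lemma hops_relabel:
  "hops r ws g (v \<circ> u) = hops (\<lambda>x y. r (v x) (v y)) ws (\<lambda>u. g (v \<circ> u)) u"
proof (induction ws arbitrary: u)
  case (Cons i ws)
  have "hops r ws g (v \<circ> u \<circ> simple_refl i) = hops (\<lambda>x y. r (v x) (v y)) ws (\<lambda>u. g (v \<circ> u)) (u \<circ> simple_refl i)"
    unfolding comp_assoc by (rule Cons.IH)
  moreover have "(v \<circ> u) i = v (u i)" "(v \<circ> u) (Suc i) = v (u (Suc i))" by simp_all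
  ultimately show ?case using Cons.IH[of u] by (simp only: hops_Cons')
qed simp

lemma W_stdz:
  assumes "set ws \<subseteq> {1..<n}"
  shows "W ws (delta (stdz n B)) (stdz n B) = hops (col_less B) ws (delta id) id"
proof -
  let ?v = "stdz n B"
  have d: "(\<lambda>u. delta ?v (?v \<circ> u)) = delta id"
  proof
    fix u show "delta ?v (?v \<circ> u) = delta id u"
      using bij_is_inj[OF bij_stdz, of n B] by (simp add: delta_def fun_eq_iff inj_eq)
  qed
  have "W ws (delta ?v) ?v = hops (<) ws (delta ?v) (?v \<circ> id)" by (simp add: W_def)
  also have "\<dots> = hops (\<lambda>x y. ?v x < ?v y) ws (delta id) id" unfolding hops_relabel d by (rule refl)
  also have "\<dots> = hops (col_less B) ws (delta id) id"
    by (rule hops_rel_cong[OF _ assms permutes_id]) (rule stdz_less_iff)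
  finally show ?thesis .
qed

lemma ctrace_eq_coloured:
  assumes "set ws \<subseteq> {1..<n}"
  shows "ctrace n t (W ws) = (\<Sum>B\<in>Pow {1..n}. smult (t ^ card B) (hops (col_less B) ws (delta id) id))"
  unfolding ctrace_def W_stdz[OF assms] by (rule refl)

section \<open>Splitting a word at a missing letter\<close>

text \<open>If deletions are only allowed between two values on the same side of \<open>i\<close>, then a letter at which the
two sides meet is always kept, and it can be cancelled against its inverse.\<close>

definition sep :: "nat \<Rightarrow> nat \<Rightarrow> nat \<Rightarrow> bool" where
  "sep i x y \<longleftrightarrow> (x \<le> i \<longleftrightarrow> y \<le> i)"

text \<open>This property holds along every branch that starts at the identity and does not use the letter \<open>i\<close>.\<close>

definition keeps :: "nat \<Rightarrow> (nat \<Rightarrow> nat) \<Rightarrow> bool" where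
  "keeps i u \<longleftrightarrow> (\<forall>x. u x \<le> i \<longleftrightarrow> x \<le> i)"

lemma keeps_id [simp]: "keeps i id" by (simp add: keeps_def)

lemma keeps_step: "keeps i u \<Longrightarrow> j \<noteq> i \<Longrightarrow> keeps i (u \<circ> simple_refl j)"
  unfolding keeps_def
proof
  fix x assume "\<forall>x. (u x \<le> i) = (x \<le> i)" "j \<noteq> i"
  then have "(u (simple_refl j x) \<le> i) = (simple_refl j x \<le> i)" by blast
  also have "\<dots> = (x \<le> i)" using \<open>j \<noteq> i\<close> by (auto simp: simple_refl_def transpose_def)
  finally show "((u \<circ> simple_refl j) x \<le> i) = (x \<le> i)" by simp
qed

text \<open>All letters of \<open>jw (m + 1)\<close> move the value at \<open>m + 1\<close> across values from the other side, so no letter can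
be deleted, and the word is a palindrome.\<close>

lemma hops_jw_cross:
  assumes "\<And>x. 1 \<le> x \<Longrightarrow> x \<le> m \<Longrightarrow> u x \<le> i" "i < u (Suc m)"
  shows "hops (\<lambda>x y. r x y \<and> sep i x y) (jw (Suc m)) g u = g u"
  using assms
proof (induction m arbitrary: g u)
  case (Suc m)
  let ?r = "\<lambda>x y. r x y \<and> sep i x y" and ?s = "simple_refl (Suc m)"
  have n1: "\<not> ?r (u (Suc m)) (u (Suc (Suc m)))" using Suc.prems by (force simp: sep_def)
  have n2: "\<not> ?r ((u \<circ> ?s) (Suc m)) ((u \<circ> ?s) (Suc (Suc m)))" using Suc.prems by (force simp: sep_def)
  have "hops ?r (jw (Suc (Suc m))) g u = hops ?r (jw (Suc m) @ [Suc m]) g (u \<circ> ?s)"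
    unfolding jw.simps by (rule hops_Cons_skip[of ?r u "Suc m", OF n1])
  also have "\<dots> = hops ?r (jw (Suc m)) (hop ?r (Suc m) g) (u \<circ> ?s)"
    by (simp only: hops_append hops_Cons hops_Nil)
  also have "\<dots> = hop ?r (Suc m) g (u \<circ> ?s)"
    by (rule Suc.IH) (use Suc.prems in auto)
  also have "\<dots> = hops ?r [Suc m] g (u \<circ> ?s)" by (simp only: hops_Cons hops_Nil)
  also have "\<dots> = hops ?r [] g (u \<circ> ?s \<circ> ?s)" by (rule hops_Cons_skip[of ?r "u \<circ> ?s" "Suc m", OF n2])
  also have "\<dots> = g u" by (simp only: hops_Nil comp_simple_refl_twice)
  finally show ?case .
qed simp

text \<open>The strand at \<open>i + k + 1\<close> first passes the strands of its own side, then those of the other side and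
back, which has no effect by \<open>hops_jw_cross\<close>, and returns.\<close>

lemma hops_jw_shift:
  assumes "keeps i u" "1 \<le> i"
  shows "hops (\<lambda>x y. r x y \<and> sep i x y) (jw (i + Suc k)) g u =
    hops (\<lambda>x y. r x y \<and> sep i x y) (map ((+) i) (jw (Suc k))) g u"
  using assms(1)
proof (induction k arbitrary: g u)
  case 0
  have "i < u (Suc i)" using 0 by (metis keeps_def not_less Suc_n_not_le_n)
  then have "hops (\<lambda>x y. r x y \<and> sep i x y) (jw (Suc i)) g u = g u"
    by (intro hops_jw_cross) (use 0 in \<open>auto simp: keeps_def\<close>)
  then show ?case by simp
next
  case (Suc k)
  let ?r = "\<lambda>x y. r x y \<and> sep i x y" and ?j = "i + Suc k"
  have e: "jw (i + Suc (Suc k)) = ?j # jw ?j @ [?j]" "map ((+) i) (jw (Suc (Suc k))) = ?j # map ((+) i) (jw (Suc k)) @ [?j]"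
    by simp_all
  have "keeps i (u \<circ> simple_refl ?j)" by (rule keeps_step[OF Suc.prems]) simp
  from Suc.IH[OF this] Suc.IH[OF Suc.prems] show ?case
    by (simp only: e hops_Cons'[of ?r ?j "jw ?j @ [?j]" g u]
      hops_Cons'[of ?r ?j "map ((+) i) (jw (Suc k)) @ [?j]" g u] hops_append)
qed

text \<open>The second word avoids the letter \<open>i\<close> and therefore preserves \<open>keeps i\<close>; this makes the relation compatible
with concatenation.\<close>

definition sep_equiv :: "(nat \<Rightarrow> nat \<Rightarrow> bool) \<Rightarrow> nat \<Rightarrow> nat list \<Rightarrow> nat list \<Rightarrow> bool" where
  "sep_equiv r i xs ys \<longleftrightarrow> i \<notin> set ys \<and> (\<forall>g u. keeps i u \<longrightarrow>
     hops (\<lambda>x y. r x y \<and> sep i x y) xs g u = hops (\<lambda>x y. r x y \<and> sep i x y) ys g u)"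

lemma sep_equiv_refl: "i \<notin> set ys \<Longrightarrow> sep_equiv r i ys ys"
  by (simp add: sep_equiv_def)

lemma sep_equiv_append:
  assumes "sep_equiv r i xs ys" "sep_equiv r i xs' ys'"
  shows "sep_equiv r i (xs @ xs') (ys @ ys')"
  unfolding sep_equiv_def
proof (intro conjI allI impI)
  let ?r = "\<lambda>x y. r x y \<and> sep i x y"
  fix g u assume u: "keeps i u"
  have i: "i \<notin> set ys" using assms by (simp add: sep_equiv_def)
  have "hops ?r (xs @ xs') g u = hops ?r ys (hops ?r xs' g) u"
    using assms(1) u by (simp add: sep_equiv_def hops_append)
  also have "\<dots> = hops ?r ys (hops ?r ys' g) u"
  proof (rule hops_cong_closed[where P="keeps i"])
    fix j and v :: "nat \<Rightarrow> nat" assume "j \<in> set ys" "keeps i v"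
    then show "keeps i (v \<circ> simple_refl j)" using i by (intro keeps_step) auto
  qed (use assms(2) u in \<open>auto simp: sep_equiv_def\<close>)
  finally show "hops ?r (xs @ xs') g u = hops ?r (ys @ ys') g u" by (simp add: hops_append)
qed (use assms in \<open>auto simp: sep_equiv_def\<close>)

lemma sep_equiv_replicate:
  assumes "sep_equiv r i x y"
  shows "sep_equiv r i (concat (replicate k x)) (concat (replicate k y))"
  using assms by (induction k) (auto intro: sep_equiv_append sep_equiv_refl)

lemma sep_equiv_jpow:
  assumes i: "1 \<le> i"
  shows "sep_equiv r i (jpow (i + m) a) (jpow i a @ map ((+) i) (jpow m (\<lambda>l. a (i + l))))"
proof (induction m)
  case 0
  have "i \<notin> set (jpow i a)" using set_jpow[of i a] by auto
  then show ?case by (simp add: sep_equiv_refl)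
next
  case (Suc m)
  have "sep_equiv r i (jw (i + Suc m)) (map ((+) i) (jw (Suc m)))"
    unfolding sep_equiv_def using hops_jw_shift[OF _ i] set_jw[of "Suc m"] by auto
  then have "sep_equiv r i (jp a (i + Suc m)) (concat (replicate (a (i + Suc m)) (map ((+) i) (jw (Suc m)))))"
    unfolding jp_def by (rule sep_equiv_replicate)
  also have "concat (replicate (a (i + Suc m)) (map ((+) i) (jw (Suc m)))) = map ((+) i) (jp (\<lambda>l. a (i + l)) (Suc m))"
    by (simp add: jp_def map_concat)
  finally have "sep_equiv r i (jpow (i + m) a @ jp a (i + Suc m))
     ((jpow i a @ map ((+) i) (jpow m (\<lambda>l. a (i + l)))) @ map ((+) i) (jp (\<lambda>l. a (i + l)) (Suc m)))"
    by (rule sep_equiv_append[OF Suc])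
  then show ?case by (simp add: jpow_Suc)
qed

lemma hops_sep:
  assumes "i \<notin> set ws" "keeps i u"
  shows "hops (\<lambda>x y. r x y \<and> sep i x y) ws g u = hops r ws g u"
  using assms
proof (induction ws arbitrary: u)
  case (Cons j ws)
  have "u j \<le> i \<longleftrightarrow> j \<le> i" "u (Suc j) \<le> i \<longleftrightarrow> Suc j \<le> i" "j \<noteq> i"
    using Cons.prems by (simp_all add: keeps_def)
  then have "sep i (u j) (u (Suc j))" unfolding sep_def by linarith
  moreover have "keeps i (u \<circ> simple_refl j)" by (rule keeps_step) (use Cons.prems in auto)
  moreover have "i \<notin> set ws" using Cons.prems by simp
  moreover note Cons.prems(2)
  ultimately show ?case
    unfolding hops_Cons' by (subst (1 2) Cons.IH) simp_all
qed simp

definition comb :: "nat \<Rightarrow> (nat \<Rightarrow> nat) \<Rightarrow> (nat \<Rightarrow> nat) \<Rightarrow> nat \<Rightarrow> nat" where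
  "comb i u1 u2 x = (if x \<le> i then u1 x else i + u2 (x - i))"

lemma comb_left: "j < i \<Longrightarrow> comb i u1 u2 \<circ> simple_refl j = comb i (u1 \<circ> simple_refl j) u2"
  by (auto simp: comb_def fun_eq_iff simple_refl_def transpose_def)

lemma comb_right: "1 \<le> j \<Longrightarrow> comb i u1 u2 \<circ> simple_refl (i + j) = comb i u1 (u2 \<circ> simple_refl j)"
  by (auto simp: comb_def fun_eq_iff simple_refl_def transpose_def)

lemma hops_comb_left:
  assumes "set xs \<subseteq> {1..<i}"
  shows "hops r xs g (comb i u1 u2) = hops r xs (\<lambda>u. g (comb i u u2)) u1"
  using assms
proof (induction xs arbitrary: u1)
  case (Cons j xs)
  have c: "comb i u1 u2 \<circ> simple_refl j = comb i (u1 \<circ> simple_refl j) u2"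
    "comb i u1 u2 j = u1 j" "comb i u1 u2 (Suc j) = u1 (Suc j)"
    using Cons.prems by (auto simp: comb_left) (auto simp: comb_def)
  have "set xs \<subseteq> {1..<i}" using Cons.prems by simp
  from Cons.IH[OF this] show ?case by (simp only: hops_Cons hop_def c)
qed simp

lemma hops_comb_right:
  assumes "set ys \<subseteq> {1..<m}"
  shows "hops r (map ((+) i) ys) g (comb i u1 u2) =
    hops (\<lambda>x y. r (i + x) (i + y)) ys (\<lambda>u. g (comb i u1 u)) u2"
  using assms
proof (induction ys arbitrary: u2)
  case (Cons j ys)
  have c: "comb i u1 u2 \<circ> simple_refl (i + j) = comb i u1 (u2 \<circ> simple_refl j)"
    "comb i u1 u2 (i + j) = i + u2 j" "comb i u1 u2 (Suc (i + j)) = i + u2 (Suc j)"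
    using Cons.prems by (auto simp: comb_right) (auto simp: comb_def)
  have "set ys \<subseteq> {1..<m}" using Cons.prems by simp
  from Cons.IH[OF this] show ?case by (simp only: hops_Cons hop_def c list.map)
qed simp

lemma hops_multr: "hops r ws (\<lambda>u. g u * c) = (\<lambda>u. hops r ws g u * c)"
  using hops_cmult[of r ws c g] by (simp add: mult.commute)

lemma comb_id: "comb i id id = id"
  by (auto simp: comb_def fun_eq_iff)

lemma delta_comb:
  assumes "u1 permutes {1..i}" "u2 permutes {1..m}"
  shows "delta id (comb i u1 u2) = delta id u1 * delta id u2"
proof -
  have "comb i u1 u2 = id \<longleftrightarrow> u1 = id \<and> u2 = id"
  proof
    assume c: "comb i u1 u2 = id"
    have "u1 x = x" for x
      using fun_cong[OF c, of x] permutes_not_in[OF assms(1), of x] by (cases "x \<le> i") (auto simp: comb_def)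
    moreover have "u2 x = x" for x
      using fun_cong[OF c, of "i + x"] permutes_not_in[OF assms(2), of 0] by (cases x) (auto simp: comb_def)
    ultimately show "u1 = id \<and> u2 = id" by auto
  qed (simp add: comb_id)
  then show ?thesis by (simp add: delta_def)
qed

lemma commute_hops_disjoint:
  "hops r (map ((+) i) ys @ xs) g (comb i u1 u2) = hops r (xs @ map ((+) i) ys) g (comb i u1 u2)"
  if "set xs \<subseteq> {1..<i}" "set ys \<subseteq> {1..<m}"
proof -
  have "hops r xs (\<lambda>w. hops (\<lambda>x y. r (i + x) (i + y)) ys (\<lambda>u. g (comb i w u)) u2) u1 =
    hops (\<lambda>x y. r (i + x) (i + y)) ys (\<lambda>u. hops r xs (\<lambda>w. g (comb i w u)) u1) u2" for u1 u2
  proof (induction xs arbitrary: u1)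
    case (Cons j xs)
    show ?case
      by (cases "r (u1 j) (u1 (Suc j))")
        (simp_all only: hops_Cons' Cons.IH if_True if_False add_0_right hops_add hops_cmult)
  qed simp
  then show ?thesis
    by (simp only: hops_append hops_comb_left[OF that(1)] hops_comb_right[OF that(2)])
qed

lemma hops_split_product:
  assumes xs: "set xs \<subseteq> {1..<i}" and ys: "set ys \<subseteq> {1..<m}"
  shows "hops r (xs @ map ((+) i) ys) (delta id) id =
    hops r xs (delta id) id * hops (\<lambda>x y. r (i + x) (i + y)) ys (delta id) id"
proof -
  let ?r2 = "\<lambda>x y. r (i + x) (i + y)"
  have "hops r (xs @ map ((+) i) ys) (delta id) id = hops r xs (hops r (map ((+) i) ys) (delta id)) (comb i id id)"
    by (simp add: comb_id hops_append)
  also have "\<dots> = hops r xs (\<lambda>u. hops ?r2 ys (\<lambda>w. delta id (comb i u w)) id) id"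
    by (simp only: hops_comb_left[OF xs] hops_comb_right[OF ys])
  also have "\<dots> = hops r xs (\<lambda>u. delta id u * hops ?r2 ys (delta id) id) id"
  proof (rule hops_cong_closed[where P="\<lambda>u. u permutes {1..i}"])
    fix u :: "nat \<Rightarrow> nat" assume u: "u permutes {1..i}"
    have "hops ?r2 ys (\<lambda>w. delta id (comb i u w)) id = hops ?r2 ys (\<lambda>w. delta id u * delta id w) id"
    proof (rule hops_cong_closed[where P="\<lambda>u. u permutes {1..m}"])
      fix j and w :: "nat \<Rightarrow> nat" assume "j \<in> set ys" "w permutes {1..m}"
      then show "w \<circ> simple_refl j permutes {1..m}"
        using ys by (intro permutes_compose simple_refl_permutes) auto
    qed (use delta_comb[OF u] permutes_id in auto)
    then show "hops ?r2 ys (\<lambda>w. delta id (comb i u w)) id = delta id u * hops ?r2 ys (delta id) id"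
      by (simp only: hops_cmult)
  next
    fix j and w :: "nat \<Rightarrow> nat" assume "j \<in> set xs" "w permutes {1..i}"
    then show "w \<circ> simple_refl j permutes {1..i}"
      using xs by (intro permutes_compose simple_refl_permutes) auto
  qed (rule permutes_id)
  also have "\<dots> = hops r xs (delta id) id * hops ?r2 ys (delta id) id"
    by (simp only: hops_multr)
  finally show ?thesis .
qed

text \<open>Among the branches with the minimal number of deletions all are separated, and for separated ones
the word decomposes into a word in the letters below \<open>i\<close> and one in the letters above. The factors of
the resulting product vanish below the degrees \<open>i - 1\<close> and \<open>n - i - 1\<close> by \<open>coeff_knot_low\<close>, so that only one term
of the Cauchy product is left.\<close>

lemma coeff_two_components:
  assumes i: "1 \<le> i" "i < n"
  shows "coeff (hops r (jpow n a @ [1..<i] @ [Suc i..<n]) (delta id) id) (n - 2) =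
    coeff (hops r (jpow i a @ [1..<i]) (delta id) id) (i - 1) *
    coeff (hops (\<lambda>x y. r (i + x) (i + y)) (jpow (n - i) (\<lambda>l. a (i + l)) @ [1..<n - i]) (delta id) id) (n - i - 1)"
    (is "_ = coeff ?f _ * coeff ?g _")
proof -
  let ?m = "n - i" and ?r = "\<lambda>x y. r x y \<and> sep i x y"
  let ?b = "\<lambda>l. a (i + l)"
  have n: "n = i + ?m" using i by simp
  have up: "[Suc i..<n] = map ((+) i) [1..<?m]"
    using i by (intro nth_equalityI) auto
  have "coeff (hops r (jpow n a @ [1..<i] @ [Suc i..<n]) (delta id) id) (n - 2) =
    coeff (hops ?r (jpow n a @ [1..<i] @ [Suc i..<n]) (delta id) id) (n - 2)"
    by (rule coeff_hops_restrict[symmetric]) (use two_component_edges[OF i] in \<open>simp add: sep_def\<close>)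
  also have "hops ?r (jpow n a @ [1..<i] @ [Suc i..<n]) (delta id) id =
    hops ?r ((jpow i a @ map ((+) i) (jpow ?m ?b)) @ [1..<i] @ [Suc i..<n]) (delta id) id"
  proof -
    have "sep_equiv r i (jpow n a @ [1..<i] @ [Suc i..<n]) ((jpow i a @ map ((+) i) (jpow ?m ?b)) @ [1..<i] @ [Suc i..<n])"
      by (rule sep_equiv_append, subst n, rule sep_equiv_jpow[OF i(1)], rule sep_equiv_refl) simp
    then show ?thesis by (simp add: sep_equiv_def)
  qed
  also have "\<dots> = hops r ((jpow i a @ map ((+) i) (jpow ?m ?b)) @ [1..<i] @ [Suc i..<n]) (delta id) id"
    by (rule hops_sep) (use set_jpow[of i a] set_jpow[of ?m ?b] in auto)
  also have "\<dots> = hops r (jpow i a) (hops r (map ((+) i) (jpow ?m ?b) @ [1..<i]) (hops r [Suc i..<n] (delta id))) (comb i id id)"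
    by (simp add: hops_append comb_id)
  also have "\<dots> = hops r (jpow i a) (\<lambda>u. hops r (map ((+) i) (jpow ?m ?b) @ [1..<i]) (hops r [Suc i..<n] (delta id)) (comb i u id)) id"
    by (rule hops_comb_left[OF set_jpow])
  also have "\<dots> = hops r (jpow i a) (\<lambda>u. hops r ([1..<i] @ map ((+) i) (jpow ?m ?b)) (hops r [Suc i..<n] (delta id)) (comb i u id)) id"
    by (subst commute_hops_disjoint[OF _ set_jpow]) auto
  also have "\<dots> = hops r (jpow i a) (hops r ([1..<i] @ map ((+) i) (jpow ?m ?b)) (hops r [Suc i..<n] (delta id))) (comb i id id)"
    by (rule hops_comb_left[OF set_jpow, symmetric])
  also have "\<dots> = hops r ((jpow i a @ [1..<i]) @ map ((+) i) (jpow ?m ?b @ [1..<?m])) (delta id) id"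
    by (simp add: hops_append comb_id up)
  also have "\<dots> = ?f * ?g"
    by (rule hops_split_product) (use set_jpow in auto)
  also have "coeff (?f * ?g) (n - 2) = (\<Sum>j\<le>n - 2. coeff ?f j * coeff ?g (n - 2 - j))"
    by (rule coeff_mult)
  also have "\<dots> = (\<Sum>j\<in>{i - 1}. coeff ?f j * coeff ?g (n - 2 - j))"
  proof (rule sum.mono_neutral_right)
    show "\<forall>j\<in>{..n - 2} - {i - 1}. coeff ?f j * coeff ?g (n - 2 - j) = 0"
    proof
      fix j assume j: "j \<in> {..n - 2} - {i - 1}"
      then consider "j < i - 1" | "n - 2 - j < ?m - 1" using i by fastforce
      then show "coeff ?f j * coeff ?g (n - 2 - j) = 0"
        by cases (simp_all only: coeff_knot_low mult_zero_left mult_zero_right)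
    qed
  qed (use i in auto)
  also have "\<dots> = coeff ?f (i - 1) * coeff ?g (n - i - 1)" using i by (simp add: numeral_2_eq_2)
  finally show ?thesis .
qed

section \<open>A recursion for the leading coefficient\<close>

definition lead :: "nat \<Rightarrow> real \<Rightarrow> (nat \<Rightarrow> nat) \<Rightarrow> real" where
  "lead n t a = coeff (ctrace n t (W (jpow n a @ [1..<n]))) (n - 1)"

lemma lead_alt:
  "lead n t a = (\<Sum>B\<in>Pow {1..n}. t ^ card B * coeff (hops (col_less B) (jpow n a @ [1..<n]) (delta id) id) (n - 1))"
proof -
  have "set (jpow n a @ [1..<n]) \<subseteq> {1..<n}" using set_jpow[of n a] by simp
  from ctrace_eq_coloured[OF this] show ?thesis by (simp only: lead_def coeff_sum coeff_smult)
qed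

lemma col_less_shift: "col_less (B1 \<union> (+) i ` B2) (i + x) (i + y) = col_less B2 x y"
  if "B1 \<subseteq> {1..i}" "1 \<le> x" "1 \<le> y"
proof -
  have "i + x \<in> B1 \<union> (+) i ` B2 \<longleftrightarrow> x \<in> B2" "i + y \<in> B1 \<union> (+) i ` B2 \<longleftrightarrow> y \<in> B2"
    using that by auto
  then show ?thesis by (simp add: col_less_def)
qed

lemma col_less_restrict: "col_less (B1 \<union> (+) i ` B2) x y = col_less B1 x y"
  if "B2 \<subseteq> {1..m}" "x \<le> i" "y \<le> i"
proof -
  have "x \<in> B1 \<union> (+) i ` B2 \<longleftrightarrow> x \<in> B1" "y \<in> B1 \<union> (+) i ` B2 \<longleftrightarrow> y \<in> B1"
    using that by auto
  then show ?thesis by (simp add: col_less_def)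
qed

lemma sum_Pow_split:
  fixes f :: "nat set \<Rightarrow> real"
  shows "(\<Sum>B\<in>Pow {1..i + m}. f B) = (\<Sum>B1\<in>Pow {1..i}. \<Sum>B2\<in>Pow {1..m}. f (B1 \<union> (+) i ` B2))"
proof -
  have "(\<Sum>B\<in>Pow {1..i + m}. f B) = (\<Sum>(B1, B2)\<in>Pow {1..i} \<times> Pow {1..m}. f (B1 \<union> (+) i ` B2))"
  proof (rule sum.reindex_bij_witness[where
        j="\<lambda>B. (B \<inter> {1..i}, (\<lambda>x. x - i) ` (B \<inter> {Suc i..i + m}))" and i="\<lambda>(B1, B2). B1 \<union> (+) i ` B2"])
    fix B assume "B \<in> Pow {1..i + m}"
    then have B: "B \<subseteq> {1..i + m}" by simp
    have "(+) i ` ((\<lambda>x. x - i) ` (B \<inter> {Suc i..i + m})) = B \<inter> {Suc i..i + m}"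
      by (force simp: image_image)
    then show *: "(case (B \<inter> {1..i}, (\<lambda>x. x - i) ` (B \<inter> {Suc i..i + m})) of (B1, B2) \<Rightarrow> B1 \<union> (+) i ` B2) = B"
      using B by auto
    show "(B \<inter> {1..i}, (\<lambda>x. x - i) ` (B \<inter> {Suc i..i + m})) \<in> Pow {1..i} \<times> Pow {1..m}"
      by auto
    show "(case (B \<inter> {1..i}, (\<lambda>x. x - i) ` (B \<inter> {Suc i..i + m})) of (B1, B2) \<Rightarrow> f (B1 \<union> (+) i ` B2)) = f B"
      using * by simp
  next
    fix p assume "p \<in> Pow {1..i} \<times> Pow {1..m}"
    then obtain B1 B2 where p: "p = (B1, B2)" "B1 \<subseteq> {1..i}" "B2 \<subseteq> {1..m}" by auto
    have "(B1 \<union> (+) i ` B2) \<inter> {1..i} = B1" using p by force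
    moreover have "(B1 \<union> (+) i ` B2) \<inter> {Suc i..i + m} = (+) i ` B2" using p by force
    moreover have "(\<lambda>x. x - i) ` (+) i ` B2 = B2" by (simp add: image_image)
    ultimately show "((case p of (B1, B2) \<Rightarrow> B1 \<union> (+) i ` B2) \<inter> {1..i},
      (\<lambda>x. x - i) ` ((case p of (B1, B2) \<Rightarrow> B1 \<union> (+) i ` B2) \<inter> {Suc i..i + m})) = p"
      using p(1) by simp
    show "(case p of (B1, B2) \<Rightarrow> B1 \<union> (+) i ` B2) \<in> Pow {1..i + m}" using p by force
  qed
  then show ?thesis by (simp only: sum.cartesian_product)
qed

text \<open>A subset of \<open>{1..n}\<close> is a pair of subsets of \<open>{1..i}\<close> and of \<open>{i+1..n}\<close>, and \<open>col_less\<close> restricts accordingly.\<close>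

lemma lead_two_components:
  assumes i: "1 \<le> i" "i < n"
  shows "coeff (ctrace n t (W (jpow n a @ [1..<i] @ [Suc i..<n]))) (n - 2) =
    lead i t a * lead (n - i) t (\<lambda>l. a (i + l))"
proof -
  let ?m = "n - i" and ?w = "jpow n a @ [1..<i] @ [Suc i..<n]"
  let ?w1 = "jpow i a @ [1..<i]" and ?w2 = "jpow ?m (\<lambda>l. a (i + l)) @ [1..<?m]"
  have n: "{1..n} = {1..i + ?m}" using i by simp
  have w: "set ?w \<subseteq> {1..<n}" using set_jpow[of n a] i by auto
  have w1: "set ?w1 \<subseteq> {1..<i}" using set_jpow[of i a] by simp
  have w2: "set ?w2 \<subseteq> {1..<?m}" using set_jpow[of ?m "\<lambda>l. a (i + l)"] by simp
  have "coeff (ctrace n t (W ?w)) (n - 2) = (\<Sum>B\<in>Pow {1..i + ?m}. t ^ card B *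
      (coeff (hops (col_less B) ?w1 (delta id) id) (i - 1) *
       coeff (hops (\<lambda>x y. col_less B (i + x) (i + y)) ?w2 (delta id) id) (n - i - 1)))"
    by (simp only: ctrace_eq_coloured[OF w] coeff_sum coeff_smult coeff_two_components[OF i] n)
  also have "\<dots> = (\<Sum>B1\<in>Pow {1..i}. \<Sum>B2\<in>Pow {1..?m}.
      (t ^ card B1 * coeff (hops (col_less B1) ?w1 (delta id) id) (i - 1)) *
      (t ^ card B2 * coeff (hops (col_less B2) ?w2 (delta id) id) (?m - 1)))"
    unfolding sum_Pow_split
  proof (intro sum.cong refl)
    fix B1 B2 assume B: "B1 \<in> Pow {1..i}" "B2 \<in> Pow {1..?m}"
    let ?B = "B1 \<union> (+) i ` B2"
    have "finite B1" "finite B2" using B finite_subset by auto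
    moreover have "B1 \<inter> (+) i ` B2 = {}" using B by force
    ultimately have c: "card ?B = card B1 + card B2"
      by (subst card_Un_disjoint) (auto simp: card_image)
    have 1: "hops (col_less ?B) ?w1 (delta id) id = hops (col_less B1) ?w1 (delta id) id"
      by (rule hops_rel_cong[OF _ w1 permutes_id], rule col_less_restrict) (use B in auto)
    have 2: "hops (\<lambda>x y. col_less ?B (i + x) (i + y)) ?w2 (delta id) id = hops (col_less B2) ?w2 (delta id) id"
      by (rule hops_rel_cong[OF _ w2 permutes_id], rule col_less_shift) (use B in auto)
    show "t ^ card ?B * (coeff (hops (col_less ?B) ?w1 (delta id) id) (i - 1) *
       coeff (hops (\<lambda>x y. col_less ?B (i + x) (i + y)) ?w2 (delta id) id) (n - i - 1)) =
      (t ^ card B1 * coeff (hops (col_less B1) ?w1 (delta id) id) (i - 1)) *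
      (t ^ card B2 * coeff (hops (col_less B2) ?w2 (delta id) id) (?m - 1))"
      unfolding 1 2 c power_add by (simp only: mult_ac)
  qed
  also have "\<dots> = lead i t a * lead ?m t (\<lambda>l. a (i + l))"
    by (simp only: lead_alt sum_product)
  finally show ?thesis .
qed

text \<open>The coefficient of \<open>z ^ (n - 1)\<close> in the skein relation; its last term has two components.\<close>

lemma lead_skein:
  assumes i: "1 \<le> i" "i < n" and a: "0 < a (Suc i)"
  shows "lead n t a = lead n t (a(i := Suc (a i), Suc i := a (Suc i) - 1)) +
    lead i t a * lead (n - i) t (\<lambda>l. a (i + l))"
proof -
  let ?b = "a(Suc i := a (Suc i) - 1)"
  have ab: "?b(Suc i := Suc (?b (Suc i))) = a" using a by simp
  have ab': "?b(i := Suc (?b i)) = a(i := Suc (a i), Suc i := a (Suc i) - 1)" by auto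
  have n: "n - 1 = Suc (n - 2)" using i by simp
  have "lead n t a = lead n t (?b(i := Suc (?b i))) +
     coeff (zvar * ctrace n t (W (jpow n a @ [1..<i] @ [Suc i..<n]))) (n - 1)"
    using arg_cong[OF ctrace_skein[OF i, of t ?b], of "\<lambda>p. coeff p (n - 1)"]
    unfolding ab lead_def coeff_add .
  also have "coeff (zvar * ctrace n t (W (jpow n a @ [1..<i] @ [Suc i..<n]))) (n - 1) =
     lead i t a * lead (n - i) t (\<lambda>l. a (i + l))"
    unfolding n zvar_mult_coeff nat.case by (rule lead_two_components[OF i])
  finally show ?thesis unfolding ab' .
qed

lemma coeff_hops_top:
  "length ws \<le> k \<Longrightarrow> coeff (hops r ws (delta v) u) k =
    of_bool (k = length ws \<and> u = v \<and> (\<forall>i\<in>set ws. r (u i) (u (Suc i))))"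
proof (induction ws arbitrary: u k)
  case Nil
  then show ?case by (cases "u = v") (auto simp: delta_def coeff_1)
next
  case (Cons i ws)
  then obtain m where m: "k = Suc m" by (cases k) auto
  have "coeff (hops r ws (delta v) (u \<circ> simple_refl i)) k = 0"
    by (subst Cons.IH) (use Cons.prems in auto)
  moreover have "coeff (hops r ws (delta v) u) m = of_bool (m = length ws \<and> u = v \<and> (\<forall>i\<in>set ws. r (u i) (u (Suc i))))"
    by (rule Cons.IH) (use Cons.prems m in auto)
  ultimately show ?case unfolding hops_Cons coeff_hop m nat.case by (auto simp: m)
qed

text \<open>Without Jucys--Murphy factors every letter must be deleted, and \<open>col_less B\<close> must be the natural order of
\<open>{1..n}\<close>.\<close>

lemma lead_base:
  assumes n: "1 \<le> n" and a: "\<And>l. l \<in> {2..n} \<Longrightarrow> a l = 0"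
  shows "lead n t a = 1 + t"
proof -
  have "jp a l = []" if "l \<in> {1..n}" for l
  proof (cases "l = 1")
    case True
    have "concat (replicate k []) = []" for k by (induction k) auto
    then show ?thesis by (simp add: True jp_def)
  next
    case False
    then show ?thesis using a[of l] that by (simp add: jp_def)
  qed
  then have "map (jp a) [1..<Suc n] = map (\<lambda>_. []) [1..<Suc n]" by (intro map_cong) auto
  moreover have "concat (map (\<lambda>_. []) xs) = []" for xs :: "nat list" by (induction xs) auto
  ultimately have j: "jpow n a = []" by (simp only: jpow_def)
  have "lead n t a = (\<Sum>B\<in>Pow {1..n}. t ^ card B * of_bool (\<forall>i\<in>{1..<n}. col_less B i (Suc i)))"
    unfolding lead_alt j append_Nil by (subst coeff_hops_top) simp_all
  also have "\<dots> = (\<Sum>B\<in>{{}, {n}}. t ^ card B * of_bool (\<forall>i\<in>{1..<n}. col_less B i (Suc i)))"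
  proof (rule sum.mono_neutral_right)
    show "\<forall>B\<in>Pow {1..n} - {{}, {n}}. t ^ card B * of_bool (\<forall>i\<in>{1..<n}. col_less B i (Suc i)) = 0"
    proof
      fix B assume B: "B \<in> Pow {1..n} - {{}, {n}}"
      then obtain i where "i \<in> B" "i \<noteq> n" by blast
      then have "i \<in> {1..<n}" "\<not> col_less B i (Suc i)" using B by (auto simp: col_less_def)
      then have "\<not> (\<forall>i\<in>{1..<n}. col_less B i (Suc i))" by blast
      then show "t ^ card B * of_bool (\<forall>i\<in>{1..<n}. col_less B i (Suc i)) = 0" by simp
    qed
  qed (use n in auto)
  also have "\<dots> = 1 + t"
  proof -
    have "\<forall>i\<in>{1..<n}. col_less {} i (Suc i)" "\<forall>i\<in>{1..<n}. col_less {n} i (Suc i)"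
      by (auto simp: col_less_def)
    then show ?thesis by simp
  qed
  finally show ?thesis .
qed

section \<open>Lattice paths\<close>

definition psum :: "(nat \<Rightarrow> nat) \<Rightarrow> nat \<Rightarrow> nat" where
  "psum a i = (\<Sum>l=1..i. a l)"

text \<open>Lattice paths, encoded by the numbers \<open>m\<close> of up steps in the columns. The columns are divided into blocks of
sizes \<open>a 1, \<dots>, a n\<close>, and just before the last of the first \<open>psum a i\<close> columns the height must be less than \<open>i\<close>.
The condition is void if \<open>psum a i = 0\<close>.\<close>

definition paths :: "nat \<Rightarrow> (nat \<Rightarrow> nat) \<Rightarrow> nat list set" where
  "paths n a = {m. length m = psum a n \<and> sum_list m = n \<and> (\<forall>i\<in>{1..n}. sum_list (take (psum a i - 1) m) < i)}"

text \<open>The weight counts the columns with an up step.\<close>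

definition wt :: "real \<Rightarrow> nat list \<Rightarrow> real" where
  "wt y m = y ^ length (filter (\<lambda>x. x \<noteq> 0) m)"

lemma wt_append: "wt y (m1 @ m2) = wt y m1 * wt y m2"
  by (simp add: wt_def power_add)

lemma psum_mono: "i \<le> j \<Longrightarrow> psum a i \<le> psum a j"
  unfolding psum_def by (intro sum_mono2) auto

lemma psum_Suc [simp]: "psum a (Suc i) = psum a i + a (Suc i)"
  by (simp add: psum_def)

lemma psum_0 [simp]: "psum a 0 = 0" by (simp add: psum_def)

lemma psum_shift: "psum a (i + l) = psum a i + psum (\<lambda>l. a (i + l)) l"
  by (induction l) simp_all

lemma sum_list_take_mono: "i \<le> j \<Longrightarrow> sum_list (take i m) \<le> sum_list (take j (m :: nat list))"
proof -
  assume "i \<le> j"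
  then have "take j m = take i m @ take (j - i) (drop i m)" by (metis le_add_diff_inverse take_add)
  then show ?thesis by simp
qed

lemma finite_compositions: "finite {m :: nat list. length m = p \<and> sum_list m = n}"
proof (rule finite_subset)
  show "{m. length m = p \<and> sum_list m = n} \<subseteq> {m. set m \<subseteq> {..n} \<and> length m = p}"
    using member_le_sum_list by auto
qed (rule finite_lists_length_eq, simp)

lemma finite_paths [simp]: "finite (paths n a)"
  by (rule finite_subset[OF _ finite_compositions[of "psum a n" n]]) (auto simp: paths_def)

text \<open>Moving one column from block \<open>i + 1\<close> to block \<open>i\<close> sharpens the bound \<open>\<le> i\<close> for the height after the first
\<open>psum a i\<close> columns to \<open>< i\<close>. The paths that are lost have height exactly \<open>i\<close> there, and split at that point
into two independent paths.\<close>

lemma paths_split: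
  assumes i: "1 \<le> i" "i < n" and a: "0 < a (Suc i)" "0 < a 1"
  shows "(\<Sum>m\<in>paths n a. wt y m) = (\<Sum>m\<in>paths n (a(i := Suc (a i), Suc i := a (Suc i) - 1)). wt y m) +
    (\<Sum>m\<in>paths i a. wt y m) * (\<Sum>m\<in>paths (n - i) (\<lambda>l. a (i + l)). wt y m)"
proof -
  define b where "b = a(i := Suc (a i), Suc i := a (Suc i) - 1)"
  let ?s = "\<lambda>l. a (i + l)" and ?k = "n - i"
  have bi: "psum b l = (if l = i then Suc (psum a i) else psum a l)" for l
  proof (induction l)
    case (Suc l)
    then show ?case using i a by (auto simp: b_def)
  qed (use i in simp)
  have pos: "1 \<le> psum a l" if "1 \<le> l" for l
    using psum_mono[OF that, of a] a by simp
  have ij: "Suc (psum a i) \<le> psum a l" if "i < l" for l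
    using psum_mono[of "Suc i" l a] that a by simp
  \<comment> \<open>The paths that split, and the concatenations of two shorter paths.\<close>
  define P where "P = {m \<in> paths n a. sum_list (take (psum a i) m) = i}"
  define X where "X = (\<lambda>(m1, m2). m1 @ m2) ` (paths i a \<times> paths ?k ?s)"
  have tk: "take (psum a i - 1) m = take (psum a i - 1) (take (psum a i) m)" for m :: "nat list"
    by (simp add: min_def)
  have sub: "paths n b = {m \<in> paths n a. sum_list (take (psum a i) m) < i}"
  proof -
    have "m \<in> paths n b \<longleftrightarrow> m \<in> paths n a \<and> sum_list (take (psum a i) m) < i" for m
    proof
      assume m: "m \<in> paths n b"
      then have c: "sum_list (take (psum b l - 1) m) < l" if "l \<in> {1..n}" for l
        using that by (simp add: paths_def)
      have 1: "sum_list (take (psum a i) m) < i" using c[of i] i by (simp add: bi)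
      have "sum_list (take (psum a l - 1) m) < l" if "l \<in> {1..n}" for l
      proof (cases "l = i")
        case True
        have "sum_list (take (psum a i - 1) m) \<le> sum_list (take (psum a i) m)"
          by (rule sum_list_take_mono) simp
        then show ?thesis using 1 True by simp
      next
        case False
        then show ?thesis using c[OF that] by (simp add: bi)
      qed
      then show "m \<in> paths n a \<and> sum_list (take (psum a i) m) < i"
        using m 1 i by (simp add: paths_def bi)
    next
      assume "m \<in> paths n a \<and> sum_list (take (psum a i) m) < i"
      then show "m \<in> paths n b" using i by (auto simp: paths_def bi)
    qed
    then show ?thesis by blast
  qed
  have le: "sum_list (take (psum a i) m) \<le> i" if "m \<in> paths n a" for m
  proof -
    have "sum_list (take (psum a i) m) \<le> sum_list (take (psum a (Suc i) - 1) m)"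
      by (rule sum_list_take_mono) (use a in simp)
    also have "\<dots> < Suc i"
    proof -
      have "\<forall>l\<in>{1..n}. sum_list (take (psum a l - 1) m) < l" using that by (simp add: paths_def)
      then show ?thesis by (rule bspec) (use i in simp)
    qed
    finally show ?thesis by simp
  qed
  have PX: "P = X"
  proof (intro subset_antisym subsetI)
    fix m assume "m \<in> P"
    then have m: "length m = psum a n" "sum_list m = n" "sum_list (take (psum a i) m) = i"
      and c: "\<And>l. l \<in> {1..n} \<Longrightarrow> sum_list (take (psum a l - 1) m) < l"
      by (auto simp: P_def paths_def)
    let ?m1 = "take (psum a i) m" and ?m2 = "drop (psum a i) m"
    have s: "sum_list ?m1 + sum_list ?m2 = n" using m(2) by (metis append_take_drop_id sum_list_append)
    have "?m1 \<in> paths i a"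
    proof -
      have "take (psum a l - 1) ?m1 = take (psum a l - 1) m" if "l \<in> {1..i}" for l
      proof -
        have "psum a l - 1 \<le> psum a i" using psum_mono[of l i a] that by simp
        then show ?thesis by (simp add: min_def)
      qed
      then have "\<forall>l\<in>{1..i}. sum_list (take (psum a l - 1) ?m1) < l" using c i by simp
      moreover have "length ?m1 = psum a i" using m(1) psum_mono[of i n a] i by simp
      ultimately show ?thesis using m(3) by (simp add: paths_def)
    qed
    moreover have "?m2 \<in> paths ?k ?s"
    proof -
      have "sum_list (take (psum ?s l - 1) ?m2) < l" if l: "l \<in> {1..?k}" for l
      proof -
        have "psum a (i + l) - 1 = psum a i + (psum ?s l - 1)"
          using ij[of "i + l"] l unfolding psum_shift by simp
        then have "take (psum a (i + l) - 1) m = ?m1 @ take (psum ?s l - 1) ?m2"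
          by (simp only: take_add)
        then have "sum_list (take (psum a (i + l) - 1) m) = i + sum_list (take (psum ?s l - 1) ?m2)"
          using m(3) by simp
        moreover have "i + l \<in> {1..n}" using l i by auto
        ultimately show ?thesis using c[of "i + l"] by simp
      qed
      moreover have "length ?m2 = psum ?s ?k" using m(1) psum_shift[of a i ?k] i by simp
      ultimately show ?thesis using s m(3) by (simp add: paths_def)
    qed
    ultimately show "m \<in> X" unfolding X_def by (intro image_eqI[of _ _ "(?m1, ?m2)"]) auto
  next
    fix m assume "m \<in> X"
    then obtain m1 m2 where m: "m = m1 @ m2" and P: "m1 \<in> paths i a" "m2 \<in> paths ?k ?s"
      by (auto simp: X_def)
    have m1: "length m1 = psum a i" "sum_list m1 = i" using P(1) by (simp_all add: paths_def)
    have m2: "length m2 = psum ?s ?k" "sum_list m2 = ?k" using P(2) by (simp_all add: paths_def)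
    have m1c: "sum_list (take (psum a l - 1) m1) < l" if "l \<in> {1..i}" for l
      using P(1) that unfolding paths_def by blast
    have m2c: "sum_list (take (psum ?s l - 1) m2) < l" if "l \<in> {1..?k}" for l
      using P(2) that unfolding paths_def by blast
    have "sum_list (take (psum a l - 1) m) < l" if l: "l \<in> {1..n}" for l
    proof (cases "l \<le> i")
      case True
      then have "psum a l - 1 \<le> length m1" using psum_mono[of l i a] m1(1) by simp
      then show ?thesis using m1c[of l] l True m by simp
    next
      case False
      define l' where "l' = l - i"
      have l': "l = i + l'" "l' \<in> {1..?k}" using False l by (auto simp: l'_def)
      have "psum a l - 1 = psum a i + (psum ?s l' - 1)"
        using ij[of l] False unfolding l'(1) psum_shift by simp
      then have "sum_list (take (psum a l - 1) m) = i + sum_list (take (psum ?s l' - 1) m2)"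
        using m1 m by (simp add: take_add)
      then show ?thesis using m2c[OF l'(2)] l' by simp
    qed
    moreover have "length m = psum a n" using m m1(1) m2(1) psum_shift[of a i ?k] i by simp
    moreover have "sum_list m = n" using m m1(2) m2(2) i by simp
    moreover have "sum_list (take (psum a i) m) = i" using m m1 by simp
    ultimately show "m \<in> P" by (simp add: P_def paths_def)
  qed
  have "m \<in> paths n b \<union> P" if "m \<in> paths n a" for m
    using le[OF that] that unfolding sub P_def by auto
  moreover have "paths n b \<subseteq> paths n a" "P \<subseteq> paths n a" unfolding sub P_def by blast+
  ultimately have U: "paths n a = paths n b \<union> P" by blast
  have "paths n b \<inter> P = {}" unfolding sub P_def by auto
  moreover have "finite P" using finite_paths[of n a] by (simp add: P_def)
  ultimately have "(\<Sum>m\<in>paths n a. wt y m) = (\<Sum>m\<in>paths n b. wt y m) + (\<Sum>m\<in>P. wt y m)"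
    unfolding U by (intro sum.union_disjoint) simp_all
  also have "(\<Sum>m\<in>P. wt y m) = (\<Sum>(m1, m2)\<in>paths i a \<times> paths ?k ?s. wt y (m1 @ m2))"
    unfolding PX X_def
  proof (subst sum.reindex)
    show "inj_on (\<lambda>(m1, m2). m1 @ m2) (paths i a \<times> paths ?k ?s)"
    proof (rule inj_onI, clarify)
      fix m1 m2 m1' m2' assume "m1 \<in> paths i a" "m1' \<in> paths i a" and e: "m1 @ m2 = m1' @ m2'"
      then have "length m1 = length m1'" by (simp add: paths_def)
      with e show "m1 = m1' \<and> m2 = m2'" by simp
    qed
  qed (simp add: case_prod_unfold)
  also have "\<dots> = (\<Sum>m\<in>paths i a. wt y m) * (\<Sum>m\<in>paths ?k ?s. wt y m)"
    by (simp add: wt_append sum_product sum.cartesian_product)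
  finally show ?thesis unfolding b_def .
qed

lemma paths_base:
  assumes n: "1 \<le> n" and a: "\<And>l. l \<in> {2..n} \<Longrightarrow> a l = 0" and a1: "0 < a 1"
  shows "(\<Sum>m\<in>paths n a. wt y m) = y"
proof -
  have ps: "psum a l = a 1" if "l \<in> {1..n}" for l
  proof -
    have "psum a l = sum a {1}" unfolding psum_def
      by (rule sum.mono_neutral_right) (use that a in auto)
    then show ?thesis by simp
  qed
  obtain q where q: "a 1 = Suc q" using a1 by (cases "a 1") auto
  have "paths n a = {replicate q 0 @ [n]}"
  proof (intro subset_antisym subsetI)
    fix m assume m: "m \<in> paths n a"
    then have len: "length m = Suc q" and sm: "sum_list m = n"
      using ps[of n] n q by (auto simp: paths_def)
    have "\<forall>l\<in>{1..n}. sum_list (take (psum a l - 1) m) < l" using m by (simp add: paths_def)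
    then have "sum_list (take (psum a 1 - 1) m) < 1" by (rule bspec) (use n in simp)
    then have z: "sum_list (take q m) = 0" using ps[of 1] n q by simp
    then have "take q m = replicate q 0"
      by (intro replicate_eqI) (use len in \<open>auto simp: sum_list_eq_0_iff\<close>)
    moreover have "m = take q m @ [m ! q]" using len by (metis lessI order_refl take_Suc_conv_app_nth take_all)
    ultimately have "m = replicate q 0 @ [m ! q]" by simp
    moreover from this have "m ! q = n" using sm by (metis add_0 sum_list_append sum_list_replicate mult_zero_right sum_list.Cons sum_list.Nil add_0_right)
    ultimately show "m \<in> {replicate q 0 @ [n]}" by simp
  next
    fix m assume "m \<in> {replicate q 0 @ [n]}"
    then show "m \<in> paths n a" using ps n q by (auto simp: paths_def sum_list_replicate)
  qed
  then show ?thesis using n by (simp add: wt_def)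
qed

text \<open>Both sides satisfy the recursion \<open>lead_skein\<close>. It either moves a unit of an exponent to the left or
splits the sequence, so it ends when only \<open>a 1\<close> is nonzero.\<close>

lemma lead_eq_paths:
  assumes "1 \<le> n" "0 < a 1"
  shows "lead n t a = (\<Sum>m\<in>paths n a. wt (1 + t) m)"
  using assms
proof (induction "(n, \<Sum>l=1..n. l * a l)" arbitrary: n a rule: wf_induct_rule[OF wf_lex_prod[OF wf_less_than wf_less_than]])
  case (1 n a)
  note IH = "1.hyps"
  show ?case
  proof (cases "\<forall>l\<in>{2..n}. a l = 0")
    case True
    then show ?thesis using lead_base[of n a] paths_base[of n a] 1 by simp
  next
    case False
    then obtain j where j: "j \<in> {2..n}" "a j \<noteq> 0" by blast
    define i where "i = j - 1"
    have i: "1 \<le> i" "i < n" and ai: "0 < a (Suc i)" using j by (auto simp: i_def)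
    let ?b = "a(i := Suc (a i), Suc i := a (Suc i) - 1)"
    have less: "(\<Sum>l=1..n. l * ?b l) < (\<Sum>l=1..n. l * a l)"
    proof -
      have *: "(\<Sum>l=1..n. l * f l) = i * f i + Suc i * f (Suc i) + (\<Sum>l\<in>{1..n} - {i, Suc i}. l * f l)" for f :: "nat \<Rightarrow> nat"
        using sum.subset_diff[of "{i, Suc i}" "{1..n}" "\<lambda>l. l * f l"] i by simp
      have "(\<Sum>l\<in>{1..n} - {i, Suc i}. l * ?b l) = (\<Sum>l\<in>{1..n} - {i, Suc i}. l * a l)"
        by (rule sum.cong) auto
      moreover obtain q where "a (Suc i) = Suc q" using ai by (cases "a (Suc i)") auto
      ultimately show ?thesis unfolding *[of ?b] *[of a] by simp
    qed
    have b1: "0 < ?b 1" using 1(3) i by auto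
    have "lead n t ?b = (\<Sum>m\<in>paths n ?b. wt (1 + t) m)"
      by (rule IH[of n ?b, OF _ 1(2) b1]) (use less in simp)
    moreover have "lead i t a = (\<Sum>m\<in>paths i a. wt (1 + t) m)"
      by (rule IH[of i a, OF _ i(1) 1(3)]) (use i in simp)
    moreover have "lead (n - i) t (\<lambda>l. a (i + l)) = (\<Sum>m\<in>paths (n - i) (\<lambda>l. a (i + l)). wt (1 + t) m)"
      by (rule IH[of "n - i" "\<lambda>l. a (i + l)"]) (use i ai in auto)
    ultimately show ?thesis
      unfolding lead_skein[where a=a, OF i ai] paths_split[where a=a, OF i ai 1(3)] by (simp only:)
  qed
qed

section \<open>The cycle lemma\<close>

text \<open>The difference \<open>\<lceil>l p / n\<rceil> - \<lceil>(l - 1) p / n\<rceil>\<close>.\<close>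

definition cexp :: "nat \<Rightarrow> nat \<Rightarrow> nat \<Rightarrow> nat" where
  "cexp n p l = (l * p + n - 1) div n - ((l - 1) * p + n - 1) div n"

lemma psum_cexp:
  assumes "0 < n"
  shows "psum (cexp n p) i = (i * p + n - 1) div n"
proof (induction i)
  case 0
  then show ?case using assms by simp
next
  case (Suc i)
  have "(i * p + n - 1) div n \<le> (Suc i * p + n - 1) div n" by (intro div_le_mono) simp
  then show ?case using Suc by (simp add: cexp_def)
qed

lemma ceiling_le_iff:
  assumes "0 < n"
  shows "(x + n - 1) div n \<le> j \<longleftrightarrow> x \<le> j * (n :: nat)"
proof -
  have "(x + n - 1) div n \<le> j \<longleftrightarrow> (x + n - 1) div n < Suc j" by auto
  also have "\<dots> \<longleftrightarrow> x + n - 1 < Suc j * n" using assms by (rule div_less_iff_less_mult)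
  also have "\<dots> \<longleftrightarrow> x \<le> j * n" using assms by auto
  finally show ?thesis .
qed

definition comps :: "nat \<Rightarrow> nat \<Rightarrow> nat list set" where
  "comps n p = {m. length m = p \<and> sum_list m = n}"

text \<open>Rational Dyck paths: strictly below the diagonal of a \<open>p\<close> by \<open>n\<close> rectangle, except at its corners.\<close>

definition dyck :: "nat \<Rightarrow> nat \<Rightarrow> nat list set" where
  "dyck n p = {m \<in> comps n p. \<forall>j. 0 < j \<longrightarrow> j < p \<longrightarrow> p * sum_list (take j m) < j * n}"

text \<open>The blocks end at the columns \<open>\<lceil>i p / n\<rceil>\<close>, where the diagonal crosses the height \<open>i\<close>. As \<open>p\<close> and \<open>n\<close> are
coprime, the diagonal meets no lattice point in between.\<close>

lemma paths_cexp:
  assumes n: "0 < n" and p: "0 < p" and cop: "coprime p n"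
  shows "paths n (cexp n p) = dyck n p"
proof -
  have L: "psum (cexp n p) n = p"
  proof -
    have "n * p + n - 1 = (n - 1) + p * n" using n by (simp add: mult.commute)
    then have "(n * p + n - 1) div n = p + (n - 1) div n" using n by (simp only: div_mult_self1 not_gr_zero)
    then show ?thesis using n by (simp only: psum_cexp) simp
  qed
  have key: "(\<forall>i\<in>{1..n}. sum_list (take (psum (cexp n p) i - 1) m) < i) \<longleftrightarrow>
     (\<forall>j. 0 < j \<longrightarrow> j < p \<longrightarrow> p * sum_list (take j m) < j * n)" (is "?A \<longleftrightarrow> ?B") for m
  proof
    assume A: ?A
    show ?B
    proof (intro allI impI, rule ccontr)
      fix j assume j: "0 < j" "j < p" and "\<not> p * sum_list (take j m) < j * n"
      then have ge: "j * n \<le> p * sum_list (take j m)" by simp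
      have "\<not> p dvd j * n"
        using j cop coprime_dvd_mult_left_iff[of p n j] by (auto dest: dvd_imp_le)
      then have nd: "j * n mod p \<noteq> 0" by (simp add: mod_eq_0_iff_dvd)
      \<comment> \<open>The diagonal point of column \<open>j\<close> lies strictly between the heights \<open>i - 1\<close> and \<open>i\<close>.\<close>
      define i where "i = j * n div p + 1"
      have i1: "i \<in> {1..n}"
      proof -
        have "j * n div p < n" using j n p by (simp add: div_less_iff_less_mult mult.commute)
        then show ?thesis by (simp add: i_def)
      qed
      have "j * n < i * p" unfolding i_def using p
        by (metis Suc_eq_plus1 dividend_less_div_times mult.commute mult_Suc mult_Suc_right add.commute)
      then have "\<not> psum (cexp n p) i \<le> j" unfolding psum_cexp[OF n] ceiling_le_iff[OF n] by simp
      then have "sum_list (take j m) \<le> sum_list (take (psum (cexp n p) i - 1) m)"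
        by (intro sum_list_take_mono) simp
      also have "\<dots> < i" using A i1 by blast
      finally have "sum_list (take j m) \<le> j * n div p" by (simp add: i_def)
      then have "p * sum_list (take j m) \<le> p * (j * n div p)" by simp
      also have "\<dots> < j * n" using nd by (metis div_mult_mod_eq less_add_same_cancel1 mult.commute neq0_conv)
      finally show False using ge by simp
    qed
  next
    assume B: ?B
    show ?A
    proof
      fix i assume i: "i \<in> {1..n}"
      define j where "j = psum (cexp n p) i - 1"
      have pos: "0 < psum (cexp n p) i"
      proof (rule ccontr)
        assume "\<not> ?thesis"
        then have "psum (cexp n p) i \<le> 0" by simp
        then have "i * p \<le> 0 * n" unfolding psum_cexp[OF n] ceiling_le_iff[OF n] .
        then show False using i p by simp
      qed
      have "\<not> psum (cexp n p) i \<le> j" using pos by (simp add: j_def)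
      then have ji: "j * n < i * p" unfolding psum_cexp[OF n] ceiling_le_iff[OF n] by simp
      show "sum_list (take (psum (cexp n p) i - 1) m) < i"
      proof (cases "j = 0")
        case True
        then show ?thesis unfolding j_def[symmetric] using i by simp
      next
        case False
        have "j < p" using pos psum_mono[of i n "cexp n p"] i L by (simp add: j_def)
        then have "p * sum_list (take j m) < j * n" using B False by simp
        then have "p * sum_list (take j m) < i * p" using ji by linarith
        then have "p * sum_list (take j m) < p * i" by (simp only: mult.commute[of p i])
        then show ?thesis by (simp add: j_def)
      qed
    qed
  qed
  show ?thesis unfolding paths_def dyck_def comps_def L key by blast
qed

text \<open>The vertical distance, scaled by the number of columns, of the path from the diagonal after \<open>j\<close> columns.\<close>

definition ht :: "nat \<Rightarrow> nat list \<Rightarrow> nat \<Rightarrow> int" where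
  "ht n m j = int j * int n - int (length m) * int (sum_list (take j m))"

lemma ht_0 [simp]: "ht n m 0 = 0" by (simp add: ht_def)

lemma ht_end: "m \<in> comps n p \<Longrightarrow> ht n m p = 0" by (simp add: ht_def comps_def)

text \<open>Modulo \<open>p\<close> the value at \<open>j\<close> is \<open>j n\<close>, and \<open>n\<close> is invertible.\<close>

lemma ht_inj:
  assumes "m \<in> comps n p" "coprime p n" "i < p" "j < p" "ht n m i = ht n m j"
  shows "i = j"
proof -
  have "int p dvd (int i - int j) * int n"
  proof -
    have "(int i - int j) * int n = int p * (int (sum_list (take i m)) - int (sum_list (take j m)))"
      using assms(1,5) by (simp add: ht_def comps_def algebra_simps)
    then show ?thesis by simp
  qed
  moreover have "coprime (int p) (int n)" using assms(2) by simp
  ultimately have "int p dvd int i - int j" using coprime_dvd_mult_left_iff by blast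
  then show ?thesis using assms(3,4) zdvd_imp_le[of "int p" "int i - int j"] zdvd_imp_le[of "int p" "int j - int i"]
    by (cases i j rule: linorder_cases) (auto simp: dvd_diff_commute)
qed

lemma sum_list_rotate: "sum_list (rotate j m) = sum_list (m :: nat list)"
proof (induction j)
  case (Suc j)
  have "sum_list (rotate1 l) = sum_list l" for l :: "nat list" by (cases l) simp_all
  with Suc show ?case by simp
qed simp

lemma rotate_comps: "rotate j m \<in> comps n p \<longleftrightarrow> m \<in> comps n p"
  by (simp add: comps_def sum_list_rotate)

lemma ht_rotate:
  assumes m: "m \<in> comps n p" and j: "j \<le> p" and i: "i \<le> p"
  shows "ht n (rotate j m) i = (if i + j \<le> p then ht n m (i + j) else ht n m (i + j - p)) - ht n m j"
proof (cases "j = p")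
  case True
  then have "rotate j m = m" using m by (simp add: comps_def)
  then show ?thesis using True ht_end[OF m] by auto
next
  case False
  then have jp: "j < p" using j by simp
  have len: "length m = p" and sm: "sum_list m = n" using m by (auto simp: comps_def)
  have r: "rotate j m = drop j m @ take j m" using len jp by (simp add: rotate_drop_take)
  show ?thesis
  proof (cases "i + j \<le> p")
    case True
    then have "take i (rotate j m) = take i (drop j m)" using len r by simp
    moreover have "take (j + i) m = take j m @ take i (drop j m)" by (rule take_add)
    then have "sum_list (take (i + j) m) = sum_list (take j m) + sum_list (take i (drop j m))"
      by (simp add: add.commute)
    ultimately show ?thesis using True len by (simp add: ht_def algebra_simps)
  next
    case False
    have "length (drop j m) \<le> i" "i - length (drop j m) = i + j - p" "i + j - p \<le> j"
      using False len i j by auto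
    then have "take i (rotate j m) = drop j m @ take (i + j - p) m"
      unfolding r by (simp only: take_append take_all take_take min_absorb1)
    moreover have "sum_list (take j m) + sum_list (drop j m) = n"
      using sm by (metis append_take_drop_id sum_list_append)
    then have "int (sum_list (drop j m)) = int n - int (sum_list (take j m))" by linarith
    then have "int p * int (sum_list (drop j m)) = int p * int n - int p * int (sum_list (take j m))"
      by (simp only: right_diff_distrib)
    ultimately show ?thesis using False len i j by (simp add: ht_def algebra_simps of_nat_diff)
  qed
qed

lemma dyck_iff_ht:
  "m \<in> dyck n p \<longleftrightarrow> m \<in> comps n p \<and> (\<forall>j. 0 < j \<longrightarrow> j < p \<longrightarrow> 0 < ht n m j)"
proof -
  have "0 < ht n m j \<longleftrightarrow> p * sum_list (take j m) < j * n" if "m \<in> comps n p" for j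
  proof -
    have "0 < ht n m j \<longleftrightarrow> int (p * sum_list (take j m)) < int (j * n)"
      using that by (simp add: ht_def comps_def)
    then show ?thesis by (simp only: of_nat_less_iff)
  qed
  then show ?thesis by (auto simp: dyck_def)
qed

text \<open>Rotation by \<open>j\<close> subtracts \<open>ht n m j\<close> from all values. So the rotation is a Dyck path iff \<open>j\<close> is the unique
minimum of \<open>ht n m\<close>, and the values are pairwise distinct by \<open>ht_inj\<close>.\<close>

lemma cycle_lemma_unique:
  assumes m: "m \<in> comps n p" and p: "0 < p" and cop: "coprime p n"
  shows "\<exists>!j. j < p \<and> rotate j m \<in> dyck n p"
proof -
  have good: "rotate j m \<in> dyck n p \<longleftrightarrow> (\<forall>i<p. i \<noteq> j \<longrightarrow> ht n m j < ht n m i)" if j: "j < p" for j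
  proof
    assume "rotate j m \<in> dyck n p"
    then have pos: "0 < ht n (rotate j m) i" if "0 < i" "i < p" for i using that by (simp add: dyck_iff_ht)
    show "\<forall>i<p. i \<noteq> j \<longrightarrow> ht n m j < ht n m i"
    proof (intro allI impI)
      fix i assume i: "i < p" "i \<noteq> j"
      show "ht n m j < ht n m i"
      proof (cases "j < i")
        case True
        then show ?thesis using pos[of "i - j"] ht_rotate[OF m, of j "i - j"] i j by simp
      next
        case False
        then have "0 < i + p - j" "i + p - j < p" using i j by auto
        moreover have "ht n (rotate j m) (i + p - j) = ht n m i - ht n m j"
          using ht_rotate[OF m, of j "i + p - j"] i j False ht_end[OF m] by (cases "i = 0") auto
        ultimately show ?thesis using pos[of "i + p - j"] by simp
      qed
    qed
  next
    assume min: "\<forall>i<p. i \<noteq> j \<longrightarrow> ht n m j < ht n m i"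
    have "0 < ht n (rotate j m) i" if i: "0 < i" "i < p" for i
    proof (cases "i + j < p")
      case True
      then show ?thesis using min ht_rotate[OF m, of j i] i j by simp
    next
      case False
      then have "ht n (rotate j m) i = ht n m (i + j - p) - ht n m j"
        using ht_rotate[OF m, of j i] i j ht_end[OF m] by (cases "i + j = p") auto
      moreover have "i + j - p < p" "i + j - p \<noteq> j" using False i j by auto
      ultimately show ?thesis using min by simp
    qed
    then show "rotate j m \<in> dyck n p" using m by (simp add: dyck_iff_ht rotate_comps)
  qed
  obtain j where j: "j < p" "\<And>i. i < p \<Longrightarrow> ht n m j \<le> ht n m i"
  proof -
    obtain j where "is_arg_min (ht n m) (\<lambda>i. i \<in> {..<p}) j"
      using ex_is_arg_min_if_finite[of "{..<p}" "ht n m"] p by auto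
    then show thesis by (intro that[of j]) (auto simp: is_arg_min_linorder)
  qed
  have strict: "ht n m j < ht n m i" if "i < p" "i \<noteq> j" for i
    using j(2)[OF that(1)] ht_inj[OF m cop that(1) j(1)] that(2) by force
  show ?thesis
  proof (rule ex1I[of _ j])
    show "j < p \<and> rotate j m \<in> dyck n p" using j(1) strict good by blast
    fix i assume i: "i < p \<and> rotate i m \<in> dyck n p"
    show "i = j"
    proof (rule ccontr)
      assume "i \<noteq> j"
      then have "ht n m i < ht n m j" using i good[of i] j(1) by blast
      then show False using j(2)[of i] i by simp
    qed
  qed
qed

lemma wt_rotate: "wt y (rotate j m) = wt y m"
proof -
  have "length (filter (\<lambda>x. x \<noteq> 0) (rotate j m)) = length (filter (\<lambda>x. x \<noteq> 0) m)"
  proof (induction j)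
    case (Suc j)
    have "length (filter P (rotate1 l)) = length (filter P l)" for P and l :: "nat list"
      by (cases l) simp_all
    with Suc show ?case by simp
  qed simp
  then show ?thesis by (simp add: wt_def)
qed

lemma cycle_lemma:
  assumes p: "0 < p" and cop: "coprime p n"
  shows "real p * (\<Sum>m\<in>dyck n p. wt y m) = (\<Sum>m\<in>comps n p. wt y m)"
proof -
  have fin: "finite (comps n p)" unfolding comps_def by (rule finite_compositions)
  have find: "finite (dyck n p)" by (rule finite_subset[OF _ fin]) (auto simp: dyck_def)
  have "(\<Sum>m\<in>comps n p. wt y m) = (\<Sum>m\<in>comps n p. \<Sum>j\<in>{j \<in> {..<p}. rotate j m \<in> dyck n p}. wt y m)"
  proof (rule sum.cong)
    fix m assume "m \<in> comps n p"
    from cycle_lemma_unique[OF this p cop] obtain j where "{j \<in> {..<p}. rotate j m \<in> dyck n p} = {j}" by auto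
    then show "wt y m = (\<Sum>j\<in>{j \<in> {..<p}. rotate j m \<in> dyck n p}. wt y m)" by simp
  qed simp
  also have "\<dots> = (\<Sum>j<p. \<Sum>m\<in>{m \<in> comps n p. rotate j m \<in> dyck n p}. wt y m)"
    by (rule sum.swap_restrict[OF fin]) simp
  also have "\<dots> = (\<Sum>j<p. \<Sum>m\<in>dyck n p. wt y m)"
  proof (rule sum.cong)
    fix j assume "j \<in> {..<p}"
    have rr: "rotate (p - j) (rotate j m) = m" "rotate j (rotate (p - j) m) = m" if "length m = p" for m :: "nat list"
      using \<open>j \<in> {..<p}\<close> that by (simp_all add: rotate_rotate)
    show "(\<Sum>m\<in>{m \<in> comps n p. rotate j m \<in> dyck n p}. wt y m) = (\<Sum>m\<in>dyck n p. wt y m)"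
      by (rule sum.reindex_bij_witness[where i="rotate (p - j)" and j="rotate j"])
        (use rr in \<open>auto simp: wt_rotate rotate_comps dyck_def comps_def sum_list_rotate\<close>)
  qed simp
  also have "\<dots> = real p * (\<Sum>m\<in>dyck n p. wt y m)" by simp
  finally show ?thesis by simp
qed

lemma lead_cexp:
  assumes n: "0 < n" and p: "0 < p" and cop: "coprime p n"
  shows "real p * lead n t (cexp n p) = (\<Sum>m\<in>comps n p. wt (1 + t) m)"
proof -
  have "0 < cexp n p 1"
  proof -
    have "psum (cexp n p) 1 = cexp n p 1" by (simp add: psum_def)
    moreover have "\<not> psum (cexp n p) 1 \<le> 0"
      unfolding psum_cexp[OF n] ceiling_le_iff[OF n] using p by simp
    ultimately show ?thesis by simp
  qed
  then have "lead n t (cexp n p) = (\<Sum>m\<in>paths n (cexp n p). wt (1 + t) m)"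
    by (intro lead_eq_paths) (use n in auto)
  then show ?thesis using cycle_lemma[OF p cop, of "1 + t"] paths_cexp[OF n p cop] by simp
qed

section \<open>All Coxeter words have the same coloured traces\<close>

definition wpow :: "nat list \<Rightarrow> nat \<Rightarrow> nat list" where
  "wpow xs p = concat (replicate p xs)"

lemma wpow_0 [simp]: "wpow xs 0 = []" and wpow_Suc: "wpow xs (Suc p) = xs @ wpow xs p"
  by (simp_all add: wpow_def)

lemma wpow_Suc': "wpow xs (Suc p) = wpow xs p @ xs"
  by (induction p) (simp_all add: wpow_Suc)

lemma wpow_rotate: "x @ wpow (y @ x) p = wpow (x @ y) p @ x"
  by (induction p) (simp_all add: wpow_Suc)

lemma W_wpow_cong: "W xs = W ys \<Longrightarrow> W (wpow xs p) = W (wpow ys p)"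
  by (induction p) (simp_all add: wpow_Suc W_append)

lemma ctrace_wpow_rotate:
  assumes "set x \<subseteq> {1..<n}"
  shows "ctrace n t (W (wpow (x @ y) p)) = ctrace n t (W (wpow (y @ x) p))"
proof (cases p)
  case (Suc q)
  have "wpow (x @ y) p = x @ (y @ wpow (x @ y) q)" by (simp add: Suc wpow_Suc)
  then have "ctrace n t (W (wpow (x @ y) p)) = ctrace n t (W ((y @ wpow (x @ y) q) @ x))"
    using ctrace_comm[OF assms] by simp
  also have "(y @ wpow (x @ y) q) @ x = wpow (y @ x) p"
    using wpow_rotate[of y x q] by (simp add: Suc wpow_Suc')
  finally show ?thesis .
qed simp

text \<open>Letters that must change places commute.\<close>

lemma W_partition:
  assumes "sorted_wrt (\<lambda>a b. \<not> P a \<and> P b \<longrightarrow> Suc a < b \<or> Suc b < a) xs"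
  shows "W xs = W (filter P xs @ filter (\<lambda>x. \<not> P x) xs)"
  using assms
proof (induction xs)
  case (Cons a xs)
  have IH: "W xs = W (filter P xs @ filter (\<lambda>x. \<not> P x) xs)" using Cons by simp
  have 0: "W (a # xs) = W ([a] @ filter P xs @ filter (\<lambda>x. \<not> P x) xs)"
    using W_cong[OF IH, of "[a]" "[]"] by simp
  show ?case
  proof (cases "P a")
    case False
    have c: "W (filter P xs @ [a]) = W ([a] @ filter P xs)"
      by (rule W_commute_words, rule W_commute') (use Cons.prems False in auto)
    have "W ([a] @ filter P xs @ filter (\<lambda>x. \<not> P x) xs) = W ([] @ ([a] @ filter P xs) @ filter (\<lambda>x. \<not> P x) xs)"
      by simp
    also have "\<dots> = W ([] @ (filter P xs @ [a]) @ filter (\<lambda>x. \<not> P x) xs)" by (rule W_cong[OF c[symmetric]])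
    finally show ?thesis using 0 False by simp
  qed (use 0 in simp)
qed simp

lemma distinct_order_cases:
  assumes "distinct xs" "a \<noteq> b"
  shows "sorted_wrt (\<lambda>x y. \<not> (x = a \<and> y = b)) xs \<or> sorted_wrt (\<lambda>x y. \<not> (x = b \<and> y = a)) xs"
proof (rule ccontr)
  assume "\<not> ?thesis"
  then obtain i j k l where ij: "i < j" "j < length xs" "xs ! i = a" "xs ! j = b"
    and kl: "k < l" "l < length xs" "xs ! k = b" "xs ! l = a"
    unfolding sorted_wrt_iff_nth_less by blast
  have "i = l" using nth_eq_iff_index_eq[OF assms(1), of i l] ij kl by simp
  moreover have "j = k" using nth_eq_iff_index_eq[OF assms(1), of j k] ij kl by simp
  ultimately show False using ij kl by simp
qed

text \<open>Letters \<open>\<le> m\<close> commute with letters \<open>> m\<close>, except for the pair \<open>m\<close>, \<open>m + 1\<close>, which occurs in one of the two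
orders. Depending on it, the smaller letters can be collected at the front or at the end; in the second
case a rotation of the power brings them to the front.\<close>

lemma ctrace_partition:
  assumes xs: "distinct xs" "set xs \<subseteq> {1..<n}"
  shows "ctrace n t (W (wpow xs p)) =
    ctrace n t (W (wpow (filter (\<lambda>x. x \<le> m) xs @ filter (\<lambda>x. \<not> x \<le> m) xs) p))"
proof -
  from distinct_order_cases[OF xs(1), of "Suc m" m]
  consider "sorted_wrt (\<lambda>x y. \<not> (x = Suc m \<and> y = m)) xs" | "sorted_wrt (\<lambda>x y. \<not> (x = m \<and> y = Suc m)) xs"
    by auto
  then show ?thesis
  proof cases
    case 1
    then have "sorted_wrt (\<lambda>a b. \<not> a \<le> m \<and> b \<le> m \<longrightarrow> Suc a < b \<or> Suc b < a) xs"
      by (rule sorted_wrt_mono_rel[rotated]) auto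
    from W_wpow_cong[OF W_partition[OF this]] show ?thesis by simp
  next
    case 2
    then have "sorted_wrt (\<lambda>a b. \<not> (\<not> a \<le> m) \<and> \<not> b \<le> m \<longrightarrow> Suc a < b \<or> Suc b < a) xs"
      by (rule sorted_wrt_mono_rel[rotated]) auto
    from W_wpow_cong[OF W_partition[OF this], of p]
    have "W (wpow xs p) = W (wpow (filter (\<lambda>x. \<not> x \<le> m) xs @ filter (\<lambda>x. x \<le> m) xs) p)" by simp
    then show ?thesis by (subst ctrace_wpow_rotate) (use xs in auto)
  qed
qed

lemma filter_eq_singleton: "distinct xs \<Longrightarrow> x \<in> set xs \<Longrightarrow> filter (\<lambda>y. y = x) xs = [x]"
  by (induction xs) (auto simp: filter_empty_conv)

text \<open>Partitioning successively at \<open>m = 1, 2, \<dots>\<close> sorts the word.\<close>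

lemma ctrace_coxeter:
  assumes xs: "distinct xs" "set xs = {1..<n}"
  shows "ctrace n t (W (wpow xs p)) = ctrace n t (W (wpow [1..<n] p))"
proof (cases "n = 0")
  case n: False
  have "m < n \<Longrightarrow> ctrace n t (W (wpow xs p)) = ctrace n t (W (wpow ([1..<Suc m] @ filter (\<lambda>x. \<not> x \<le> m) xs) p))" for m
  proof (induction m)
    case 0
    have "filter (\<lambda>x. \<not> x \<le> 0) xs = xs" by (rule filter_True) (use xs(2) in auto)
    then show ?case by simp
  next
    case (Suc m)
    show ?case
    proof -
      have m: "Suc m < n" by (rule Suc.prems)
      let ?ys = "[1..<Suc m] @ filter (\<lambda>x. \<not> x \<le> m) xs"
      have d: "distinct ?ys" "set ?ys \<subseteq> {1..<n}"
      proof -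
        have "x \<in> {1..<n}" if "x \<in> set xs" for x using that xs(2) by blast
        moreover have "set [1..<Suc m] \<subseteq> {1..<n}" using m by auto
        ultimately show "set ?ys \<subseteq> {1..<n}" by (intro subsetI) (simp only: set_append set_filter, blast)
        have "set [1..<Suc m] \<inter> set (filter (\<lambda>x. \<not> x \<le> m) xs) = {}" by auto
        then show "distinct ?ys" using xs(1) by (simp only: distinct_append distinct_upt distinct_filter)
      qed
      have s: "Suc m \<in> set xs" using xs(2) m by auto
      have "filter (\<lambda>x. x \<le> Suc m) (filter (\<lambda>x. \<not> x \<le> m) xs) = filter (\<lambda>x. x = Suc m) xs"
        unfolding filter_filter by (rule filter_cong) auto
      then have "filter (\<lambda>x. x \<le> Suc m) (filter (\<lambda>x. \<not> x \<le> m) xs) = [Suc m]"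
        using filter_eq_singleton[OF xs(1) s] by (rule trans)
      moreover have "filter (\<lambda>x. x \<le> Suc m) [1..<Suc m] = [1..<Suc m]" by (rule filter_True) auto
      ultimately have f1: "filter (\<lambda>x. x \<le> Suc m) ?ys = [1..<Suc (Suc m)]"
        by (simp only: filter_append upt_Suc) simp
      have "filter (\<lambda>x. \<not> x \<le> Suc m) (filter (\<lambda>x. \<not> x \<le> m) xs) = filter (\<lambda>x. \<not> x \<le> Suc m) xs"
        unfolding filter_filter by (rule filter_cong) auto
      moreover have "filter (\<lambda>x. \<not> x \<le> Suc m) [1..<Suc m] = []" by (rule filter_False) auto
      ultimately have f2: "filter (\<lambda>x. \<not> x \<le> Suc m) ?ys = filter (\<lambda>x. \<not> x \<le> Suc m) xs"
        by (simp only: filter_append append_Nil)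
      have "ctrace n t (W (wpow xs p)) = ctrace n t (W (wpow ?ys p))" by (rule Suc.IH) (use m in simp)
      also have "\<dots> = ctrace n t (W (wpow ([1..<Suc (Suc m)] @ filter (\<lambda>x. \<not> x \<le> Suc m) xs) p))"
        unfolding ctrace_partition[OF d, of t p "Suc m"] f1 f2 by (rule refl)
      finally show ?thesis .
    qed
  qed
  note * = this
  have "filter (\<lambda>x. \<not> x \<le> n - 1) xs = []" by (rule filter_False) (use xs(2) in auto)
  moreover have "[1..<Suc (n - 1)] = [1..<n]" using n by simp
  ultimately show ?thesis using *[of "n - 1"] n by (simp only: append_Nil2)
qed (use xs in simp)

section \<open>Reduced words\<close>

text \<open>Reduced words, built by appending letters that increase the length.\<close>

inductive reduced :: "nat \<Rightarrow> nat list \<Rightarrow> (nat \<Rightarrow> nat) \<Rightarrow> bool" for n where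
  reduced_Nil: "reduced n [] id"
| reduced_snoc: "reduced n ws w \<Longrightarrow> i \<in> {1..<n} \<Longrightarrow> w i < w (Suc i) \<Longrightarrow> reduced n (ws @ [i]) (w \<circ> simple_refl i)"

lemma reduced_permutes: "reduced n ws w \<Longrightarrow> w permutes {1..n}"
proof (induction rule: reduced.induct)
  case reduced_Nil
  show ?case by (rule permutes_id)
next
  case (reduced_snoc ws w i)
  then show ?case by (intro permutes_compose simple_refl_permutes)
qed

lemma reduced_letters: "reduced n ws w \<Longrightarrow> set ws \<subseteq> {1..<n}"
  by (induction rule: reduced.induct) auto

lemma reduced_list_exists:
  assumes "w permutes {1..n}"
  shows "\<exists>ws. reduced n ws w"
  using assms
proof (induction "card (invset w)" arbitrary: w rule: less_induct)
  case less
  show ?case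
  proof (cases "w = id")
    case True
    then show ?thesis using reduced_Nil by blast
  next
    case False
    then obtain i where i: "i \<in> {1..<n}" "w (Suc i) < w i" using permutes_descent less.prems by blast
    let ?g = "w \<circ> simple_refl i"
    have c: "card (invset ?g) < card (invset w)" using invset_step_down[OF less.prems i] by simp
    have "?g permutes {1..n}" by (rule permutes_compose[OF simple_refl_permutes[OF i(1)] less.prems])
    from less.hyps[OF c this] obtain ws where "reduced n ws ?g" by blast
    then have "reduced n (ws @ [i]) (?g \<circ> simple_refl i)" by (rule reduced_snoc) (use i in simp_all)
    then show ?thesis unfolding comp_simple_refl_twice by blast
  qed
qed

text \<open>At an order reversing \<open>v\<close> no letter of a reduced word can be deleted.\<close>

lemma reduced_top:
  fixes v :: "nat \<Rightarrow> nat"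
  assumes "reduced n ws w" and v: "\<And>x y. x \<in> {1..n} \<Longrightarrow> y \<in> {1..n} \<Longrightarrow> x < y \<Longrightarrow> v y < v x"
  shows "hops (<) ws g v = g (v \<circ> w)"
  using assms(1)
proof (induction arbitrary: g rule: reduced.induct)
  case (reduced_snoc ws w i)
  have w: "w permutes {1..n}" by (rule reduced_permutes[OF reduced_snoc.hyps(1)])
  have "i \<in> {1..n}" "Suc i \<in> {1..n}" using reduced_snoc.hyps by auto
  then have "w i \<in> {1..n}" "w (Suc i) \<in> {1..n}" using permutes_in_image[OF w] by blast+
  from v[OF this reduced_snoc.hyps(3)] have "\<not> (v \<circ> w) i < (v \<circ> w) (Suc i)" by simp
  then show ?case unfolding hops_append reduced_snoc.IH hops_Cons hops_Nil hop_def
    by (simp only: if_False add_0_right comp_assoc)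
qed simp

text \<open>Since left operators commute with words, two words that agree at \<open>v\<close> agree at \<open>s\<^sub>j v\<close>.\<close>

lemma hops_left_step:
  assumes "\<And>g. hops (<) ws g v = hops (<) ws' g v" "bij v"
  shows "hops (<) ws g (simple_refl j \<circ> v) = hops (<) ws' g (simple_refl j \<circ> v)"
proof -
  have "lhop j (hops (<) ws g) v = lhop j (hops (<) ws' g) v"
    unfolding lhop_hops[OF assms(2)] by (rule assms(1))
  then show ?thesis unfolding lhop_def assms(1)[of g] by simp
qed

text \<open>Only the relative order of the values on \<open>{1..n}\<close> matters, so an arbitrary bijection can be replaced by
a permutation of \<open>{1..n}\<close>.\<close>

lemma hops_standardize:
  fixes v :: "nat \<Rightarrow> nat"
  assumes v: "bij v" and ws: "set ws \<subseteq> {1..<n}"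
  obtains v' where "v' permutes {1..n}"
    "\<And>ws g. set ws \<subseteq> {1..<n} \<Longrightarrow> hops (<) ws g v = hops (<) ws (\<lambda>u. g (v \<circ> inv_into UNIV v' \<circ> u)) v'"
proof -
  \<comment> \<open>The rank of \<open>v x\<close> among the values on \<open>{1..n}\<close>.\<close>
  define v' where "v' x = (if x \<in> {1..n} then card {y \<in> {1..n}. v y \<le> v x} else x)" for x
  have inj: "v x = v y \<longleftrightarrow> x = y" for x y using bij_is_inj[OF v] by (simp add: inj_eq)
  have mono: "v' x < v' y" if "x \<in> {1..n}" "y \<in> {1..n}" "v x < v y" for x y
  proof -
    have "{z \<in> {1..n}. v z \<le> v x} \<subset> {z \<in> {1..n}. v z \<le> v y}"
    proof (rule psubsetI)
      show "{z \<in> {1..n}. v z \<le> v x} \<subseteq> {z \<in> {1..n}. v z \<le> v y}"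
        using that(3) by (auto intro: le_trans)
      have "y \<in> {z \<in> {1..n}. v z \<le> v y}" "y \<notin> {z \<in> {1..n}. v z \<le> v x}" using that by auto
      then show "{z \<in> {1..n}. v z \<le> v x} \<noteq> {z \<in> {1..n}. v z \<le> v y}" by blast
    qed
    then have "card {z \<in> {1..n}. v z \<le> v x} < card {z \<in> {1..n}. v z \<le> v y}"
      by (intro psubset_card_mono) auto
    then show ?thesis using that by (simp add: v'_def)
  qed
  have iff: "v' x < v' y \<longleftrightarrow> v x < v y" if "x \<in> {1..n}" "y \<in> {1..n}" for x y
    using mono[OF that] mono[OF that(2,1)] inj[of x y] by (cases "v x" "v y" rule: linorder_cases) auto
  have perm: "v' permutes {1..n}"
  proof (rule bij_imp_permutes)
    have "inj_on v' {1..n}" by (rule inj_onI) (metis iff inj linorder_neqE_nat less_irrefl)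
    moreover have "v' ` {1..n} \<subseteq> {1..n}"
    proof (rule image_subsetI)
      fix x assume x: "x \<in> {1..n}"
      have "card {y \<in> {1..n}. v y \<le> v x} \<le> card {1..n}" by (intro card_mono) auto
      moreover have "card {y \<in> {1..n}. v y \<le> v x} > 0" using x by (auto simp: card_gt_0_iff)
      ultimately show "v' x \<in> {1..n}" using x by (auto simp: v'_def)
    qed
    ultimately show "bij_betw v' {1..n} {1..n}" by (simp add: bij_betw_def endo_inj_surj)
  qed (auto simp: v'_def)
  have "hops (<) ws g v = hops (<) ws (\<lambda>u. g (v \<circ> inv_into UNIV v' \<circ> u)) v'" if "set ws \<subseteq> {1..<n}" for ws g
  proof -
    have e: "v \<circ> inv_into UNIV v' \<circ> (v' \<circ> u) = v \<circ> u" for u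
      using permutes_inv_o(2)[OF perm] by (metis comp_assoc comp_id)
    have "hops (<) ws g (v \<circ> id) = hops (\<lambda>x y. v x < v y) ws (\<lambda>u. g (v \<circ> u)) id" by (rule hops_relabel)
    also have "\<dots> = hops (\<lambda>x y. v' x < v' y) ws (\<lambda>u. g (v \<circ> u)) id"
      by (rule hops_rel_cong[OF _ that permutes_id]) (simp add: iff)
    also have "\<dots> = hops (\<lambda>x y. v' x < v' y) ws (\<lambda>u. g (v \<circ> inv_into UNIV v' \<circ> (v' \<circ> u))) id"
      unfolding e by (rule refl)
    also have "\<dots> = hops (<) ws (\<lambda>u. g (v \<circ> inv_into UNIV v' \<circ> u)) (v' \<circ> id)"
      by (rule hops_relabel[symmetric])
    finally show ?thesis by simp
  qed
  with perm show thesis using that by blast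
qed

text \<open>This is the consequence of Matsumoto's theorem that the operator of a reduced word depends only on its
product. Instead of connecting reduced words by braid moves, one compares the operators at the order
reversing permutation, where they are evaluated by \<open>reduced_top\<close>, and reaches every other permutation by left
multiplication.\<close>

lemma reduced_unique:
  assumes r: "reduced n ws w" "reduced n ws' w"
  shows "W ws = W ws'"
proof (intro ext)
  fix g and v :: "nat \<Rightarrow> nat"
  have L: "set ws \<subseteq> {1..<n}" "set ws' \<subseteq> {1..<n}" using r reduced_letters by auto
  \<comment> \<open>The order reversing permutation.\<close>
  define d where "d x = (if x \<in> {1..n} then Suc n - x else x)" for x
  have d: "d permutes {1..n}"
  proof (rule bij_imp_permutes)
    show "bij_betw d {1..n} {1..n}"
      by (rule bij_betw_byWitness[where f'=d]) (auto simp: d_def)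
  qed (auto simp: d_def)
  have base: "hops (<) ws g d = hops (<) ws' g d" for g
    using reduced_top[OF r(1), of d g] reduced_top[OF r(2), of d g] by (simp add: d_def)
  have all: "set ss \<subseteq> simple_refls n \<Longrightarrow> hops (<) ws g (word_prod ss \<circ> d) = hops (<) ws' g (word_prod ss \<circ> d)" for ss g
  proof (induction ss arbitrary: g)
    case Nil
    then show ?case using base by simp
  next
    case (Cons s ss)
    then obtain j where j: "s = simple_refl j" by (auto simp: simple_refls_def)
    have b: "bij (word_prod ss \<circ> d)"
      using Cons.prems word_prod_permutes[of ss n] d permutes_bij bij_comp by (metis set_subset_Cons subset_trans)
    show ?case unfolding word_prod_simps comp_assoc j
      by (rule hops_left_step[OF Cons.IH b]) (use Cons.prems in simp)
  qed
  have S: "hops (<) ws g u = hops (<) ws' g u" if u: "u permutes {1..n}" for u g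
  proof -
    have "u \<circ> inv_into UNIV d permutes {1..n}" by (rule permutes_compose[OF permutes_inv[OF d] u])
    from reduced_word_exists[OF this] obtain ss where ss: "set ss \<subseteq> simple_refls n" "word_prod ss = u \<circ> inv_into UNIV d"
      by blast
    have "word_prod ss \<circ> d = u" unfolding ss(2) comp_assoc permutes_inv_o(2)[OF d] by simp
    with all[OF ss(1), of g] show ?thesis by simp
  qed
  show "W ws g v = W ws' g v"
  proof (cases "bij v")
    case True
    from hops_standardize[OF True L(1)] obtain v' where v': "v' permutes {1..n}"
      "\<And>ws g. set ws \<subseteq> {1..<n} \<Longrightarrow> hops (<) ws g v = hops (<) ws (\<lambda>u. g (v \<circ> inv_into UNIV v' \<circ> u)) v'"
      by blast
    show ?thesis unfolding W_def v'(2)[OF L(1)] v'(2)[OF L(2)] S[OF v'(1)] by (rule refl)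
  qed (simp add: W_def)
qed

lemma reduced_left:
  assumes "reduced n ws w" "i \<in> {1..<n}" "inv_into UNIV w i < inv_into UNIV w (Suc i)"
  shows "reduced n (i # ws) (simple_refl i \<circ> w)"
  using assms
proof (induction rule: reduced.induct)
  case reduced_Nil
  from reduced_snoc[OF reduced.reduced_Nil reduced_Nil(1)] show ?case by simp
next
  case (reduced_snoc ws w j)
  let ?i = "inv_into UNIV w"
  have w: "w permutes {1..n}" by (rule reduced_permutes[OF reduced_snoc.hyps(1)])
  have iv: "?i (w x) = x" "w (?i x) = x" for x using permutes_inverses[OF w] by auto
  have inv: "inv_into UNIV (w \<circ> simple_refl j) x = simple_refl j (?i x)" for x
    by (rule inv_comp_simple_refl[OF permutes_bij[OF w]])
  have lt: "simple_refl j (?i i) < simple_refl j (?i (Suc i))" using reduced_snoc.prems(2) unfolding inv .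
  have ne: "?i i \<noteq> ?i (Suc i)" by (metis iv(2) n_not_Suc_n)
  have nd: "{?i i, ?i (Suc i)} \<noteq> {j, Suc j}"
  proof
    assume "{?i i, ?i (Suc i)} = {j, Suc j}"
    then consider "?i i = j" "?i (Suc i) = Suc j" | "?i i = Suc j" "?i (Suc i) = j" by (auto simp: doubleton_eq_iff)
    then show False
    proof cases
      case 1
      then show False using lt by simp
    next
      case 2
      then have "w (Suc j) = i" "w j = Suc i" using iv(2) by metis+
      then show False using reduced_snoc.hyps(3) by simp
    qed
  qed
  then have "?i i < ?i (Suc i)" using lt simple_refl_less_iff[OF ne nd] by simp
  then have IH: "reduced n (i # ws) (simple_refl i \<circ> w)" using reduced_snoc.IH reduced_snoc.prems(1) by blast
  have "{w j, w (Suc j)} \<noteq> {i, Suc i}" using nd iv(1) by (metis doubleton_eq_iff)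
  then have "simple_refl i (w j) < simple_refl i (w (Suc j))"
    using simple_refl_less_iff[of "w j" "w (Suc j)" i] reduced_snoc.hyps(3) by auto
  then have "reduced n ((i # ws) @ [j]) ((simple_refl i \<circ> w) \<circ> simple_refl j)"
    by (intro reduced.reduced_snoc[OF IH reduced_snoc.hyps(2)]) simp
  then show ?case by (simp only: append_Cons comp_assoc)
qed

text \<open>A reduced word of \<open>w\<close>; by \<open>reduced_unique\<close> the choice does not affect the operator, so that \<open>W (rword n w)\<close> is the
standard basis element of the Hecke algebra.\<close>

definition rword :: "nat \<Rightarrow> (nat \<Rightarrow> nat) \<Rightarrow> nat list" where
  "rword n w = (SOME ws. reduced n ws w)"

lemma reduced_rw: "w permutes {1..n} \<Longrightarrow> reduced n (rword n w) w"
  unfolding rword_def using reduced_list_exists by (rule someI_ex)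

lemma rword_id: "W (rword n id) = W []"
  by (rule reduced_unique[OF reduced_rw[OF permutes_id] reduced_Nil])

lemma rword_right:
  assumes "w permutes {1..n}" "i \<in> {1..<n}" "w i < w (Suc i)"
  shows "W (rword n (w \<circ> simple_refl i)) = W (rword n w @ [i])"
  by (rule reduced_unique[OF reduced_rw[OF permutes_compose[OF simple_refl_permutes[OF assms(2)] assms(1)]]
    reduced_snoc[OF reduced_rw[OF assms(1)] assms(2,3)]])

lemma rword_left:
  assumes "w permutes {1..n}" "i \<in> {1..<n}" "inv_into UNIV w i < inv_into UNIV w (Suc i)"
  shows "W (rword n (simple_refl i \<circ> w)) = W (i # rword n w)"
  by (rule reduced_unique[OF reduced_rw[OF permutes_compose[OF assms(1) simple_refl_permutes[OF assms(2)]]]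
    reduced_left[OF reduced_rw[OF assms(1)] assms(2,3)]])

section \<open>Powers of the standard Coxeter word\<close>

lemma wprod_permutes: "set ws \<subseteq> {1..<n} \<Longrightarrow> wprod ws permutes {1..n}"
proof (induction ws)
  case (Cons i ws)
  then have i: "i \<in> {1..<n}" by simp
  have "wprod ws permutes {1..n}" using Cons by simp
  with simple_refl_permutes[OF i] show ?case unfolding wprod_Cons by (intro permutes_compose)
qed (simp add: permutes_id)

lemma wprod_upt_end: "a \<le> b \<Longrightarrow> wprod [a..<b] b = a"
proof (induction b)
  case (Suc b)
  show ?case
  proof (cases "a = Suc b")
    case False
    then have "wprod [a..<Suc b] (Suc b) = wprod [a..<b] b" using Suc.prems by (simp add: wprod_append wprod_Cons)
    then show ?thesis using Suc False by simp
  qed simp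
qed simp

text \<open>In multiplying by the cycle \<open>s\<^sub>a \<dots> s\<^bsub>b-1\<^esub>\<close>, the value \<open>w a\<close> passes larger values only, so the length increases in
each step.\<close>

lemma rword_move_right:
  assumes w: "w permutes {1..n}" and a: "1 \<le> a" "a \<le> b" "b \<le> n"
    and less: "\<And>x. a < x \<Longrightarrow> x \<le> b \<Longrightarrow> w a < w x"
  shows "W (rword n w @ [a..<b]) = W (rword n (w \<circ> wprod [a..<b]))"
  using a(2,3) less
proof (induction b)
  case (Suc b)
  show ?case
  proof (cases "a = Suc b")
    case False
    then have ab: "a \<le> b" using Suc.prems by simp
    let ?u = "w \<circ> wprod [a..<b]"
    have u: "?u permutes {1..n}"
      by (rule permutes_compose[OF wprod_permutes w]) (use a Suc.prems in auto)
    have IH: "W (rword n w @ [a..<b]) = W (rword n ?u)" by (rule Suc.IH) (use Suc.prems ab in auto)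
    have "wprod [a..<b] b = a" by (rule wprod_upt_end[OF ab])
    moreover have "wprod [a..<b] (Suc b) = Suc b" by (rule wprod_upt(3)) simp
    ultimately have "?u b < ?u (Suc b)" using Suc.prems(3)[of "Suc b"] ab by simp
    then have "W (rword n (?u \<circ> simple_refl b)) = W (rword n ?u @ [b])"
      by (intro rword_right[OF u]) (use a Suc.prems ab in auto)
    also have "\<dots> = W (rword n w @ [a..<Suc b])"
      using W_cong[OF IH, of "[]" "[b]"] ab by simp
    also have "?u \<circ> simple_refl b = w \<circ> wprod [a..<Suc b]"
      using ab by (simp add: wprod_append wprod_Cons comp_assoc)
    finally show ?thesis by simp
  qed simp
qed (use a in simp)

lemma inv_comp_apply:
  assumes "f permutes {1..n}" "g permutes {1..n}"
  shows "inv_into UNIV (f \<circ> g) x = inv_into UNIV g (inv_into UNIV f x)"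
  using o_inv_distrib[OF permutes_bij[OF assms(1)] permutes_bij[OF assms(2)]] by simp

lemma inv_eqI: "f permutes {1..n} \<Longrightarrow> f x = y \<Longrightarrow> inv_into UNIV f y = x"
  using permutes_inverses(2) by metis

lemma rword_move_left:
  assumes x: "x permutes {1..n}" and a: "1 \<le> a" "a \<le> b" "b \<le> n"
    and less: "\<And>y. a \<le> y \<Longrightarrow> y < b \<Longrightarrow> inv_into UNIV x y < inv_into UNIV x b"
  shows "W ([a..<b] @ rword n x) = W (rword n (wprod [a..<b] \<circ> x))"
  using a less
proof (induction "b - a" arbitrary: a)
  case (Suc k)
  then have ab: "a < b" by simp
  let ?p = "wprod [Suc a..<b]"
  have p: "?p permutes {1..n}" by (rule wprod_permutes) (use Suc.prems in auto)
  have px: "?p \<circ> x permutes {1..n}" by (rule permutes_compose[OF x p])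
  have IH: "W ([Suc a..<b] @ rword n x) = W (rword n (?p \<circ> x))"
    by (rule Suc.hyps(1)) (use Suc in auto)
  have "inv_into UNIV ?p a = a" by (rule inv_eqI[OF p], rule wprod_upt(2)) simp
  moreover have "inv_into UNIV ?p (Suc a) = b"
  proof -
    obtain z where z: "?p z = Suc a" using permutes_surj[OF p] by (metis surj_def)
    have "z = b"
    proof (rule ccontr)
      assume "z \<noteq> b"
      then consider "z < Suc a" | "Suc a \<le> z" "z < b" | "b < z" by linarith
      then show False using z wprod_upt[where a="Suc a" and b=b and x=z] ab by cases auto
    qed
    then show ?thesis using inv_eqI[OF p z] by simp
  qed
  ultimately have "inv_into UNIV (?p \<circ> x) a < inv_into UNIV (?p \<circ> x) (Suc a)"
    unfolding inv_comp_apply[OF p x] using Suc.prems(4)[of a] ab by simp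
  then have "W (rword n (simple_refl a \<circ> (?p \<circ> x))) = W (a # rword n (?p \<circ> x))"
    by (intro rword_left[OF px]) (use Suc.prems ab in auto)
  also have "\<dots> = W ([a..<b] @ rword n x)"
    using W_cong[OF IH, of "[a]" "[]"] ab by (simp add: upt_conv_Cons)
  also have "simple_refl a \<circ> (?p \<circ> x) = wprod [a..<b] \<circ> x"
    using ab by (simp add: upt_conv_Cons wprod_Cons comp_assoc)
  finally show ?case by (rule sym)
qed simp

lemma rword_move_left_rev:
  assumes w: "w permutes {1..n}" and r: "Suc r \<le> n"
    and less: "\<And>y. 1 < y \<Longrightarrow> y \<le> Suc r \<Longrightarrow> inv_into UNIV w 1 < inv_into UNIV w y"
  shows "W (rev [1..<Suc r] @ rword n w) = W (rword n (wprod (rev [1..<Suc r]) \<circ> w)) \<and>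
    (\<forall>x. wprod (rev [1..<Suc r]) (wprod [1..<Suc r] x) = x)"
  using r less
proof (induction r)
  case (Suc r)
  let ?p = "wprod (rev [1..<Suc r])" and ?q = "wprod [1..<Suc r]"
  have p: "?p permutes {1..n}" by (rule wprod_permutes) (use Suc.prems in auto)
  have q: "?q permutes {1..n}" by (rule wprod_permutes) (use Suc.prems in auto)
  have pw: "?p \<circ> w permutes {1..n}" by (rule permutes_compose[OF w p])
  have IH0: "W (rev [1..<Suc r] @ rword n w) = W (rword n (?p \<circ> w)) \<and> (\<forall>x. ?p (?q x) = x)"
    by (rule Suc.IH) (use Suc.prems in simp_all)
  have IH: "W (rev [1..<Suc r] @ rword n w) = W (rword n (?p \<circ> w))" "\<And>x. ?p (?q x) = x"
    using conjunct1[OF IH0] spec[OF conjunct2[OF IH0]] by this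
  have q1: "?q (Suc r) = 1" by (rule wprod_upt_end) simp
  have "inv_into UNIV ?p (Suc r) = 1"
    by (rule inv_eqI[OF p], rule IH(2)[of "Suc r", unfolded q1])
  moreover have "inv_into UNIV ?p (Suc (Suc r)) = Suc (Suc r)"
  proof (rule inv_eqI[OF p])
    have "?q (Suc (Suc r)) = Suc (Suc r)" by (rule wprod_upt(3)) simp
    then show "?p (Suc (Suc r)) = Suc (Suc r)" using IH(2)[of "Suc (Suc r)"] by simp
  qed
  ultimately have "inv_into UNIV (?p \<circ> w) (Suc r) < inv_into UNIV (?p \<circ> w) (Suc (Suc r))"
    unfolding inv_comp_apply[OF p w] using Suc.prems(2)[of "Suc (Suc r)"] by simp
  then have "W (rword n (simple_refl (Suc r) \<circ> (?p \<circ> w))) = W (Suc r # rword n (?p \<circ> w))"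
    by (intro rword_left[OF pw]) (use Suc.prems in auto)
  also have "\<dots> = W (rev [1..<Suc (Suc r)] @ rword n w)"
    using W_cong[OF IH(1), of "[Suc r]" "[]"] by simp
  also have "simple_refl (Suc r) \<circ> (?p \<circ> w) = wprod (rev [1..<Suc (Suc r)]) \<circ> w"
    by (simp add: wprod_Cons comp_assoc)
  finally have 1: "W (rev [1..<Suc (Suc r)] @ rword n w) = W (rword n (wprod (rev [1..<Suc (Suc r)]) \<circ> w))" by (rule sym)
  have "wprod (rev [1..<Suc (Suc r)]) (wprod [1..<Suc (Suc r)] x) = x" for x
  proof -
    have "wprod [1..<Suc (Suc r)] x = ?q (simple_refl (Suc r) x)" by (simp add: wprod_append wprod_Cons)
    moreover have "wprod (rev [1..<Suc (Suc r)]) y = simple_refl (Suc r) (?p y)" for y by (simp add: wprod_Cons)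
    ultimately show ?thesis using IH(2) by simp
  qed
  with 1 show ?case by blast
qed simp

text \<open>The power \<open>x \<mapsto> x + r\<close> of the long cycle, with values modulo \<open>n\<close> in \<open>{1..n}\<close>.\<close>

definition rot :: "nat \<Rightarrow> nat \<Rightarrow> nat \<Rightarrow> nat" where
  "rot n r x = (if x \<in> {1..n} then if x + r \<le> n then x + r else x + r - n else x)"

lemma rot_permutes: "r \<le> n \<Longrightarrow> rot n r permutes {1..n}"
  by (rule bij_imp_permutes, rule bij_betw_byWitness[where f'="\<lambda>x. if r < x then x - r else x + n - r"])
    (auto simp: rot_def)

lemma jw_Suc_eq: "jw (Suc r) = rev [1..<Suc r] @ [1..<Suc r]"
  by (induction r) simp_all

text \<open>With \<open>q = s\<^sub>1 \<dots> s\<^sub>r\<close> one has the factorizations \<open>rot n r = q\<^sup>-\<^sup>1 w\<close> and \<open>w c = q (rot n (r + 1))\<close>, where \<open>c\<close> is the long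
cycle and \<open>w\<close> fixes \<open>1\<close>; these three products are length additive. The leftover \<open>q\<^sup>-\<^sup>1 q\<close>, read as a word, is that of
\<open>J\<^bsub>r+1\<^esub>\<close>.\<close>

lemma rot_step:
  assumes r: "r < n"
  shows "W (rword n (rot n r) @ [1..<n]) = W (jw (Suc r) @ rword n (rot n (Suc r)))"
proof -
  let ?x = "rot n (Suc r)" and ?y = "rot n r" and ?q = "wprod [1..<Suc r]"
  let ?w = "?q \<circ> ?y"
  have x: "?x permutes {1..n}" and y: "?y permutes {1..n}" using rot_permutes r by auto
  have q: "?q permutes {1..n}" by (rule wprod_permutes) (use r in auto)
  have w: "?w permutes {1..n}" by (rule permutes_compose[OF y q])
  have q1: "?q (Suc r) = 1" by (rule wprod_upt_end) simp
  have qs: "?q z = Suc z" if "1 \<le> z" "z \<le> r" for z by (rule wprod_upt(1)) (use that in auto)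
  have qf: "?q z = z" if "Suc r < z" for z by (rule wprod_upt(3)) (use that in auto)
  have w1: "?w 1 = 1" using r q1 by (simp add: rot_def)
  have A: "W ([1..<Suc r] @ rword n ?x) = W (rword n (?q \<circ> ?x))"
  proof (rule rword_move_left[OF x])
    fix z assume z: "1 \<le> z" "z < Suc r"
    have "inv_into UNIV ?x z = z + n - Suc r" by (rule inv_eqI[OF x]) (use z r in \<open>auto simp: rot_def\<close>)
    moreover have "inv_into UNIV ?x (Suc r) = n" by (rule inv_eqI[OF x]) (use r in \<open>auto simp: rot_def\<close>)
    ultimately show "inv_into UNIV ?x z < inv_into UNIV ?x (Suc r)" using z r by simp
  qed (use r in auto)
  have iw: "inv_into UNIV ?w 1 = 1" by (rule inv_eqI[OF w w1])
  have B: "W (rev [1..<Suc r] @ rword n ?w) = W (rword n (wprod (rev [1..<Suc r]) \<circ> ?w)) \<and>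
    (\<forall>x. wprod (rev [1..<Suc r]) (wprod [1..<Suc r] x) = x)"
  proof (rule rword_move_left_rev[OF w])
    fix z assume z: "1 < z" "z \<le> Suc r"
    have "inv_into UNIV ?w z \<in> {1..n}" using permutes_in_image[OF permutes_inv[OF w], of z] z r by simp
    moreover have "inv_into UNIV ?w z \<noteq> 1"
    proof
      assume e: "inv_into UNIV ?w z = 1"
      have "?w (inv_into UNIV ?w z) = z" by (rule permutes_inverses(1)[OF w])
      then show False unfolding e w1 using z by simp
    qed
    ultimately show "inv_into UNIV ?w 1 < inv_into UNIV ?w z" unfolding iw by simp
  qed (use r in simp)
  have "wprod (rev [1..<Suc r]) \<circ> ?w = ?y" using B by (auto simp: fun_eq_iff)
  then have B': "W (rword n ?y) = W (rev [1..<Suc r] @ rword n ?w)" using B by simp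
  have C: "W (rword n ?w @ [1..<n]) = W (rword n (?w \<circ> wprod [1..<n]))"
  proof (rule rword_move_right[OF w])
    fix z assume z: "1 < z" "z \<le> n"
    have "?w z \<in> {1..n}" using permutes_in_image[OF w, of z] z by simp
    moreover have "?w z \<noteq> 1" using z w1 permutes_inj[OF w, THEN injD, of z 1] by auto
    ultimately show "?w 1 < ?w z" unfolding w1 by simp
  qed (use r in auto)
  have D: "?w \<circ> wprod [1..<n] = ?q \<circ> ?x"
  proof
    fix z
    show "(?w \<circ> wprod [1..<n]) z = (?q \<circ> ?x) z"
    proof (cases "z \<in> {1..n}")
      case True
      show ?thesis
      proof (cases "z = n")
        case True
        then show ?thesis using r w1 q1 wprod_upt_end[of 1 n] by (simp add: rot_def)
      next
        case False
        then have c: "wprod [1..<n] z = Suc z" using True by (intro wprod_upt(1)) auto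
        show ?thesis
        proof (cases "z + Suc r \<le> n")
          case True
          have "rot n r (Suc z) = z + Suc r" "rot n (Suc r) z = z + Suc r"
            using True \<open>z \<in> {1..n}\<close> by (auto simp: rot_def)
          then show ?thesis using c by (simp only: comp_apply)
        next
          case False
          have "rot n r (Suc z) = z + Suc r - n" "rot n (Suc r) z = z + Suc r - n"
            using False True \<open>z \<noteq> n\<close> by (auto simp: rot_def)
          then show ?thesis using c by (simp only: comp_apply)
        qed
      qed
    next
      case False
      have "wprod [1..<n] permutes {1..n}" by (rule wprod_permutes) auto
      then have "wprod [1..<n] z = z" using False permutes_not_in by metis
      moreover have "?y z = z" "?x z = z" using False by (auto simp: rot_def)
      ultimately show ?thesis by simp
    qed
  qed
  have "W (rword n ?y @ [1..<n]) = W (rev [1..<Suc r] @ (rword n ?w @ [1..<n]) @ [])"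
    using W_cong[OF B', of "[]" "[1..<n]"] by simp
  also have "\<dots> = W (rev [1..<Suc r] @ rword n (?q \<circ> ?x) @ [])" by (rule W_cong) (simp only: C D)
  also have "\<dots> = W (rev [1..<Suc r] @ ([1..<Suc r] @ rword n ?x) @ [])" by (rule W_cong[OF A[symmetric]])
  finally show ?thesis by (simp only: jw_Suc_eq append_assoc append_Nil2)
qed

lemma jp_jp_commute: "W (jp a m @ jp b l) = W (jp b l @ jp a m)"
proof -
  have "W (concat (replicate k (jw m)) @ jp b l) = W (jp b l @ concat (replicate k (jw m)))" for k
  proof (induction k)
    case (Suc k)
    have "W (concat (replicate (Suc k) (jw m)) @ jp b l) = W (jw m @ (concat (replicate k (jw m)) @ jp b l) @ [])" by simp
    also have "\<dots> = W ([] @ (jw m @ jp b l) @ concat (replicate k (jw m)))" by (subst W_cong[OF Suc]) simp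
    also have "\<dots> = W ([] @ (jp b l @ jw m) @ concat (replicate k (jw m)))" by (rule W_cong[OF jp_commute])
    finally show ?case by simp
  qed simp
  then show ?thesis by (simp add: jp_def)
qed

lemma jp_jpow_commute: "W (jp a m @ jpow n b) = W (jpow n b @ jp a m)"
proof (induction n)
  case (Suc n)
  have "W (jp a m @ jpow (Suc n) b) = W ([] @ (jp a m @ jpow n b) @ jp b (Suc n))" by (simp add: jpow_Suc)
  also have "\<dots> = W (jpow n b @ (jp a m @ jp b (Suc n)) @ [])" by (subst W_cong[OF Suc]) simp
  also have "\<dots> = W (jpow n b @ (jp b (Suc n) @ jp a m) @ [])" by (rule W_cong[OF jp_jp_commute])
  finally show ?case by (simp add: jpow_Suc)
qed simp

lemma jpow_add: "W (jpow n a @ jpow n b) = W (jpow n (\<lambda>l. a l + b l))"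
proof (induction n)
  case (Suc n)
  have "W (jpow (Suc n) a @ jpow (Suc n) b) = W (jpow n a @ (jp a (Suc n) @ jpow n b) @ jp b (Suc n))"
    by (simp add: jpow_Suc)
  also have "\<dots> = W ([] @ (jpow n a @ jpow n b) @ (jp a (Suc n) @ jp b (Suc n)))"
    by (subst W_cong[OF jp_jpow_commute]) simp
  also have "\<dots> = W ([] @ jpow n (\<lambda>l. a l + b l) @ (jp a (Suc n) @ jp b (Suc n)))" by (rule W_cong[OF Suc])
  also have "jp a (Suc n) @ jp b (Suc n) = jp (\<lambda>l. a l + b l) (Suc n)" by (simp add: jp_def replicate_add)
  finally show ?case by (simp add: jpow_Suc)
qed simp

lemma jpow_trivial: "(\<And>l. l \<in> {1..n} \<Longrightarrow> a l = 0) \<Longrightarrow> jpow n a = []"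
  by (induction n) (simp_all add: jpow_Suc jp_def)

text \<open>Iterating \<open>rot_step\<close>, the first \<open>r\<close> Jucys--Murphy elements are split off.\<close>

lemma W_power_le:
  assumes "r \<le> n"
  shows "W (wpow [1..<n] r) = W (jpow n (\<lambda>l. of_bool (l \<le> r)) @ rword n (rot n r))"
  using assms
proof (induction r)
  case 0
  have 1: "rot n 0 = id" by (auto simp: rot_def)
  have 2: "jpow n (\<lambda>l. of_bool (l \<le> 0)) = []" by (rule jpow_trivial) simp
  show ?case unfolding 1 2 append_Nil rword_id wpow_0 by (rule refl)
next
  case (Suc r)
  let ?a = "\<lambda>l. of_bool (l \<le> r) :: nat"
  have IH: "W (wpow [1..<n] r) = W (jpow n ?a @ rword n (rot n r))" using Suc by simp
  have "W (wpow [1..<n] (Suc r)) = W ([] @ wpow [1..<n] r @ [1..<n])" by (simp only: wpow_Suc' append_Nil)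
  also have "\<dots> = W (jpow n ?a @ (rword n (rot n r) @ [1..<n]) @ [])" by (subst W_cong[OF IH]) simp
  also have "\<dots> = W (jpow n ?a @ (jw (Suc r) @ rword n (rot n (Suc r))) @ [])"
    by (rule W_cong[OF rot_step]) (use Suc in simp)
  also have "\<dots> = W ([] @ (jpow n ?a @ jw (Suc r)) @ rword n (rot n (Suc r)))" by simp
  also have "\<dots> = W ([] @ jpow n (?a(Suc r := Suc (?a (Suc r)))) @ rword n (rot n (Suc r)))"
    by (rule W_cong, rule jpow_upd[symmetric]) (use Suc in auto)
  also have "?a(Suc r := Suc (?a (Suc r))) = (\<lambda>l. of_bool (l \<le> Suc r))" by auto
  finally show ?case by simp
qed

lemma wpow_add: "wpow xs (p + q) = wpow xs p @ wpow xs q"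
  by (induction p) (simp_all add: wpow_Suc)

text \<open>The \<open>n\<close>-th power of the long cycle word is the product of all Jucys--Murphy elements, the full twist.\<close>

lemma W_power:
  assumes r: "r \<le> n"
  shows "W (wpow [1..<n] (q * n + r)) = W (jpow n (\<lambda>l. q + of_bool (l \<le> r)) @ rword n (rot n r))"
proof (induction q)
  case 0
  then show ?case using W_power_le[OF r] by simp
next
  case (Suc q)
  let ?a = "\<lambda>l. q + of_bool (l \<le> r) :: nat"
  have "rot n n = id" by (auto simp: rot_def)
  then have "W (wpow [1..<n] n) = W (jpow n (\<lambda>l. of_bool (l \<le> n)) @ rword n id)" using W_power_le[of n n] by simp
  also have "\<dots> = W (jpow n (\<lambda>l. of_bool (l \<le> n)) @ [] @ [])"
    using W_cong[OF rword_id[of n], where xs="jpow n (\<lambda>l. of_bool (l \<le> n))" and zs="[]"] by simp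
  also have "jpow n (\<lambda>l. of_bool (l \<le> n)) = jpow n (\<lambda>l. 1)" by (rule jpow_cong) simp
  finally have full: "W (wpow [1..<n] n) = W (jpow n (\<lambda>l. 1))" by simp
  have "wpow [1..<n] (Suc q * n + r) = wpow [1..<n] n @ wpow [1..<n] (q * n + r)"
    by (simp only: mult_Suc add.assoc wpow_add)
  then have "W (wpow [1..<n] (Suc q * n + r)) = W (jpow n (\<lambda>l. 1)) \<circ> W (jpow n ?a @ rword n (rot n r))"
    by (simp only: W_append full Suc)
  also have "\<dots> = W (jpow n (\<lambda>l. 1) @ jpow n ?a) \<circ> W (rword n (rot n r))"
    by (simp only: W_append comp_assoc)
  also have "\<dots> = W (jpow n (\<lambda>l. 1 + ?a l) @ rword n (rot n r))"
    by (subst jpow_add) (simp only: W_append)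
  finally show ?case by simp
qed

section \<open>Sorting by conjugation\<close>

lemma comm_append: "W ([i] @ xs) = W (xs @ [i]) \<Longrightarrow> W ([i] @ ys) = W (ys @ [i]) \<Longrightarrow> W ([i] @ xs @ ys) = W ((xs @ ys) @ [i])"
proof -
  assume x: "W ([i] @ xs) = W (xs @ [i])" and y: "W ([i] @ ys) = W (ys @ [i])"
  have "W ([i] @ xs @ ys) = W ([] @ ([i] @ xs) @ ys)" by simp
  also have "\<dots> = W (xs @ ([i] @ ys) @ [])" by (subst W_cong[OF x]) simp
  also have "\<dots> = W (xs @ (ys @ [i]) @ [])" by (rule W_cong[OF y])
  finally show ?thesis by simp
qed

lemma comm_replicate: "W ([i] @ xs) = W (xs @ [i]) \<Longrightarrow> W ([i] @ concat (replicate k xs)) = W (concat (replicate k xs) @ [i])"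
proof (induction k)
  case (Suc k)
  then show ?case using comm_append[of i xs "concat (replicate k xs)"] by simp
qed simp

lemma comm_jpow_away:
  assumes i: "1 \<le> i" and a: "a i = 0" "a (Suc i) = 0"
  shows "W ([i] @ jpow n a) = W (jpow n a @ [i])"
proof (induction n)
  case (Suc n)
  have "W ([i] @ jp a (Suc n)) = W (jp a (Suc n) @ [i])"
  proof (cases "Suc n = i \<or> Suc n = Suc i")
    case True
    then have "jp a (Suc n) = []" using a by (auto simp: jp_def)
    then show ?thesis by simp
  next
    case False
    then have "W ([i] @ jw (Suc n)) = W (jw (Suc n) @ [i])"
      using jw_commute_above[of "Suc n" i] jw_commute_below[of i "Suc n"] i by (cases "Suc n < i") auto
    then show ?thesis unfolding jp_def by (rule comm_replicate)
  qed
  with Suc show ?case unfolding jpow_Suc by (rule comm_append)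
qed simp

lemma jw_Suc_pos: "1 \<le> i \<Longrightarrow> jw (Suc i) = [i] @ jw i @ [i]"
  by (cases i) auto

text \<open>The generator \<open>s\<^sub>i\<close> commutes with the product of \<open>J\<^sub>i\<close> and \<open>J\<^bsub>i+1\<^esub> = s\<^sub>i J\<^sub>i s\<^sub>i\<close>, because these two commute, and
with all other Jucys--Murphy elements.\<close>

lemma comm_jpow_eq:
  assumes i: "1 \<le> i" "i < n" and a: "a i = a (Suc i)"
  shows "W ([i] @ jpow n a) = W (jpow n a @ [i])"
  using a
proof (induction "a i" arbitrary: a)
  case 0
  then show ?case using comm_jpow_away[OF i(1)] by simp
next
  case (Suc k)
  define b where "b = a(i := k, Suc i := k)"
  let ?b' = "b(i := Suc (b i))"
  have b: "b i = k" "b (Suc i) = k" by (simp_all add: b_def)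
  have a: "a = ?b'(Suc i := Suc (?b' (Suc i)))" using Suc by (auto simp: b_def)
  have JJ: "W (jw i @ jw (Suc i)) = W (jw (Suc i) @ jw i)" by (rule jw_commute)
  have "W (jpow n a) = W (jpow n ?b' @ jw (Suc i))" unfolding a[symmetric] by (subst (1) a, rule jpow_upd) (use i in auto)
  also have "\<dots> = W ([] @ (jpow n b @ jw i) @ jw (Suc i))"
    using W_cong[OF jpow_upd[of i n b], of "[]" "jw (Suc i)"] i by simp
  finally have J: "W (jpow n a) = W (jpow n b @ (jw i @ jw (Suc i)))" by simp
  have c: "W ([i] @ (jw i @ jw (Suc i))) = W ((jw i @ jw (Suc i)) @ [i])"
  proof -
    have "W ([i] @ (jw i @ jw (Suc i))) = W (([i] @ jw i @ [i]) @ jw i @ [i])"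
      using i by (simp add: jw_Suc_pos)
    also have "\<dots> = W ([] @ (jw (Suc i) @ jw i) @ [i])" using i by (simp add: jw_Suc_pos)
    also have "\<dots> = W ([] @ (jw i @ jw (Suc i)) @ [i])" by (rule W_cong[OF JJ[symmetric]])
    finally show ?thesis by simp
  qed
  have "W ([i] @ jpow n b) = W (jpow n b @ [i])" by (rule Suc.hyps(1)) (use b in auto)
  from comm_append[OF this c] have "W ([i] @ jpow n b @ (jw i @ jw (Suc i))) = W ((jpow n b @ (jw i @ jw (Suc i))) @ [i])" .
  then show ?case using W_cong[OF J, of "[i]" "[]"] W_cong[OF J, of "[]" "[i]"] by simp
qed

text \<open>Conjugation by \<open>s\<^sub>i\<close>: the letter \<open>s\<^sub>i\<close> is split off at the right end of \<open>w\<close>, rotated to the front, passed through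
the monomial, and absorbed at the left end of \<open>w s\<^sub>i\<close>.\<close>

lemma ctrace_swap_equal:
  assumes w: "w permutes {1..n}" and i: "i \<in> {1..<n}" and a: "a i = a (Suc i)"
    and d: "w (Suc i) < w i" and u: "inv_into UNIV w i < inv_into UNIV w (Suc i)"
  shows "ctrace n t (W (jpow n a @ rword n w)) = ctrace n t (W (jpow n a @ rword n (simple_refl i \<circ> w \<circ> simple_refl i)))"
proof -
  let ?w1 = "w \<circ> simple_refl i"
  have w1: "?w1 permutes {1..n}" by (rule permutes_compose[OF simple_refl_permutes[OF i] w])
  have iv: "w (inv_into UNIV w x) = x" "inv_into UNIV w (w x) = x" for x using permutes_inverses[OF w] by auto
  have 1: "W (rword n w) = W (rword n ?w1 @ [i])"
    using rword_right[OF w1 i] d by simp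
  have inv: "inv_into UNIV ?w1 x = simple_refl i (inv_into UNIV w x)" for x
    by (rule inv_comp_simple_refl[OF permutes_bij[OF w]])
  have "simple_refl i (inv_into UNIV w i) < simple_refl i (inv_into UNIV w (Suc i))"
  proof (subst simple_refl_less_iff)
    show "{inv_into UNIV w i, inv_into UNIV w (Suc i)} \<noteq> {i, Suc i}"
    proof
      assume "{inv_into UNIV w i, inv_into UNIV w (Suc i)} = {i, Suc i}"
      then have "inv_into UNIV w i = i" "inv_into UNIV w (Suc i) = Suc i" using u by (auto simp: doubleton_eq_iff)
      then show False using d iv(1) by (metis not_less_iff_gr_or_eq lessI)
    qed
  qed (use u in auto)
  then have 2: "W (rword n (simple_refl i \<circ> ?w1)) = W (i # rword n ?w1)"
    by (intro rword_left[OF w1 i]) (simp only: inv)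
  have "i \<ge> 1" "i < n" using i by auto
  have "ctrace n t (W (jpow n a @ rword n w)) = ctrace n t (W ((jpow n a @ rword n ?w1) @ [i]))"
    using W_cong[OF 1, of "jpow n a" "[]"] by simp
  also have "\<dots> = ctrace n t (W ([i] @ jpow n a @ rword n ?w1))"
    by (rule ctrace_comm[symmetric]) (use i in simp)
  also have "W ([i] @ jpow n a @ rword n ?w1) = W (jpow n a @ [i] @ rword n ?w1)"
    using W_cong[OF comm_jpow_eq[of i n a], of "[]" "rword n ?w1"] i a by simp
  also have "\<dots> = W (jpow n a @ rword n (simple_refl i \<circ> ?w1))"
    using W_cong[OF 2, of "jpow n a" "[]"] by simp
  finally show ?thesis by (simp only: comp_assoc)
qed

text \<open>As before, but on its way \<open>s\<^sub>i\<close> meets one surplus factor \<open>J\<^sub>i\<close>. Together with a second letter \<open>s\<^sub>i\<close>, split off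
at the left end of \<open>w s\<^sub>i\<close>, it forms \<open>s\<^sub>i J\<^sub>i s\<^sub>i = J\<^bsub>i+1\<^esub>\<close>, so the two exponents are exchanged.\<close>

lemma ctrace_swap_unequal:
  assumes w: "w permutes {1..n}" and i: "i \<in> {1..<n}" and a: "a i = Suc (a (Suc i))"
    and d: "w (Suc i) < w i" and u: "inv_into UNIV w (Suc i) < inv_into UNIV w i" and ne: "w i \<noteq> Suc i"
  shows "ctrace n t (W (jpow n a @ rword n w)) =
    ctrace n t (W (jpow n (a \<circ> simple_refl i) @ rword n (simple_refl i \<circ> w \<circ> simple_refl i)))"
proof -
  let ?w1 = "w \<circ> simple_refl i"
  let ?w2 = "simple_refl i \<circ> ?w1"
  have w1: "?w1 permutes {1..n}" by (rule permutes_compose[OF simple_refl_permutes[OF i] w])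
  have w2: "?w2 permutes {1..n}" by (rule permutes_compose[OF w1 simple_refl_permutes[OF i]])
  have iv: "w (inv_into UNIV w x) = x" "inv_into UNIV w (w x) = x" for x using permutes_inverses[OF w] by auto
  have 1: "W (rword n w) = W (rword n ?w1 @ [i])"
    using rword_right[OF w1 i] d by simp
  have inv1: "inv_into UNIV ?w1 x = simple_refl i (inv_into UNIV w x)" for x
    by (rule inv_comp_simple_refl[OF permutes_bij[OF w]])
  have inv2: "inv_into UNIV ?w2 x = inv_into UNIV ?w1 (simple_refl i x)" for x
    by (rule inv_simple_refl_comp[OF permutes_bij[OF w1]])
  have "simple_refl i (inv_into UNIV w (Suc i)) < simple_refl i (inv_into UNIV w i)"
  proof (subst simple_refl_less_iff)
    show "{inv_into UNIV w (Suc i), inv_into UNIV w i} \<noteq> {i, Suc i}"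
    proof
      assume "{inv_into UNIV w (Suc i), inv_into UNIV w i} = {i, Suc i}"
      then have "inv_into UNIV w (Suc i) = i" using u by (auto simp: doubleton_eq_iff)
      then show False using ne iv(1) by metis
    qed
  qed (use u in auto)
  then have 2: "W (rword n ?w1) = W (i # rword n ?w2)"
    using rword_left[OF w2 i] unfolding inv1 inv2 by (simp add: comp_assoc[symmetric])
  have i1: "1 \<le> i" "i < n" using i by auto
  define b where "b = a(i := a (Suc i))"
  have ab: "a = b(i := Suc (b i))" using a by (auto simp: b_def)
  have as: "a \<circ> simple_refl i = b(Suc i := Suc (b (Suc i)))"
  proof
    fix x show "(a \<circ> simple_refl i) x = (b(Suc i := Suc (b (Suc i)))) x"
      using a by (cases "x = i"; cases "x = Suc i") (auto simp: b_def)
  qed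
  have bc: "W ([i] @ jpow n b) = W (jpow n b @ [i])" by (rule comm_jpow_eq[OF i1]) (simp add: b_def)
  have Ja: "W (jpow n a) = W (jpow n b @ jw i)" by (subst ab, rule jpow_upd) (use i1 in auto)
  have Js: "W (jpow n (a \<circ> simple_refl i)) = W (jpow n b @ jw (Suc i))" unfolding as by (rule jpow_upd) (use i1 in auto)
  have "W (jpow n a @ rword n w) = W ([] @ (jpow n b @ jw i) @ rword n w)" using W_cong[OF Ja, of "[]" "rword n w"] by simp
  also have "\<dots> = W ((jpow n b @ jw i) @ (rword n ?w1 @ [i]) @ [])" using W_cong[OF 1, of "jpow n b @ jw i" "[]"] by simp
  also have "\<dots> = W ((jpow n b @ jw i) @ rword n ?w1 @ [i])" by simp
  also have "\<dots> = W ((jpow n b @ jw i @ [i] @ rword n ?w2) @ [i])" by (subst W_cong[OF 2]) simp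
  finally have "ctrace n t (W (jpow n a @ rword n w)) = ctrace n t (W ((jpow n b @ jw i @ [i] @ rword n ?w2) @ [i]))" by simp
  also have "\<dots> = ctrace n t (W ([i] @ jpow n b @ jw i @ [i] @ rword n ?w2))"
    by (rule ctrace_comm[symmetric]) (use i in simp)
  also have "W ([i] @ jpow n b @ jw i @ [i] @ rword n ?w2) = W ([] @ (jpow n b @ [i]) @ jw i @ [i] @ rword n ?w2)"
    using W_cong[OF bc, of "[]" "jw i @ [i] @ rword n ?w2"] by simp
  also have "\<dots> = W ([] @ (jpow n b @ jw (Suc i)) @ rword n ?w2)" using i1 by (simp add: jw_Suc_pos)
  also have "\<dots> = W (jpow n (a \<circ> simple_refl i) @ rword n ?w2)"
    using W_cong[OF Js, of "[]" "rword n ?w2"] by simp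
  finally show ?thesis by (simp only: comp_assoc)
qed

text \<open>The residue of \<open>m p\<close> modulo \<open>n\<close> in \<open>{1..n}\<close>, since \<open>psum (cexp n p) m = \<lceil>m p / n\<rceil>\<close>.\<close>

definition residue_pos :: "nat \<Rightarrow> nat \<Rightarrow> nat \<Rightarrow> nat" where
  "residue_pos n p m = m * p + n - n * psum (cexp n p) m"

lemma residue_pos_bounds:
  assumes n: "0 < n"
  shows "residue_pos n p m + n * psum (cexp n p) m = m * p + n" "1 \<le> residue_pos n p m" "residue_pos n p m \<le> n"
proof -
  let ?K = "psum (cexp n p) m"
  have 1: "m * p \<le> ?K * n"
    using ceiling_le_iff[OF n, of "m * p" ?K] psum_cexp[OF n, of p m] by simp
  have 2: "?K * n < m * p + n"
  proof (cases ?K)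
    case 0
    then show ?thesis using n by simp
  next
    case (Suc k)
    then have "\<not> ?K \<le> k" by simp
    then have "\<not> m * p \<le> k * n" unfolding psum_cexp[OF n] ceiling_le_iff[OF n] .
    then show ?thesis using Suc by simp
  qed
  show "residue_pos n p m + n * ?K = m * p + n" "1 \<le> residue_pos n p m" "residue_pos n p m \<le> n"
    using 1 2 by (simp_all add: residue_pos_def mult.commute)
qed

lemma residue_pos_Suc: "0 < n \<Longrightarrow> residue_pos n p (Suc m) + n * cexp n p (Suc m) = residue_pos n p m + p"
  using residue_pos_bounds(1)[of n p m] residue_pos_bounds(1)[of n p "Suc m"] by (simp add: algebra_simps)

lemma residue_pos_0: "residue_pos n p 0 = n" by (simp add: residue_pos_def)

lemma residue_pos_n:
  assumes n: "0 < n"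
  shows "residue_pos n p n = n"
proof -
  have "psum (cexp n p) n \<le> p" unfolding psum_cexp[OF n] ceiling_le_iff[OF n] by (simp add: mult.commute)
  moreover have "\<not> psum (cexp n p) n < p"
  proof
    assume "psum (cexp n p) n < p"
    then have "n * Suc (psum (cexp n p) n) \<le> n * p" by (intro mult_le_mono2) simp
    then show False using residue_pos_bounds(1,3)[OF n, of p n] n by simp
  qed
  ultimately have "psum (cexp n p) n = p" by simp
  then show ?thesis by (simp add: residue_pos_def)
qed

lemma residue_pos_inj:
  assumes cop: "coprime p n" and x: "x \<in> {1..n}" "y \<in> {1..n}" and e: "residue_pos n p x = residue_pos n p y"
  shows "x = y"
proof -
  have n: "0 < n" using x by simp
  have *: "x = y" if le: "y \<le> x" and x: "x \<in> {1..n}" "y \<in> {1..n}" and e: "residue_pos n p x = residue_pos n p y" for x y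
  proof -
    have "x * p + n * psum (cexp n p) y = y * p + n * psum (cexp n p) x"
      using residue_pos_bounds(1)[OF n, of p x] residue_pos_bounds(1)[OF n, of p y] e by linarith
    moreover have "psum (cexp n p) y \<le> psum (cexp n p) x" by (rule psum_mono[OF le])
    ultimately have "(x - y) * p = n * (psum (cexp n p) x - psum (cexp n p) y)"
      using le by (simp add: diff_mult_distrib diff_mult_distrib2)
    then have "n dvd (x - y) * p" by simp
    then have "n dvd x - y" using cop by (simp add: coprime_commute coprime_dvd_mult_left_iff)
    then show ?thesis using x le by (auto dest!: dvd_imp_le)
  qed
  show ?thesis using *[of y x] *[of x y] x e by (cases "y \<le> x") auto
qed

text \<open>The permutation that conjugates the long cycle to its \<open>p\<close>-th power.\<close>

definition residue_perm :: "nat \<Rightarrow> nat \<Rightarrow> nat \<Rightarrow> nat" where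
  "residue_perm n p m = (if m \<in> {1..n} then residue_pos n p m else m)"

lemma residue_perm_permutes:
  assumes n: "0 < n" and cop: "coprime p n"
  shows "residue_perm n p permutes {1..n}"
proof (rule bij_imp_permutes)
  have "inj_on (residue_perm n p) {1..n}"
  proof (rule inj_onI)
    fix x y assume xy: "x \<in> {1..n}" "y \<in> {1..n}" and "residue_perm n p x = residue_perm n p y"
    then have "residue_pos n p x = residue_pos n p y" by (simp only: residue_perm_def if_True)
    then show "x = y" by (rule residue_pos_inj[OF cop xy])
  qed
  moreover have "residue_perm n p ` {1..n} \<subseteq> {1..n}"
    using residue_pos_bounds(2,3)[OF n] by (auto simp: residue_perm_def)
  ultimately show "bij_betw (residue_perm n p) {1..n} {1..n}" by (simp add: bij_betw_def endo_inj_surj)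
qed (auto simp: residue_perm_def)

text \<open>The strand with label \<open>m\<close> sits at position \<open>\<sigma> m\<close>, carries the exponent \<open>cexp n p m\<close>, and is followed by the
strand with label \<open>m + 1\<close>. For \<open>\<sigma> = residue_perm n p\<close> this is the \<open>p\<close>-th power of the Coxeter word, for \<open>\<sigma> = id\<close>
the sorted form.\<close>

definition state :: "nat \<Rightarrow> nat \<Rightarrow> real \<Rightarrow> (nat \<Rightarrow> nat) \<Rightarrow> real poly" where
  "state n p t \<sigma> = ctrace n t (W (jpow n (cexp n p \<circ> inv_into UNIV \<sigma>) @ rword n (\<sigma> \<circ> rot n 1 \<circ> inv_into UNIV \<sigma>)))"

lemma rot1: "m \<in> {1..<n} \<Longrightarrow> rot n 1 m = Suc m" "0 < n \<Longrightarrow> rot n 1 n = 1"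
  by (auto simp: rot_def)

text \<open>Exchanging the neighbouring labels \<open>l\<close> and \<open>y\<close> is a conjugation by \<open>s\<^sub>i\<close>.\<close>

lemma state_swap:
  assumes s: "\<sigma> permutes {1..n}" and i: "i \<in> {1..<n}"
    and l: "inv_into UNIV \<sigma> i = l" and y: "inv_into UNIV \<sigma> (Suc i) = y"
    and d: "\<sigma> (rot n 1 y) < \<sigma> (rot n 1 l)" and ne: "\<sigma> (rot n 1 l) \<noteq> Suc i"
    and c: "cexp n p l = cexp n p y \<and> \<sigma> (inv_into UNIV (rot n 1) l) < \<sigma> (inv_into UNIV (rot n 1) y) \<or>
        cexp n p l = Suc (cexp n p y) \<and> \<sigma> (inv_into UNIV (rot n 1) y) < \<sigma> (inv_into UNIV (rot n 1) l)"
  shows "state n p t \<sigma> = state n p t (simple_refl i \<circ> \<sigma>)"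
proof -
  let ?a = "cexp n p \<circ> inv_into UNIV \<sigma>" and ?w = "\<sigma> \<circ> rot n 1 \<circ> inv_into UNIV \<sigma>"
  have n: "1 \<le> n" using i by simp
  have r: "rot n 1 permutes {1..n}" by (rule rot_permutes[OF n])
  have si: "inv_into UNIV \<sigma> permutes {1..n}" by (rule permutes_inv[OF s])
  have sr: "\<sigma> \<circ> rot n 1 permutes {1..n}" by (rule permutes_compose[OF r s])
  have w: "?w permutes {1..n}" by (rule permutes_compose[OF si sr])
  have inv: "inv_into UNIV (simple_refl i \<circ> \<sigma>) = inv_into UNIV \<sigma> \<circ> simple_refl i"
    using o_inv_distrib[OF bij_simple_refl permutes_bij[OF s]] by simp
  have w': "(simple_refl i \<circ> \<sigma>) \<circ> rot n 1 \<circ> (inv_into UNIV \<sigma> \<circ> simple_refl i) = simple_refl i \<circ> ?w \<circ> simple_refl i"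
    by (simp only: comp_assoc)
  have invw: "inv_into UNIV ?w x = \<sigma> (inv_into UNIV (rot n 1) (inv_into UNIV \<sigma> x))" for x
    unfolding inv_comp_apply[OF sr si] inv_comp_apply[OF s r]
    using permutes_inv_inv[OF s] by simp
  have wi: "?w i = \<sigma> (rot n 1 l)" "?w (Suc i) = \<sigma> (rot n 1 y)" using l y by simp_all
  have ai: "?a i = cexp n p l" "?a (Suc i) = cexp n p y" using l y by simp_all
  have iw: "inv_into UNIV ?w i = \<sigma> (inv_into UNIV (rot n 1) l)"
    "inv_into UNIV ?w (Suc i) = \<sigma> (inv_into UNIV (rot n 1) y)" unfolding invw l y by (rule refl)+
  have dw: "?w (Suc i) < ?w i" unfolding wi by (rule d)
  show ?thesis
    using c
  proof
    assume c: "cexp n p l = cexp n p y \<and> \<sigma> (inv_into UNIV (rot n 1) l) < \<sigma> (inv_into UNIV (rot n 1) y)"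
    have "?a \<circ> simple_refl i = ?a"
    proof
      fix x show "(?a \<circ> simple_refl i) x = ?a x"
        using c l y by (cases "x = i"; cases "x = Suc i") simp_all
    qed
    then have a: "cexp n p \<circ> (inv_into UNIV \<sigma> \<circ> simple_refl i) = ?a" by (simp only: comp_assoc)
    have "ctrace n t (W (jpow n ?a @ rword n ?w)) = ctrace n t (W (jpow n ?a @ rword n (simple_refl i \<circ> ?w \<circ> simple_refl i)))"
      by (rule ctrace_swap_equal[OF w i _ dw]) (use c in \<open>simp_all only: ai iw\<close>)
    then show ?thesis unfolding state_def inv w' a .
  next
    assume c: "cexp n p l = Suc (cexp n p y) \<and> \<sigma> (inv_into UNIV (rot n 1) y) < \<sigma> (inv_into UNIV (rot n 1) l)"
    have a: "cexp n p \<circ> (inv_into UNIV \<sigma> \<circ> simple_refl i) = ?a \<circ> simple_refl i" by (simp only: comp_assoc)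
    have "ctrace n t (W (jpow n ?a @ rword n ?w)) = ctrace n t (W (jpow n (?a \<circ> simple_refl i) @ rword n (simple_refl i \<circ> ?w \<circ> simple_refl i)))"
      by (rule ctrace_swap_unequal[OF w i _ dw]) (use c ne in \<open>simp_all only: ai iw wi not_False_eq_True\<close>)
    then show ?thesis unfolding state_def inv w' a .
  qed
qed

text \<open>The invariant of the selection sort: the labels above \<open>L\<close> are in place, those below \<open>L\<close> are still in the order
of their residues, and \<open>L\<close> itself is on its way from its initial place to the right.\<close>

definition sorted_above :: "nat \<Rightarrow> nat \<Rightarrow> nat \<Rightarrow> (nat \<Rightarrow> nat) \<Rightarrow> bool" where
  "sorted_above n p L \<sigma> \<longleftrightarrow> \<sigma> permutes {1..n} \<and> (\<forall>m\<in>{Suc L..n}. \<sigma> m = m) \<and>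
     (\<forall>x\<in>{1..<L}. \<forall>y\<in>{1..<L}. \<sigma> x < \<sigma> y \<longleftrightarrow> residue_pos n p x < residue_pos n p y) \<and>
     (\<forall>x\<in>{1..<L}. residue_pos n p x < residue_pos n p L \<longrightarrow> \<sigma> x < \<sigma> L)"

text \<open>Let \<open>y < L\<close> be the label to the right of \<open>L\<close>. The successor of \<open>L\<close> is in place, hence to the right of the
successor of \<open>y\<close>. The order of the predecessors is that of their residues, and adding \<open>p\<close> leads to the
residues of \<open>L\<close> and \<open>y\<close>, which are in the order \<open>L\<close> before \<open>y\<close>. So the predecessors either are in the same
order and the exponents are equal, or they are in the opposite order and only \<open>L\<close> has an additional wrap
around, which is one more unit of exponent. These are the two cases in which conjugation is possible.\<close>

lemma sorted_above_step:
  assumes cop: "coprime p n" and L: "2 \<le> L" "L \<le> n" and S: "sorted_above n p L \<sigma>" and lt: "\<sigma> L < L"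
  shows "state n p t \<sigma> = state n p t (simple_refl (\<sigma> L) \<circ> \<sigma>)"
    and "sorted_above n p L (simple_refl (\<sigma> L) \<circ> \<sigma>)"
proof -
  let ?i = "\<sigma> L" and ?z = "residue_pos n p"
  have n: "0 < n" using L by simp
  have s: "\<sigma> permutes {1..n}" and fx: "\<And>m. m \<in> {Suc L..n} \<Longrightarrow> \<sigma> m = m"
    and ord: "\<And>x y. x \<in> {1..<L} \<Longrightarrow> y \<in> {1..<L} \<Longrightarrow> \<sigma> x < \<sigma> y \<longleftrightarrow> ?z x < ?z y"
    and last: "\<And>x. x \<in> {1..<L} \<Longrightarrow> ?z x < ?z L \<Longrightarrow> \<sigma> x < \<sigma> L"
    using S by (auto simp: sorted_above_def)
  have inj: "\<sigma> x = \<sigma> y \<Longrightarrow> x = y" for x y using permutes_inj[OF s] by (meson injD)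
  have im: "\<sigma> x \<in> {1..n}" if "x \<in> {1..n}" for x using permutes_in_image[OF s] that by blast
  have iv: "inv_into UNIV \<sigma> (\<sigma> x) = x" "\<sigma> (inv_into UNIV \<sigma> x) = x" for x using permutes_inverses[OF s] by auto
  have low: "\<sigma> x \<le> L" if "x \<in> {1..L}" for x
  proof (rule ccontr)
    assume a: "\<not> \<sigma> x \<le> L"
    then have "\<sigma> (\<sigma> x) = \<sigma> x" by (intro fx) (use im[of x] that L in auto)
    then have "\<sigma> x = x" by (rule inj)
    then show False using a that by simp
  qed
  have i: "?i \<in> {1..<n}" using im[of L] lt L by auto
  \<comment> \<open>The label at the next position to the right.\<close>
  define y where "y = inv_into UNIV \<sigma> (Suc ?i)"
  have sy: "\<sigma> y = Suc ?i" by (simp add: y_def iv)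
  have yn: "y \<in> {1..n}" using permutes_in_image[OF s, of y] i sy by auto
  have yL: "y \<in> {1..<L}"
  proof -
    have "y \<noteq> L" using sy by auto
    moreover have "\<not> L < y" using fx[of y] sy lt yn by auto
    ultimately show ?thesis using yn by auto
  qed
  have zly: "?z L < ?z y"
  proof -
    have "?z y \<noteq> ?z L" using residue_pos_inj[OF cop yn, of L] yL L by auto
    moreover have "\<not> ?z y < ?z L" using last[OF yL] sy by auto
    ultimately show ?thesis by simp
  qed
  have Ln: "L < n"
  proof (rule ccontr)
    assume "\<not> L < n"
    then have "L = n" using L by simp
    then show False using zly residue_pos_n[OF n] residue_pos_bounds(3)[OF n, of p y] by simp
  qed
  have r: "rot n 1 permutes {1..n}" by (rule rot_permutes) (use n in simp)
  have sn: "\<sigma> n = n" using fx[of n] Ln by simp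
  obtain L' where L': "L = Suc L'" "1 \<le> L'" using L by (cases L) auto
  have irL: "inv_into UNIV (rot n 1) L = L'" by (rule inv_eqI[OF r]) (use L' L rot1 in auto)
  \<comment> \<open>The predecessor label; the labels are cyclic, with \<open>n\<close> before \<open>1\<close>.\<close>
  define y' where "y' = (if y = 1 then n else y - 1)"
  have iry: "inv_into UNIV (rot n 1) y = y'"
  proof (rule inv_eqI[OF r])
    show "rot n 1 y' = y"
    proof (cases "y = 1")
      case True
      then show ?thesis using rot1(2)[OF n] by (simp add: y'_def)
    next
      case False
      then have "y - 1 \<in> {1..<n}" "Suc (y - 1) = y" using yn by auto
      then show ?thesis using rot1(1)[of "y - 1" n] False by (simp only: y'_def if_False)
    qed
  qed
  have zL: "?z L + n * cexp n p L = ?z L' + p" using residue_pos_Suc[OF n, of p L'] L' by simp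
  have zy: "?z y + n * cexp n p y = ?z (y - 1) + p" using residue_pos_Suc[OF n, of p "y - 1"] yn by simp
  have b: "?z L' \<le> n" "1 \<le> ?z L'" "?z (y - 1) \<le> n" "1 \<le> ?z (y - 1)" using residue_pos_bounds(2,3)[OF n] by auto
  have c: "cexp n p L = cexp n p y \<and> ?z L' < ?z (y - 1) \<or> cexp n p L = Suc (cexp n p y) \<and> ?z (y - 1) < ?z L'"
  proof (cases "cexp n p L" "cexp n p y" rule: linorder_cases)
    case less
    then have "n * Suc (cexp n p L) \<le> n * cexp n p y" by (intro mult_le_mono2) simp
    then have "n * cexp n p L + n \<le> n * cexp n p y" by simp
    then show ?thesis using zL zy b zly by linarith
  next
    case equal
    then show ?thesis using zL zy zly by auto
  next
    case greater
    have "cexp n p L \<le> Suc (cexp n p y)"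
    proof (rule ccontr)
      assume "\<not> ?thesis"
      then have "n * (cexp n p y + 2) \<le> n * cexp n p L" by (intro mult_le_mono2) simp
      then have "n * cexp n p y + 2 * n \<le> n * cexp n p L" by (simp add: algebra_simps)
      then show False using zL zy b zly residue_pos_bounds(2,3)[OF n, of p y] residue_pos_bounds(2,3)[OF n, of p L] by linarith
    qed
    then have e: "cexp n p L = Suc (cexp n p y)" using greater by simp
    then have "n * cexp n p L = n * cexp n p y + n" by simp
    then have "?z (y - 1) < ?z L'" using zL zy zly residue_pos_bounds(2,3)[OF n, of p y] residue_pos_bounds(2,3)[OF n, of p L] by linarith
    with e show ?thesis by simp
  qed
  have c': "cexp n p L = cexp n p y \<and> \<sigma> L' < \<sigma> y' \<or> cexp n p L = Suc (cexp n p y) \<and> \<sigma> y' < \<sigma> L'"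
  proof (cases "y = 1")
    case True
    then have "?z (y - 1) = n" by (simp add: residue_pos_0)
    then have "cexp n p L = cexp n p y" using c b by auto
    moreover have "\<sigma> L' < \<sigma> y'" using low[of L'] L' Ln True sn by (simp add: y'_def)
    ultimately show ?thesis by simp
  next
    case False
    then have "y' \<in> {1..<L}" "L' \<in> {1..<L}" using yL L' by (auto simp: y'_def)
    then show ?thesis using c ord[of L' y'] ord[of y' L'] False by (simp add: y'_def)
  qed
  show "state n p t \<sigma> = state n p t (simple_refl ?i \<circ> \<sigma>)"
  proof (rule state_swap[OF s i])
    show "inv_into UNIV \<sigma> ?i = L" by (rule iv)
    show "inv_into UNIV \<sigma> (Suc ?i) = y" by (simp add: y_def)
    have rL: "rot n 1 L = Suc L" and ry: "rot n 1 y = Suc y" using rot1(1) Ln L yL by auto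
    have "\<sigma> (Suc L) = Suc L" using fx[of "Suc L"] Ln by simp
    moreover have "\<sigma> (Suc y) \<le> L" using low[of "Suc y"] yL by auto
    ultimately show "\<sigma> (rot n 1 y) < \<sigma> (rot n 1 L)" "\<sigma> (rot n 1 L) \<noteq> Suc ?i" unfolding rL ry using lt by auto
    show "cexp n p L = cexp n p y \<and> \<sigma> (inv_into UNIV (rot n 1) L) < \<sigma> (inv_into UNIV (rot n 1) y) \<or>
        cexp n p L = Suc (cexp n p y) \<and> \<sigma> (inv_into UNIV (rot n 1) y) < \<sigma> (inv_into UNIV (rot n 1) L)"
      unfolding irL iry by (rule c')
  qed
  show "sorted_above n p L (simple_refl ?i \<circ> \<sigma>)"
    unfolding sorted_above_def
  proof (intro conjI ballI impI)
    show "simple_refl ?i \<circ> \<sigma> permutes {1..n}" by (rule permutes_compose[OF s simple_refl_permutes[OF i]])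
  next
    fix m assume "m \<in> {Suc L..n}"
    then show "(simple_refl ?i \<circ> \<sigma>) m = m" using fx[of m] lt by simp
  next
    fix x x' assume x: "x \<in> {1..<L}" "x' \<in> {1..<L}"
    have "\<sigma> x \<noteq> ?i" "\<sigma> x' \<noteq> ?i" using inj[of x L] inj[of x' L] x by auto
    then have "{\<sigma> x, \<sigma> x'} \<noteq> {?i, Suc ?i}" by (auto simp: doubleton_eq_iff)
    then have "simple_refl ?i (\<sigma> x) < simple_refl ?i (\<sigma> x') \<longleftrightarrow> \<sigma> x < \<sigma> x'"
      using simple_refl_less_iff[of "\<sigma> x" "\<sigma> x'" ?i] by (cases "\<sigma> x = \<sigma> x'") auto
    then show "(simple_refl ?i \<circ> \<sigma>) x < (simple_refl ?i \<circ> \<sigma>) x' \<longleftrightarrow> ?z x < ?z x'" using ord[OF x] by simp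
  next
    fix x assume "x \<in> {1..<L}" "?z x < ?z L"
    then have "\<sigma> x < ?i" by (rule last)
    then show "(simple_refl ?i \<circ> \<sigma>) x < (simple_refl ?i \<circ> \<sigma>) L" by simp
  qed
qed

lemma state_sorted:
  assumes cop: "coprime p n" and "1 \<le> L" "L \<le> n" "sorted_above n p L \<sigma>"
  shows "state n p t \<sigma> = state n p t id"
  using assms(2-)
proof (induction "(L, L - \<sigma> L)" arbitrary: L \<sigma> rule: wf_induct_rule[OF wf_lex_prod[OF wf_less_than wf_less_than]])
  case (1 L \<sigma>)
  have s: "\<sigma> permutes {1..n}" and fx: "\<And>m. m \<in> {Suc L..n} \<Longrightarrow> \<sigma> m = m"
    using 1(4) by (auto simp: sorted_above_def)
  have inj: "\<sigma> x = \<sigma> y \<Longrightarrow> x = y" for x y using permutes_inj[OF s] by (meson injD)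
  have low: "\<sigma> L \<le> L" "1 \<le> \<sigma> L"
  proof -
    have im: "\<sigma> L \<in> {1..n}" using permutes_in_image[OF s, of L] 1(2,3) by simp
    then show "1 \<le> \<sigma> L" by simp
    show "\<sigma> L \<le> L"
    proof (rule ccontr)
      assume a: "\<not> \<sigma> L \<le> L"
      then have "\<sigma> (\<sigma> L) = \<sigma> L" by (intro fx) (use im in auto)
      then have "\<sigma> L = L" by (rule inj)
      then show False using a by simp
    qed
  qed
  show ?case
  proof (cases "L = 1")
    case True
    have "\<sigma> x = x" for x
    proof (cases "x \<in> {1..n}")
      case True
      then show ?thesis using fx[of x] low \<open>L = 1\<close> by (cases "x = 1") auto
    qed (rule permutes_not_in[OF s])
    then have "\<sigma> = id" by auto
    then show ?thesis by simp
  next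
    case False
    then have L: "2 \<le> L" "L \<le> n" using 1(2,3) by auto
    show ?thesis
    proof (cases "\<sigma> L < L")
      case True
      let ?s = "simple_refl (\<sigma> L) \<circ> \<sigma>"
      note step = sorted_above_step[OF cop L 1(4) True]
      have "?s L = Suc (\<sigma> L)" by simp
      then have "state n p t ?s = state n p t id"
        by (intro 1(1)[of L ?s, OF _ 1(2,3) step(2)]) (use True in simp)
      then show ?thesis using step(1)[of t] by simp
    next
      case False
      then have sL: "\<sigma> L = L" using low by simp
      have "sorted_above n p (L - 1) \<sigma>"
        unfolding sorted_above_def
      proof (intro conjI ballI impI)
        show "\<sigma> permutes {1..n}" by (rule s)
      next
        fix m assume "m \<in> {Suc (L - 1)..n}"
        then show "\<sigma> m = m" using fx[of m] sL by (cases "m = L") auto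
      next
        fix x y assume "x \<in> {1..<L - 1}" "y \<in> {1..<L - 1}"
        then have "x \<in> {1..<L}" "y \<in> {1..<L}" by auto
        then show "\<sigma> x < \<sigma> y \<longleftrightarrow> residue_pos n p x < residue_pos n p y" using 1(4) unfolding sorted_above_def by blast
      next
        fix x assume "x \<in> {1..<L - 1}" and z: "residue_pos n p x < residue_pos n p (L - 1)"
        then have "x \<in> {1..<L}" "L - 1 \<in> {1..<L}" by auto
        then show "\<sigma> x < \<sigma> (L - 1)" using z 1(4) unfolding sorted_above_def by blast
      qed
      then show ?thesis by (intro 1(1)[of "L - 1" \<sigma>]) (use L in auto)
    qed
  qed
qed

text \<open>Write \<open>p = q n + r\<close>. Then \<open>W_power\<close> gives exponents \<open>q\<close> or \<open>q + 1\<close>, the latter at the positions \<open>\<le> r\<close>, and these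
agree with \<open>cexp\<close> when read along \<open>residue_perm\<close>; it remains to sort the strands.\<close>

lemma ctrace_coxeter_power:
  assumes n: "2 \<le> n" and cop: "coprime p n"
  shows "ctrace n t (W (wpow [1..<n] p)) = ctrace n t (W (jpow n (cexp n p) @ [1..<n]))"
proof -
  let ?P = "residue_perm n p" and ?a = "cexp n p"
  define q r where "q = p div n" and "r = p mod n"
  have n0: "0 < n" using n by simp
  have P: "?P permutes {1..n}" by (rule residue_perm_permutes[OF n0 cop])
  have iP: "inv_into UNIV ?P (?P x) = x" "?P (inv_into UNIV ?P x) = x" for x using permutes_inverses[OF P] by auto
  have r: "r < n" using n0 by (simp add: r_def)
  have p: "p = q * n + r" by (simp add: q_def r_def)
  have R1: "rot n 1 permutes {1..n}" by (rule rot_permutes) (use n in simp)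
  have key: "rot n r (?P m) = ?P (rot n 1 m) \<and> ?a (rot n 1 m) = q + of_bool (?P (rot n 1 m) \<le> r)"
    if m: "m \<in> {1..n}" for m
  proof -
    let ?m = "rot n 1 m"
    have m': "?m \<in> {1..n}" using permutes_in_image[OF R1, of m] m by blast
    have rel: "residue_pos n p ?m + n * ?a ?m = residue_pos n p m + p"
    proof (cases "m = n")
      case True
      then show ?thesis using residue_pos_Suc[OF n0, of p 0] residue_pos_n[OF n0, of p] residue_pos_0[of n p] rot1(2)[OF n0] by simp
    next
      case False
      then show ?thesis using residue_pos_Suc[OF n0, of p m] rot1(1)[of m n] m by simp
    qed
    have b: "1 \<le> residue_pos n p m" "residue_pos n p m \<le> n" "1 \<le> residue_pos n p ?m" "residue_pos n p ?m \<le> n"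
      using residue_pos_bounds(2,3)[OF n0] by auto
    have PP: "?P m = residue_pos n p m" "?P ?m = residue_pos n p ?m" using m m' by (simp_all only: residue_perm_def if_True)
    consider "?a ?m = q" | "?a ?m = Suc q" | "Suc (Suc q) \<le> ?a ?m" | "Suc (?a ?m) \<le> q" by linarith
    then show ?thesis
    proof cases
      case 1
      then have "residue_pos n p ?m = residue_pos n p m + r" using rel p by (simp add: mult.commute)
      then show ?thesis unfolding PP using 1 b by (simp add: rot_def)
    next
      case 2
      then have "residue_pos n p ?m + n = residue_pos n p m + r" using rel p by (simp add: mult.commute)
      then show ?thesis unfolding PP using 2 b r by (auto simp: rot_def)
    next
      case 3
      then have "n * Suc (Suc q) \<le> n * ?a ?m" by (rule mult_le_mono2)
      then have "n * q + 2 * n \<le> n * ?a ?m" by simp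
      then show ?thesis using rel p b r by (simp add: mult.commute)
    next
      case 4
      then have "n * Suc (?a ?m) \<le> n * q" by (rule mult_le_mono2)
      then have "n * ?a ?m + n \<le> n * q" by simp
      then show ?thesis using rel p b r by (simp add: mult.commute)
    qed
  qed
  have rotP: "rot n r = ?P \<circ> rot n 1 \<circ> inv_into UNIV ?P"
  proof
    fix x
    show "rot n r x = (?P \<circ> rot n 1 \<circ> inv_into UNIV ?P) x"
    proof (cases "x \<in> {1..n}")
      case True
      then have "inv_into UNIV ?P x \<in> {1..n}" using permutes_in_image[OF permutes_inv[OF P]] by blast
      from key[OF this] show ?thesis by (simp add: iP)
    next
      case False
      then have "inv_into UNIV ?P x = x" using permutes_not_in[OF permutes_inv[OF P]] by blast
      then show ?thesis using False by (auto simp: rot_def residue_perm_def)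
    qed
  qed
  have exps: "jpow n (\<lambda>l. q + of_bool (l \<le> r)) = jpow n (?a \<circ> inv_into UNIV ?P)"
  proof (rule jpow_cong)
    fix l assume l: "l \<in> {1..n}"
    let ?m = "inv_into UNIV (rot n 1) (inv_into UNIV ?P l)"
    have "inv_into UNIV ?P l \<in> {1..n}" using permutes_in_image[OF permutes_inv[OF P]] l by blast
    then have "?m \<in> {1..n}" using permutes_in_image[OF permutes_inv[OF R1]] by blast
    moreover have "rot n 1 ?m = inv_into UNIV ?P l" using permutes_inverses(1)[OF R1] by blast
    ultimately have "?a (inv_into UNIV ?P l) = q + of_bool (?P (inv_into UNIV ?P l) \<le> r)"
      using key[of ?m] by (simp only:) 
    then show "q + of_bool (l \<le> r) = (?a \<circ> inv_into UNIV ?P) l" by (simp add: iP)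
  qed
  have "ctrace n t (W (wpow [1..<n] p)) = state n p t ?P"
    unfolding state_def rotP[symmetric] exps[symmetric] using W_power[of r n q] r by (simp add: p)
  also have "\<dots> = state n p t id"
  proof (rule state_sorted[OF cop])
    show "sorted_above n p n ?P"
      unfolding sorted_above_def using P by (auto simp: residue_perm_def)
  qed (use n in auto)
  also have "\<dots> = ctrace n t (W (jpow n ?a @ [1..<n]))"
  proof -
    have "jpow n (\<lambda>l. of_bool (l \<le> 1)) = []"
    proof -
      have "jp (\<lambda>l. of_bool (l \<le> 1)) l = []" for l by (cases "l = 0"; cases "l = 1") (auto simp: jp_def)
      then show ?thesis by (simp add: jpow_def)
    qed
    then have "W (wpow [1..<n] 1) = W (rword n (rot n 1))" using W_power_le[of 1 n] n by simp
    then have C: "W (rword n (rot n 1)) = W [1..<n]" by (simp add: wpow_def)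
    have "state n p t id = ctrace n t (W (jpow n ?a @ rword n (rot n 1)))" by (simp add: state_def)
    then show ?thesis using W_cong[OF C, of "jpow n ?a" "[]"] by simp
  qed
  finally show ?thesis .
qed

section \<open>Determinants as sums over stable subsets\<close>

text \<open>The sum of all principal minors of \<open>a\<close> times the permutation matrix of \<open>w\<close>: a principal minor on \<open>T\<close>
vanishes unless \<open>T\<close> is stable.\<close>

definition inv_sum :: "'b set \<Rightarrow> ('b \<Rightarrow> 'b) \<Rightarrow> 'a :: comm_ring_1 \<Rightarrow> 'a" where
  "inv_sum S w a = (\<Sum>T\<in>{T \<in> Pow S. w ` T = T}. a ^ card T * of_int (sign (restrict_id w T)))"

lemma prod_of_bool: "finite A \<Longrightarrow> (\<Prod>x\<in>A. of_bool (P x)) = (of_bool (\<forall>x\<in>A. P x) :: 'a :: comm_ring_1)"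
  by (induction A rule: finite_induct) auto

text \<open>In the Leibniz formula, a product over a permutation \<open>u\<close> expands into a sum over the sets \<open>T\<close> on which the factor
\<open>a\<close> is chosen; such a term is nonzero iff \<open>u\<close> is \<open>w\<close> on \<open>T\<close> and the identity elsewhere.\<close>

lemma det_perm_matrix:
  fixes a :: "'a :: comm_ring_1"
  assumes v: "v permutes {0..<n}"
  shows "det (mat n n (\<lambda>(i, j). of_bool (i = j) + a * of_bool (v i = j))) = inv_sum {0..<n} v a"
proof -
  let ?S = "{0..<n}" and ?A = "mat n n (\<lambda>(i, j). of_bool (i = j) + a * of_bool (v i = j))"
  let ?PS = "{p. p permutes ?S}"
  have fin: "finite ?PS" by (rule finite_permutations) simp
  have A: "?A \<in> carrier_mat n n" by simp
  have "det ?A = (\<Sum>p\<in>?PS. of_int (sign p) * (\<Prod>i\<in>?S. a * of_bool (v i = p i) + of_bool (i = p i)))"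
    unfolding det_def'[OF A]
  proof (rule sum.cong)
    fix p assume "p \<in> ?PS"
    then have "p i < n" if "i < n" for i using permutes_in_image[of p ?S i] that by simp
    then have "(\<Prod>i = 0..<n. ?A $$ (i, p i)) = (\<Prod>i\<in>?S. a * of_bool (v i = p i) + of_bool (i = p i))"
      by (intro prod.cong) (simp_all add: add.commute)
    then show "of_int (sign p) * (\<Prod>i = 0..<n. ?A $$ (i, p i)) = of_int (sign p) * (\<Prod>i\<in>?S. a * of_bool (v i = p i) + of_bool (i = p i))"
      by simp
  qed simp
  also have "\<dots> = (\<Sum>p\<in>?PS. \<Sum>T\<in>Pow ?S. of_int (sign p) * (a ^ card T * of_bool (p = restrict_id v T)))"
  proof (rule sum.cong)
    fix p assume p: "p \<in> ?PS"
    have "(\<Prod>i\<in>?S. a * of_bool (v i = p i) + of_bool (i = p i)) =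
      (\<Sum>T\<in>Pow ?S. (\<Prod>i\<in>T. a * of_bool (v i = p i)) * (\<Prod>i\<in>?S - T. of_bool (i = p i)))"
      by (rule prod_add) simp
    also have "\<dots> = (\<Sum>T\<in>Pow ?S. a ^ card T * of_bool (p = restrict_id v T))"
    proof (rule sum.cong)
      fix T assume T: "T \<in> Pow ?S"
      then have fT: "finite T" using finite_subset by auto
      have "(\<forall>i\<in>T. v i = p i) \<and> (\<forall>i\<in>?S - T. i = p i) \<longleftrightarrow> p = restrict_id v T"
      proof
        assume a: "(\<forall>i\<in>T. v i = p i) \<and> (\<forall>i\<in>?S - T. i = p i)"
        show "p = restrict_id v T"
        proof
          fix i show "p i = restrict_id v T i"
            using a p permutes_not_in[of p ?S i] by (cases "i \<in> T"; cases "i \<in> ?S") (auto simp: restrict_id_def)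
        qed
      qed (auto simp: restrict_id_def)
      then show "(\<Prod>i\<in>T. a * of_bool (v i = p i)) * (\<Prod>i\<in>?S - T. of_bool (i = p i)) = a ^ card T * of_bool (p = restrict_id v T)"
        using fT by (simp add: prod.distrib prod_of_bool mult.assoc flip: of_bool_conj)
    qed simp
    finally show "of_int (sign p) * (\<Prod>i\<in>?S. a * of_bool (v i = p i) + of_bool (i = p i)) =
       (\<Sum>T\<in>Pow ?S. of_int (sign p) * (a ^ card T * of_bool (p = restrict_id v T)))"
      by (simp only: sum_distrib_left)
  qed simp
  also have "\<dots> = (\<Sum>T\<in>Pow ?S. \<Sum>p\<in>?PS. of_int (sign p) * (a ^ card T * of_bool (p = restrict_id v T)))"
    by (rule sum.swap)
  also have "\<dots> = (\<Sum>T\<in>Pow ?S. if v ` T = T then a ^ card T * of_int (sign (restrict_id v T)) else 0)"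
  proof (rule sum.cong)
    fix T assume T: "T \<in> Pow ?S"
    have iff: "restrict_id v T permutes ?S \<longleftrightarrow> v ` T = T"
    proof
      assume r: "restrict_id v T permutes ?S"
      then have "restrict_id v T permutes T"
        by (rule permutes_superset) (auto simp: restrict_id_def)
      then have "restrict_id v T ` T = T" by (rule permutes_image)
      then show "v ` T = T" by simp
    next
      assume "v ` T = T"
      then have "bij_betw v T T" using inj_on_subset[OF permutes_inj[OF v]] by (auto simp: bij_betw_def)
      then have "restrict_id v T permutes T" by (rule permutes_restrict_id)
      then show "restrict_id v T permutes ?S" by (rule permutes_subset) (use T in auto)
    qed
    have "(\<Sum>p\<in>?PS. of_int (sign p) * (a ^ card T * of_bool (p = restrict_id v T))) =
      (\<Sum>p\<in>?PS. if p = restrict_id v T then a ^ card T * of_int (sign (restrict_id v T)) else 0)"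
      by (rule sum.cong) (auto simp: mult.commute)
    also have "\<dots> = (if v ` T = T then a ^ card T * of_int (sign (restrict_id v T)) else 0)"
      using fin iff by (simp add: sum.delta)
    finally show "(\<Sum>p\<in>?PS. of_int (sign p) * (a ^ card T * of_bool (p = restrict_id v T))) =
      (if v ` T = T then a ^ card T * of_int (sign (restrict_id v T)) else 0)" .
  qed simp
  also have "\<dots> = inv_sum ?S v a"
    unfolding inv_sum_def by (rule sum.inter_filter[symmetric]) simp
  finally show ?thesis .
qed

text \<open>Shifts a permutation of \<open>{1..n}\<close> to \<open>{0..<n}\<close>, the index set of matrices.\<close>

definition lower :: "nat \<Rightarrow> (nat \<Rightarrow> nat) \<Rightarrow> nat \<Rightarrow> nat" where
  "lower n w i = (if i < n then w (Suc i) - 1 else i)"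

lemma lower_Suc:
  assumes "w permutes {1..n}" "i < n"
  shows "Suc (lower n w i) = w (Suc i)" "lower n w i < n"
proof -
  have "w (Suc i) \<in> {1..n}" using permutes_in_image[OF assms(1), of "Suc i"] assms(2) by simp
  then show "Suc (lower n w i) = w (Suc i)" "lower n w i < n" using assms(2) by (auto simp: lower_def)
qed

lemma lower_permutes:
  assumes w: "w permutes {1..n}"
  shows "lower n w permutes {0..<n}"
proof (rule bij_imp_permutes)
  have "inj_on (lower n w) {0..<n}"
  proof (rule inj_onI)
    fix x y assume xy: "x \<in> {0..<n}" "y \<in> {0..<n}" "lower n w x = lower n w y"
    then have "w (Suc x) = w (Suc y)" using lower_Suc(1)[OF w] by (metis atLeastLessThan_iff)
    then show "x = y" using permutes_inj[OF w, THEN injD] by blast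
  qed
  moreover have "lower n w ` {0..<n} \<subseteq> {0..<n}" using lower_Suc(2)[OF w] by auto
  ultimately show "bij_betw (lower n w) {0..<n} {0..<n}" by (simp add: bij_betw_def endo_inj_surj)
qed (auto simp: lower_def)

lemma sum_of_bool_le: "(\<Sum>b\<le>j. of_bool (b = i)) = (of_bool (i \<le> j) :: 'a :: comm_ring_1)" for i j :: nat
  by (induction j) auto

text \<open>Passing to partial sums and differences (unitriangular matrices \<open>L\<close> and \<open>U\<close>) brings \<open>1 + a w\<close> on the full
permutation representation into block triangular form, with the dual reflection representation and
the trivial one as diagonal blocks; the latter contributes \<open>1 + a\<close>.\<close>

lemma det_dual_eq:
  fixes a :: "'a :: idom"
  assumes n: "1 \<le> n" and w: "w permutes {1..n}"
  shows "(1 + a) * det_dual n a w = inv_sum {0..<n} (lower n w) a"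
proof -
  let ?v = "lower n w" and ?m = "n - 1"
  have v: "?v permutes {0..<n}" by (rule lower_permutes[OF w])
  define M where "M = mat ?m ?m (\<lambda>(j, i). of_bool (j = i) +
    a * (\<Sum>b\<le>j. of_bool (?v b = i) - of_bool (?v b = Suc i)) :: 'a)"
  have D: "det_dual n a w = det M"
  proof -
    have iw: "inv_into UNIV (inv_into UNIV w) = w" by (rule permutes_inv_inv[OF w])
    have e: "root_coeff (perm_act (inv_into UNIV w) (simple_root (Suc i))) (Suc j) =
      (\<Sum>b\<le>j. of_bool (?v b = i) - of_bool (?v b = Suc i) :: 'a)" if "i < ?m" "j < ?m" for i j
    proof -
      have "root_coeff (perm_act (inv_into UNIV w) (simple_root (Suc i))) (Suc j) =
        (\<Sum>b\<in>{Suc 0..Suc j}. of_bool (w b = Suc i) - of_bool (w b = Suc (Suc i)) :: 'a)"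
        by (simp only: root_coeff_def perm_act_def simple_root_def iw One_nat_def)
      also have "\<dots> = (\<Sum>b\<in>{0..j}. of_bool (w (Suc b) = Suc i) - of_bool (w (Suc b) = Suc (Suc i)))"
        by (rule sum.shift_bounds_cl_Suc_ivl)
      also have "\<dots> = (\<Sum>b\<le>j. of_bool (?v b = i) - of_bool (?v b = Suc i))"
      proof (rule sum.cong)
        fix b assume "b \<in> {..j}"
        then have "w (Suc b) = Suc (?v b)" using that lower_Suc(1)[OF w, of b] by simp
        then show "of_bool (w (Suc b) = Suc i) - of_bool (w (Suc b) = Suc (Suc i)) = (of_bool (?v b = i) - of_bool (?v b = Suc i) :: 'a)"
          by (simp only: nat.inject)
      qed auto
      finally show ?thesis .
    qed
    have "transpose_mat (1\<^sub>m ?m + a \<cdot>\<^sub>m dual_refl_mat n w) = M"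
      by (rule eq_matI) (auto simp: M_def dual_refl_mat_def refl_mat_def e)
    moreover have "1\<^sub>m ?m + a \<cdot>\<^sub>m dual_refl_mat n w \<in> carrier_mat ?m ?m"
      by (simp add: dual_refl_mat_def refl_mat_def)
    ultimately show ?thesis unfolding det_dual_def using det_transpose by metis
  qed
  define N where "N = mat n n (\<lambda>(i, j). of_bool (i = j) + a * of_bool (?v i = j) :: 'a)"
  define L where "L = mat n n (\<lambda>(j, b). of_bool (b \<le> j) :: 'a)"
  define U where "U = mat n n (\<lambda>(b, i). of_bool (b = i) - of_bool (b = Suc i) :: 'a)"
  have car: "N \<in> carrier_mat n n" "L \<in> carrier_mat n n" "U \<in> carrier_mat n n"
    by (simp_all add: N_def L_def U_def)
  have dL: "det L = 1"
  proof -
    have "det L = prod_list (diag_mat L)" by (rule det_lower_triangular[OF _ car(2)]) (auto simp: L_def)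
    also have "\<dots> = 1" by (simp add: prod_list_diag_prod L_def)
    finally show ?thesis .
  qed
  have dU: "det U = 1"
  proof -
    have "det U = prod_list (diag_mat U)" by (rule det_lower_triangular[OF _ car(3)]) (auto simp: U_def)
    also have "\<dots> = 1" by (simp add: prod_list_diag_prod U_def)
    finally show ?thesis .
  qed
  have LN: "(L * N) $$ (j, k) = (\<Sum>b\<le>j. of_bool (b = k) + a * of_bool (?v b = k))" if "j < n" "k < n" for j k
  proof -
    have "(L * N) $$ (j, k) = (\<Sum>b = 0..<n. of_bool (b \<le> j) * (of_bool (b = k) + a * of_bool (?v b = k)))"
      using that by (simp add: L_def N_def scalar_prod_def)
    also have "\<dots> = (\<Sum>b\<in>{..j}. of_bool (b \<le> j) * (of_bool (b = k) + a * of_bool (?v b = k)))"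
      by (rule sum.mono_neutral_right) (use that in auto)
    also have "\<dots> = (\<Sum>b\<le>j. of_bool (b = k) + a * of_bool (?v b = k))"
      by (rule sum.cong) auto
    finally show ?thesis .
  qed
  have LNU: "(L * N * U) $$ (j, i) = (L * N) $$ (j, i) - (if Suc i < n then (L * N) $$ (j, Suc i) else 0)"
    if "j < n" "i < n" for j i
  proof -
    have "(L * N * U) $$ (j, i) = (\<Sum>k = 0..<n. (L * N) $$ (j, k) * (of_bool (k = i) - of_bool (k = Suc i)))"
      using that car by (simp add: U_def scalar_prod_def)
    also have "\<dots> = (\<Sum>k = 0..<n. if k = i then (L * N) $$ (j, k) else 0) - (\<Sum>k = 0..<n. if k = Suc i then (L * N) $$ (j, k) else 0)"
      unfolding sum_subtractf[symmetric] by (rule sum.cong) auto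
    also have "\<dots> = (L * N) $$ (j, i) - (if Suc i < n then (L * N) $$ (j, Suc i) else 0)"
      using that by (simp add: sum.delta)
    finally show ?thesis .
  qed
  define A2 where "A2 = mat ?m 1 (\<lambda>(j, i). (L * N * U) $$ (j, ?m))"
  have blk: "L * N * U = four_block_mat M A2 (0\<^sub>m 1 ?m) (mat 1 1 (\<lambda>_. 1 + a))"
  proof (rule eq_matI)
    fix j i assume "j < dim_row (four_block_mat M A2 (0\<^sub>m 1 ?m) (mat 1 1 (\<lambda>_. 1 + a)))"
      "i < dim_col (four_block_mat M A2 (0\<^sub>m 1 ?m) (mat 1 1 (\<lambda>_. 1 + a)))"
    then have ji: "j < n" "i < n" using n by (simp_all add: M_def)
    have full: "(\<Sum>b\<le>?m. of_bool (?v b = k)) = (1 :: 'a)" if "k < n" for k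
    proof -
      have "(\<Sum>b\<le>?m. of_bool (?v b = k) :: 'a) = (\<Sum>b\<in>{0..<n}. of_bool (?v b = k))"
        using n by (intro sum.cong) auto
      also have "\<dots> = (\<Sum>c\<in>{0..<n}. of_bool (c = k))"
        by (rule sum.reindex_bij_betw[OF permutes_imp_bij[OF v]])
      also have "\<dots> = 1" using that by (simp add: sum.delta of_bool_def)
      finally show ?thesis .
    qed
    consider "j < ?m" "i < ?m" | "j < ?m" "i = ?m" | "j = ?m" "i < ?m" | "j = ?m" "i = ?m"
      using ji by linarith
    then show "(L * N * U) $$ (j, i) = four_block_mat M A2 (0\<^sub>m 1 ?m) (mat 1 1 (\<lambda>_. 1 + a)) $$ (j, i)"
    proof cases
      case 1
      have "(L * N * U) $$ (j, i) = (\<Sum>b\<le>j. of_bool (b = i) + a * of_bool (?v b = i)) - (\<Sum>b\<le>j. of_bool (b = Suc i) + a * of_bool (?v b = Suc i))"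
        using 1 by (simp add: LNU LN)
      also have "\<dots> = (of_bool (i \<le> j) - of_bool (Suc i \<le> j)) + a * (\<Sum>b\<le>j. of_bool (?v b = i) - of_bool (?v b = Suc i))"
        by (simp add: sum.distrib sum_subtractf sum_distrib_left[symmetric] sum_of_bool_le algebra_simps)
      also have "of_bool (i \<le> j) - of_bool (Suc i \<le> j) = (of_bool (j = i) :: 'a)" by auto
      finally show ?thesis using 1 by (simp add: M_def)
    next
      case 2
      then show ?thesis by (simp add: M_def A2_def)
    next
      case 3
      have "(L * N * U) $$ (j, i) = (\<Sum>b\<le>?m. of_bool (b = i) + a * of_bool (?v b = i)) - (\<Sum>b\<le>?m. of_bool (b = Suc i) + a * of_bool (?v b = Suc i))"
        using 3 ji by (simp add: LNU LN)
      also have "\<dots> = 0"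
      proof -
        have "i < n" "Suc i < n" "i \<le> ?m" "Suc i \<le> ?m" using 3 by auto
        then show ?thesis by (simp only: sum.distrib sum_distrib_left[symmetric] sum_of_bool_le full) simp
      qed
      finally show ?thesis using 3 by (simp add: M_def)
    next
      case 4
      have "(L * N * U) $$ (j, i) = (\<Sum>b\<le>?m. of_bool (b = ?m) + a * of_bool (?v b = ?m))"
        using 4 ji by (simp add: LNU LN)
      also have "\<dots> = 1 + a"
      proof -
        have "?m < n" "?m \<le> ?m" using n by auto
        then show ?thesis by (simp only: sum.distrib sum_distrib_left[symmetric] sum_of_bool_le full) simp
      qed
      finally show ?thesis using 4 by (simp add: M_def)
    qed
  qed (use car n in \<open>simp_all add: M_def\<close>)
  have "det N = det L * det N * det U" using dL dU by simp
  also have "\<dots> = det (L * N * U)"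
    by (subst det_mult[of _ n], (use car in simp_all)[2], subst det_mult[of _ n]) (use car in simp_all)
  also have "\<dots> = det M * det (mat 1 1 (\<lambda>_. 1 + a))"
    unfolding blk by (rule det_four_block_mat_lower_left_zero[of _ ?m _ 1]) (simp_all add: M_def A2_def)
  also have "det (mat 1 1 (\<lambda>_. 1 + a)) = 1 + a" by (simp add: det_single)
  finally have "det N = det M * (1 + a)" .
  moreover have "det N = inv_sum {0..<n} ?v a" unfolding N_def by (rule det_perm_matrix[OF v])
  ultimately show ?thesis using D by (simp add: mult.commute)
qed

section \<open>Cycle types\<close>

text \<open>The list of cycle lengths is not normalized: a permutation has one cycle type for each order in which its
cycles are composed.\<close>

inductive ctype :: "'b set \<Rightarrow> ('b \<Rightarrow> 'b) \<Rightarrow> nat list \<Rightarrow> bool" where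
  ctype_empty: "ctype {} id []"
| ctype_cycle: "ctype I w ls \<Longrightarrow> distinct cs \<Longrightarrow> cs \<noteq> [] \<Longrightarrow> set cs \<inter> I = {} \<Longrightarrow>
    ctype (set cs \<union> I) (cycle_of_list cs \<circ> w) (length cs # ls)"

lemma ctype_exists:
  assumes "w permutes S" "finite S"
  shows "\<exists>ls. ctype S w ls"
  using cycle_decomposition[OF assms]
proof (induction rule: cycle_decomp.induct)
  case empty
  show ?case using ctype_empty by blast
next
  case (comp I p cs)
  then obtain ls where ls: "ctype I p ls" by blast
  show ?case
  proof (cases "cs = []")
    case True
    then show ?thesis using ls by auto
  next
    case False
    then show ?thesis using ctype_cycle[OF ls comp.hyps(2) _ comp.hyps(3)] by blast
  qed
qed

lemma ctype_basic:
  "ctype S w ls \<Longrightarrow> finite S \<and> w permutes S \<and> sum_list ls = card S \<and> (\<forall>l\<in>set ls. 0 < l)"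
proof (induction rule: ctype.induct)
  case ctype_empty
  show ?case using permutes_id[of "{}"] by (simp add: id_def)
next
  case (ctype_cycle I w ls cs)
  have "cycle_of_list cs permutes (set cs \<union> I)" by (rule permutes_subset[OF cycle_permutes]) auto
  moreover have "w permutes (set cs \<union> I)" by (rule permutes_subset[of w I]) (use ctype_cycle in auto)
  ultimately have perm: "cycle_of_list cs \<circ> w permutes (set cs \<union> I)" by (rule permutes_compose[rotated])
  have "card (set cs \<union> I) = length cs + card I"
    using ctype_cycle by (subst card_Un_disjoint) (auto simp: distinct_card)
  then show ?case using ctype_cycle by (intro conjI perm) auto
qed

lemma sign_cycle: "distinct cs \<Longrightarrow> cs \<noteq> [] \<Longrightarrow> sign (cycle_of_list cs) = (- 1) ^ (length cs - 1)"
proof (induction cs rule: cycle_of_list.induct)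
  case (1 i j cs)
  have "sign (cycle_of_list (i # j # cs)) = sign (transpose i j) * sign (cycle_of_list (j # cs))"
    unfolding cycle_of_list.simps by (rule sign_compose) (auto simp: permutation_of_cycle permutation_swap_id)
  moreover have "sign (cycle_of_list (j # cs)) = (- 1) ^ length cs" using 1 by simp
  moreover have "sign (transpose i j) = - 1" using 1 by (simp add: sign_swap_id)
  ultimately show ?case by (simp only:) simp
qed simp_all

lemma cycle_closed:
  assumes "distinct cs" "cs \<noteq> []" "T \<subseteq> set cs" "cycle_of_list cs ` T = T"
  shows "T = {} \<or> T = set cs"
proof (rule disjCI)
  assume "T \<noteq> set cs" 
  show "T = {}"
  proof (rule ccontr)
    assume "T \<noteq> {}"
    then obtain x where x: "x \<in> T" by blast
    then obtain i where i: "i < length cs" "cs ! i = x" using assms(3) by (metis in_set_conv_nth subsetD)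
    have st: "(cycle_of_list cs ^^ k) x \<in> T" for k
      using x assms(4) by (induction k) auto
    have "y \<in> T" if y: "y \<in> set cs" for y
    proof -
      obtain j where j: "j < length cs" "cs ! j = y" using y unfolding in_set_conv_nth by blast
      let ?k = "j + length cs - i"
      have "map (cycle_of_list cs ^^ ?k) cs ! i = rotate ?k cs ! i" by (simp only: cyclic_rotation[OF assms(1)])
      then have "(cycle_of_list cs ^^ ?k) x = cs ! ((?k + i) mod length cs)" using i by (simp add: nth_rotate add.commute)
      also have "(?k + i) mod length cs = j" using i j by simp
      finally show ?thesis using st j by metis
    qed
    then show False using \<open>T \<noteq> set cs\<close> assms(3) by blast
  qed
qed

lemma disjoint_union_parts:
  "T = A \<union> B \<Longrightarrow> A \<subseteq> C \<Longrightarrow> B \<subseteq> D \<Longrightarrow> C \<inter> D = {} \<Longrightarrow> A = T \<inter> C \<and> B = T \<inter> D"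
  by blast

text \<open>A stable set contains a cycle entirely or not at all, and a cycle of length \<open>l\<close> contributes
\<open>sign \<cdot> a ^ l = - ((- a) ^ l)\<close>.\<close>

lemma inv_sum_ctype:
  fixes a :: "'a :: comm_ring_1"
  shows "ctype S w ls \<Longrightarrow> inv_sum S w a = (\<Prod>l\<leftarrow>ls. 1 - (- a) ^ l)"
proof (induction rule: ctype.induct)
  case ctype_empty
  have "{T \<in> Pow {}. id ` T = T} = {{} :: 'b set}" by auto
  moreover have "restrict_id id {} = (id :: 'b \<Rightarrow> 'b)" by (auto simp: restrict_id_def)
  ultimately show ?case by (simp add: inv_sum_def)
next
  case (ctype_cycle I w ls cs)
  let ?c = "cycle_of_list cs" and ?l = "length cs"
  let ?w = "?c \<circ> w" and ?J = "{T \<in> Pow I. w ` T = T}"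
  have basic: "finite I" "w permutes I" using ctype_basic[OF ctype_cycle.hyps(1)] by auto
  have c: "?c permutes set cs" by (rule cycle_permutes)
  have wI: "w x = x" if "x \<notin> I" for x using permutes_not_in[OF basic(2) that] .
  have cI: "?c x = x" if "x \<notin> set cs" for x using permutes_not_in[OF c that] .
  have wim: "w x \<in> I \<longleftrightarrow> x \<in> I" for x by (rule permutes_in_image[OF basic(2)])
  have cim: "?c x \<in> set cs \<longleftrightarrow> x \<in> set cs" for x by (rule permutes_in_image[OF c])
  have dis: "x \<in> set cs \<Longrightarrow> x \<notin> I" for x using ctype_cycle.hyps by auto
  have on1: "?w x = ?c x" if "x \<in> set cs" for x using wI[OF dis[OF that]] by simp
  have on2: "?w x = w x" if "x \<in> I" for x
    using cI[of "w x"] wim[of x] dis that by auto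
  have J: "{T \<in> Pow (set cs \<union> I). ?w ` T = T} = ?J \<union> (\<lambda>T. set cs \<union> T) ` ?J"
  proof (intro subset_antisym subsetI)
    fix T assume "T \<in> {T \<in> Pow (set cs \<union> I). ?w ` T = T}"
    then have T: "T \<subseteq> set cs \<union> I" "?w ` T = T" by auto
    let ?T1 = "T \<inter> set cs" and ?T2 = "T \<inter> I"
    have im: "?w ` T = ?c ` ?T1 \<union> w ` ?T2"
    proof -
      have "T = ?T1 \<union> ?T2" using T(1) by blast
      then have "?w ` T = ?w ` ?T1 \<union> ?w ` ?T2" by (metis image_Un)
      moreover have "?w ` ?T1 = ?c ` ?T1" by (rule image_cong) (use on1 in auto)
      moreover have "?w ` ?T2 = w ` ?T2" by (rule image_cong) (use on2 in auto)
      ultimately show ?thesis by simp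
    qed
    have s1: "?c ` ?T1 \<subseteq> set cs" using cim by auto
    have s2: "w ` ?T2 \<subseteq> I" using wim by auto
    have "?c ` ?T1 = ?T1" "w ` ?T2 = ?T2"
      using disjoint_union_parts[OF _ s1 s2 ctype_cycle.hyps(4), of T] T(2) im by simp_all
    moreover from cycle_closed[OF ctype_cycle.hyps(2,3) _ this(1)] have "?T1 = {} \<or> ?T1 = set cs" by blast
    moreover have "T = ?T1 \<union> ?T2" using T(1) by blast
    ultimately show "T \<in> ?J \<union> (\<lambda>T. set cs \<union> T) ` ?J" by auto
  next
    fix T assume "T \<in> ?J \<union> (\<lambda>T. set cs \<union> T) ` ?J"
    then consider "T \<in> ?J" | T' where "T = set cs \<union> T'" "T' \<in> ?J" by blast
    then show "T \<in> {T \<in> Pow (set cs \<union> I). ?w ` T = T}"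
    proof cases
      case 1
      then have "?w ` T = w ` T" by (intro image_cong) (use on2 in auto)
      then show ?thesis using 1 by auto
    next
      case 2
      have "?w ` T' = w ` T'" by (rule image_cong) (use on2 2 in auto)
      moreover have "?w ` set cs = ?c ` set cs" by (rule image_cong) (use on1 in auto)
      ultimately have "?w ` T = T" using 2 permutes_image[OF c] by (simp add: image_Un)
      then show ?thesis using 2 by auto
    qed
  qed
  have fJ: "finite ?J" using basic by simp
  have disJ: "?J \<inter> (\<lambda>T. set cs \<union> T) ` ?J = {}"
    using ctype_cycle.hyps(3,4) by (cases cs) auto
  have r1: "restrict_id ?w T = restrict_id w T" if "T \<in> ?J" for T
    using that on2 by (auto simp: restrict_id_def fun_eq_iff)
  have r2: "restrict_id ?w (set cs \<union> T) = ?c \<circ> restrict_id w T" if T: "T \<in> ?J" for T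
  proof
    fix x
    consider "x \<in> set cs" | "x \<in> T" | "x \<notin> set cs" "x \<notin> T" by blast
    then show "restrict_id ?w (set cs \<union> T) x = (?c \<circ> restrict_id w T) x"
    proof cases
      case 1
      then have "x \<notin> T" using T dis by auto
      then show ?thesis using 1 on1 by simp
    next
      case 2
      then have "w x \<in> T" using T by auto
      then have "w x \<notin> set cs" using T dis by auto
      then show ?thesis using 2 cI by simp
    next
      case 3
      then show ?thesis using cI by simp
    qed
  qed
  have pT: "permutation (restrict_id w T)" if T: "T \<in> ?J" for T
  proof -
    have "bij_betw w T T" using inj_on_subset[OF permutes_inj[OF basic(2)]] T by (auto simp: bij_betw_def)
    then have "restrict_id w T permutes T" by (rule permutes_restrict_id)
    then show ?thesis using T basic(1) finite_subset permutation_permutes by blast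
  qed
  have cT: "card (set cs \<union> T) = ?l + card T" if T: "T \<in> ?J" for T
    using T ctype_cycle.hyps basic(1) finite_subset[of T I]
    by (subst card_Un_disjoint) (auto simp: distinct_card)
  have s: "of_int (sign ?c) * a ^ ?l = - ((- a) ^ ?l)"
  proof -
    obtain k where "?l = Suc k" using ctype_cycle.hyps(3) by (cases cs) auto
    then show ?thesis using sign_cycle[OF ctype_cycle.hyps(2,3)] by (simp add: power_minus[of a])
  qed
  have "inv_sum (set cs \<union> I) ?w a = (\<Sum>T\<in>?J. a ^ card T * of_int (sign (restrict_id w T))) +
     (\<Sum>T\<in>(\<lambda>T. set cs \<union> T) ` ?J. a ^ card T * of_int (sign (restrict_id ?w T)))"
    unfolding inv_sum_def J
    by (subst sum.union_disjoint[OF fJ _ disJ]) (use fJ r1 in \<open>auto intro!: sum.cong\<close>)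
  also have "(\<Sum>T\<in>(\<lambda>T. set cs \<union> T) ` ?J. a ^ card T * of_int (sign (restrict_id ?w T))) =
    (\<Sum>T\<in>?J. a ^ card (set cs \<union> T) * of_int (sign (restrict_id ?w (set cs \<union> T))))"
  proof (rule sum.reindex_cong[OF _ refl refl])
    show "inj_on (\<lambda>T. set cs \<union> T) ?J" by (rule inj_onI) (use dis in blast)
  qed
  also have "\<dots> = (\<Sum>T\<in>?J. (of_int (sign ?c) * a ^ ?l) * (a ^ card T * of_int (sign (restrict_id w T))))"
  proof (rule sum.cong)
    fix T assume T: "T \<in> ?J"
    show "a ^ card (set cs \<union> T) * of_int (sign (restrict_id ?w (set cs \<union> T))) =
      (of_int (sign ?c) * a ^ ?l) * (a ^ card T * of_int (sign (restrict_id w T)))"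
      unfolding cT[OF T] r2[OF T] sign_compose[OF permutation_of_cycle pT[OF T]]
      by (simp add: power_add mult_ac)
  qed simp
  also have "\<dots> = - ((- a) ^ ?l) * inv_sum I w a"
    unfolding s inv_sum_def sum_distrib_left by (rule refl)
  also have "(\<Sum>T\<in>?J. a ^ card T * of_int (sign (restrict_id w T))) = inv_sum I w a"
    by (simp only: inv_sum_def)
  finally show ?case using ctype_cycle.IH by (simp add: algebra_simps)
qed

section \<open>Counting colourings\<close>

text \<open>Colourings by \<open>p\<close> colours that are constant on the cycles of \<open>w\<close>.\<close>

definition colorings :: "nat \<Rightarrow> 'b set \<Rightarrow> ('b \<Rightarrow> 'b) \<Rightarrow> ('b \<Rightarrow> nat) set" where
  "colorings p S w = {f \<in> S \<rightarrow>\<^sub>E {..<p}. \<forall>x\<in>S. f (w x) = f x}"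

lemma colorings_insert_fixed:
  assumes b: "b \<notin> S" and q: "q permutes S"
  shows "card (colorings p (insert b S) q) = p * card (colorings p S q)"
proof -
  have qb: "q b = b" by (rule permutes_not_in[OF q b])
  have qS: "q y \<in> S" if "y \<in> S" for y using permutes_in_image[OF q] that by simp
  have "bij_betw (\<lambda>(y, g). g(b := y)) ({..<p} \<times> colorings p S q) (colorings p (insert b S) q)"
  proof (rule bij_betw_byWitness[where f' = "\<lambda>f. (f b, f(b := undefined))"])
    show "\<forall>a\<in>{..<p} \<times> colorings p S q. (\<lambda>f. (f b, f(b := undefined))) (case a of (y, g) \<Rightarrow> g(b := y)) = a"
      using b by (auto simp: colorings_def PiE_def extensional_def fun_eq_iff)
    show "\<forall>a'\<in>colorings p (insert b S) q. (case (a' b, a'(b := undefined)) of (y, g) \<Rightarrow> g(b := y)) = a'"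
      by auto
    show "(\<lambda>(y, g). g(b := y)) ` ({..<p} \<times> colorings p S q) \<subseteq> colorings p (insert b S) q"
    proof (rule image_subsetI)
      fix z assume "z \<in> {..<p} \<times> colorings p S q"
      then obtain y g where z: "z = (y, g)" and y: "y \<in> {..<p}" and g: "g \<in> colorings p S q" by blast
      have "g(b := y) \<in> insert b S \<rightarrow>\<^sub>E {..<p}"
        using g y by (intro PiE_fun_upd) (auto simp: colorings_def)
      moreover have "(g(b := y)) (q z) = (g(b := y)) z" if "z \<in> insert b S" for z
      proof (cases "z = b")
        case False
        then have "z \<in> S" using that by simp
        then show ?thesis using g b qS[of z] by (auto simp: colorings_def)
      qed (use qb in simp)
      ultimately show "(case z of (y, g) \<Rightarrow> g(b := y)) \<in> colorings p (insert b S) q"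
        unfolding colorings_def z by simp
    qed
    show "(\<lambda>f. (f b, f(b := undefined))) ` colorings p (insert b S) q \<subseteq> {..<p} \<times> colorings p S q"
    proof (intro image_subsetI SigmaI)
      fix f assume f: "f \<in> colorings p (insert b S) q"
      show "f b \<in> {..<p}" using f by (auto simp: colorings_def PiE_def)
      have "f(b := undefined) \<in> S \<rightarrow>\<^sub>E {..<p}"
        using f by (intro fun_upd_in_PiE[OF b]) (auto simp: colorings_def)
      moreover have "(f(b := undefined)) (q z) = (f(b := undefined)) z" if "z \<in> S" for z
        using f b qS[of z] that by (auto simp: colorings_def)
      ultimately show "f(b := undefined) \<in> colorings p S q" unfolding colorings_def by blast
    qed
  qed
  from bij_betw_same_card[OF this] show ?thesis by (simp add: card_cartesian_product)
qed

text \<open>The new point \<open>b\<close> is inserted into the cycle of \<open>x\<close> and must have the same colour.\<close>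

lemma colorings_insert_transpose:
  assumes b: "b \<notin> S" and x: "x \<in> S" and q: "q permutes S"
  shows "card (colorings p (insert b S) (transpose b x \<circ> q)) = card (colorings p S q)"
proof -
  let ?w = "transpose b x \<circ> q"
  have qb: "q b = b" by (rule permutes_not_in[OF q b])
  have qS: "q y \<in> S" if "y \<in> S" for y using permutes_in_image[OF q] that by simp
  have xb: "x \<noteq> b" using x b by auto
  have fx: "f b = f x" if f: "f \<in> colorings p (insert b S) ?w" for f
  proof -
    have "f (?w b) = f b" using f by (simp add: colorings_def)
    then show ?thesis by (simp add: qb)
  qed
  have tr: "f (transpose b x y) = f y" if "f b = f x" for f :: "'a \<Rightarrow> nat" and y
    using that by (simp add: transpose_def)
  have "bij_betw (\<lambda>g. g(b := g x)) (colorings p S q) (colorings p (insert b S) ?w)"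
  proof (rule bij_betw_byWitness[where f' = "\<lambda>f. f(b := undefined)"])
    show "\<forall>a\<in>colorings p S q. (a(b := a x))(b := undefined) = a"
      using b by (auto simp: colorings_def PiE_def extensional_def fun_eq_iff)
    show "\<forall>a'\<in>colorings p (insert b S) ?w. (a'(b := undefined))(b := (a'(b := undefined)) x) = a'"
    proof
      fix f assume "f \<in> colorings p (insert b S) ?w"
      then have "f b = f x" by (rule fx)
      then show "(f(b := undefined))(b := (f(b := undefined)) x) = f" using xb by auto
    qed
    show "(\<lambda>g. g(b := g x)) ` colorings p S q \<subseteq> colorings p (insert b S) ?w"
    proof (rule image_subsetI)
      fix g assume g: "g \<in> colorings p S q"
      let ?g = "g(b := g x)"
      have "?g \<in> insert b S \<rightarrow>\<^sub>E {..<p}"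
        using g x by (intro PiE_fun_upd) (auto simp: colorings_def PiE_def)
      moreover have "?g (?w z) = ?g z" if z: "z \<in> insert b S" for z
      proof -
        have "?g (?w z) = ?g (q z)" using tr[of ?g "q z"] xb by simp
        also have "\<dots> = ?g z"
        proof (cases "z = b")
          case False
          then have "z \<in> S" using z by simp
          then show ?thesis using g b qS[of z] by (auto simp: colorings_def)
        qed (use qb in simp)
        finally show ?thesis .
      qed
      ultimately show "?g \<in> colorings p (insert b S) ?w" unfolding colorings_def by blast
    qed
    show "(\<lambda>f. f(b := undefined)) ` colorings p (insert b S) ?w \<subseteq> colorings p S q"
    proof (rule image_subsetI)
      fix f assume f: "f \<in> colorings p (insert b S) ?w"
      have "f(b := undefined) \<in> S \<rightarrow>\<^sub>E {..<p}"
        using f by (intro fun_upd_in_PiE[OF b]) (auto simp: colorings_def)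
      moreover have "(f(b := undefined)) (q z) = (f(b := undefined)) z" if z: "z \<in> S" for z
      proof -
        have "f (?w z) = f z" using f z by (simp add: colorings_def)
        then have "f (q z) = f z" using tr[OF fx[OF f], of "q z"] by simp
        then show ?thesis using b qS[OF z] z by auto
      qed
      ultimately show "f(b := undefined) \<in> colorings p S q" unfolding colorings_def by blast
    qed
  qed
  from bij_betw_same_card[OF this] show ?thesis by simp
qed

lemma colorings_cycle:
  assumes w: "w permutes I"
  shows "distinct cs \<Longrightarrow> cs \<noteq> [] \<Longrightarrow> set cs \<inter> I = {} \<Longrightarrow>
    card (colorings p (set cs \<union> I) (cycle_of_list cs \<circ> w)) = p * card (colorings p I w)"
proof (induction cs rule: cycle_of_list.induct)
  case (1 i j cs)
  let ?S = "set (j # cs) \<union> I" and ?q = "cycle_of_list (j # cs) \<circ> w"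
  have "cycle_of_list (j # cs) permutes ?S" by (rule permutes_subset[OF cycle_permutes]) auto
  moreover have "w permutes ?S" by (rule permutes_subset[OF w]) auto
  ultimately have q: "?q permutes ?S" by (rule permutes_compose[rotated])
  have e: "set (i # j # cs) \<union> I = insert i ?S" "cycle_of_list (i # j # cs) \<circ> w = transpose i j \<circ> ?q"
    by (auto simp only: cycle_of_list.simps comp_assoc set_simps Un_insert_left)
  have "card (colorings p (insert i ?S) (transpose i j \<circ> ?q)) = card (colorings p ?S ?q)"
    by (rule colorings_insert_transpose[OF _ _ q]) (use 1 in auto)
  moreover have "card (colorings p ?S ?q) = p * card (colorings p I w)"
    by (rule "1.IH") (use "1.prems" in auto)
  ultimately show ?case unfolding e by (rule trans)
next
  case ("2_2" i)
  then show ?case using colorings_insert_fixed[of i I w p] w by simp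
qed simp

lemma colorings_ctype: "ctype S w ls \<Longrightarrow> card (colorings p S w) = p ^ length ls"
proof (induction rule: ctype.induct)
  case ctype_empty
  have "colorings p {} (id :: 'a \<Rightarrow> 'a) = {\<lambda>_. undefined}" by (auto simp: colorings_def)
  then show ?case by (simp only: card.insert finite.emptyI) simp
next
  case (ctype_cycle I w ls cs)
  then have w: "w permutes I" using ctype_basic by blast
  show ?case unfolding colorings_cycle[OF w ctype_cycle.hyps(2,3,4)] using ctype_cycle.IH by simp
qed

section \<open>Signed sums over permutations with a stable subset\<close>

definition signed_sum :: "nat \<Rightarrow> 'b set \<Rightarrow> 'b set \<Rightarrow> real" where
  "signed_sum p S T = (\<Sum>w\<in>{w. w permutes S}. if w ` T = T
     then of_int (sign (restrict_id w T)) * real (card (colorings p S w)) else 0)"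

lemma transpose_image_fix: "b \<notin> A \<Longrightarrow> x \<notin> A \<Longrightarrow> transpose b x ` A = A"
  by (force simp: transpose_def image_iff)

text \<open>A permutation of \<open>S \<union> {b}\<close> arises from one of \<open>S\<close> by inserting \<open>b\<close> into the cycle of some \<open>x\<close> or, for \<open>x = b\<close>, as a
fixed point, with \<open>p\<close> possible colours. The set \<open>T\<close> remains stable iff \<open>x \<notin> T\<close>.\<close>

lemma signed_sum_insert_outside:
  assumes S: "finite S" and b: "b \<notin> S" and T: "T \<subseteq> S"
  shows "signed_sum p (insert b S) T = (real p + card (S - T)) * signed_sum p S T"
proof -
  let ?F = "\<lambda>w. if w ` T = T then of_int (sign (restrict_id w T)) * real (card (colorings p S w)) else 0"
  let ?c = "\<lambda>x. if x = b then real p else if x \<in> T then 0 else 1"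
  have bT: "b \<notin> T" using b T by auto
  have "signed_sum p (insert b S) T = (\<Sum>x\<in>insert b S. \<Sum>q\<in>{q. q permutes S}.
      if (transpose b x \<circ> q) ` T = T then of_int (sign (restrict_id (transpose b x \<circ> q) T)) *
        real (card (colorings p (insert b S) (transpose b x \<circ> q))) else 0)"
    unfolding signed_sum_def by (rule sum_over_permutations_insert[OF S b])
  also have "\<dots> = (\<Sum>x\<in>insert b S. \<Sum>q\<in>{q. q permutes S}. ?c x * ?F q)"
  proof (intro sum.cong refl)
    fix x q assume x: "x \<in> insert b S" and "q \<in> {q. q permutes S}"
    then have q: "q permutes S" by simp
    have im: "q ` T \<subseteq> S" using permutes_image[OF q] T by blast
    have card: "real (card (colorings p (insert b S) (transpose b x \<circ> q))) = (if x = b then real p else 1) * real (card (colorings p S q))"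
      using colorings_insert_fixed[OF b q, of p] colorings_insert_transpose[OF b _ q, of x p] x
      by (cases "x = b") simp_all
    have iff: "(transpose b x \<circ> q) ` T = T \<longleftrightarrow> q ` T = T \<and> x \<notin> T"
    proof (cases "x \<in> q ` T")
      case True
      then have "transpose b x x \<in> (transpose b x \<circ> q) ` T" unfolding image_comp[symmetric] by (rule imageI)
      then have "b \<in> (transpose b x \<circ> q) ` T" by simp
      then show ?thesis using bT True by blast
    next
      case False
      have "(transpose b x \<circ> q) ` T = q ` T"
        unfolding image_comp[symmetric] by (rule transpose_image_fix[OF _ False]) (use b im in auto)
      then show ?thesis using False by auto
    qed
    show "(if (transpose b x \<circ> q) ` T = T then of_int (sign (restrict_id (transpose b x \<circ> q) T)) *
        real (card (colorings p (insert b S) (transpose b x \<circ> q))) else 0) = ?c x * ?F q"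
    proof (cases "q ` T = T \<and> x \<notin> T")
      case True
      have "restrict_id (transpose b x \<circ> q) T = restrict_id q T"
      proof
        fix y show "restrict_id (transpose b x \<circ> q) T y = restrict_id q T y"
        proof (cases "y \<in> T")
          case yT: True
          then have "q y \<in> T" using True by blast
          then have "q y \<noteq> b" "q y \<noteq> x" using bT True by auto
          then show ?thesis using yT by simp
        qed simp
      qed
      then have r: "sign (restrict_id (transpose b x \<circ> q) T) = sign (restrict_id q T)" by (rule arg_cong)
      show ?thesis unfolding iff card r using True by simp
    next
      case False
      then show ?thesis unfolding iff using bT by auto
    qed
  qed
  also have "\<dots> = (\<Sum>x\<in>insert b S. ?c x) * signed_sum p S T"
    unfolding signed_sum_def sum_distrib_left[symmetric] sum_distrib_right[symmetric] by (rule refl)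
  also have "(\<Sum>x\<in>insert b S. ?c x) = real p + (\<Sum>x\<in>S. if x \<in> T then 0 else 1)"
    using S b by (subst sum.insert) (auto intro!: sum.cong)
  also have "(\<Sum>x\<in>S. if x \<in> T then 0 else 1) = (\<Sum>x\<in>S - T. (1 :: real))"
    by (rule sum.mono_neutral_cong_right) (use S in auto)
  finally show ?thesis by simp
qed

text \<open>The set \<open>T \<union> {b}\<close> is stable iff \<open>b\<close> is a fixed point or is inserted into a cycle contained in \<open>T\<close>; in the second
case the sign changes.\<close>

lemma signed_sum_insert_inside:
  assumes S: "finite S" and b: "b \<notin> S" and T: "T \<subseteq> S"
  shows "signed_sum p (insert b S) (insert b T) = (real p - card T) * signed_sum p S T"
proof -
  let ?F = "\<lambda>w. if w ` T = T then of_int (sign (restrict_id w T)) * real (card (colorings p S w)) else 0"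
  let ?c = "\<lambda>x. if x = b then real p else if x \<in> T then - 1 else 0"
  have bT: "b \<notin> T" using b T by auto
  have "signed_sum p (insert b S) (insert b T) = (\<Sum>x\<in>insert b S. \<Sum>q\<in>{q. q permutes S}.
      if (transpose b x \<circ> q) ` insert b T = insert b T then of_int (sign (restrict_id (transpose b x \<circ> q) (insert b T))) *
        real (card (colorings p (insert b S) (transpose b x \<circ> q))) else 0)"
    unfolding signed_sum_def by (rule sum_over_permutations_insert[OF S b])
  also have "\<dots> = (\<Sum>x\<in>insert b S. \<Sum>q\<in>{q. q permutes S}. ?c x * ?F q)"
  proof (intro sum.cong refl)
    fix x q assume x: "x \<in> insert b S" and "q \<in> {q. q permutes S}"
    then have q: "q permutes S" by simp
    have qb: "q b = b" by (rule permutes_not_in[OF q b])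
    have im: "q ` T \<subseteq> S" using permutes_image[OF q] T by blast
    have card: "real (card (colorings p (insert b S) (transpose b x \<circ> q))) = (if x = b then real p else 1) * real (card (colorings p S q))"
      using colorings_insert_fixed[OF b q, of p] colorings_insert_transpose[OF b _ q, of x p] x
      by (cases "x = b") simp_all
    have bq: "b \<notin> q ` T" using b im by auto
    have iq: "(transpose b x \<circ> q) ` insert b T = transpose b x ` insert b (q ` T)"
      unfolding image_comp[symmetric] by (simp add: qb)
    have iff: "(transpose b x \<circ> q) ` insert b T = insert b T \<longleftrightarrow> q ` T = T \<and> x \<in> insert b T"
    proof (cases "x \<in> insert b (q ` T)")
      case True
      then have "transpose b x ` insert b (q ` T) = insert b (q ` T)" by (intro transpose_image_eq) auto
      then show ?thesis unfolding iq using True bq bT by (metis insert_ident)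
    next
      case False
      then have "b \<notin> transpose b x ` insert b (q ` T)" by (auto simp: transpose_def split: if_splits)
      then show ?thesis unfolding iq using False by (metis insertI1)
    qed
    show "(if (transpose b x \<circ> q) ` insert b T = insert b T then of_int (sign (restrict_id (transpose b x \<circ> q) (insert b T))) *
        real (card (colorings p (insert b S) (transpose b x \<circ> q))) else 0) = ?c x * ?F q"
    proof (cases "q ` T = T \<and> x \<in> insert b T")
      case True
      have e: "restrict_id (transpose b x \<circ> q) (insert b T) = transpose b x \<circ> restrict_id q T"
      proof
        fix y show "restrict_id (transpose b x \<circ> q) (insert b T) y = (transpose b x \<circ> restrict_id q T) y"
          using True qb bT by (cases "y \<in> T"; cases "y = b") (auto simp: restrict_id_def transpose_def)
      qed
      have "bij_betw q T T" using inj_on_subset[OF permutes_inj[OF q]] True by (auto simp: bij_betw_def)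
      then have "restrict_id q T permutes T" by (rule permutes_restrict_id)
      then have "permutation (restrict_id q T)" using T S finite_subset permutation_permutes by blast
      then have "sign (restrict_id (transpose b x \<circ> q) (insert b T)) = sign (transpose b x) * sign (restrict_id q T)"
        unfolding e by (rule sign_compose[OF permutation_swap_id])
      then have r: "sign (restrict_id (transpose b x \<circ> q) (insert b T)) = (if x = b then 1 else - 1) * sign (restrict_id q T)"
        by (simp add: sign_swap_id)
      show ?thesis unfolding iff card r using True by auto
    next
      case False
      then show ?thesis unfolding iff using bT by auto
    qed
  qed
  also have "\<dots> = (\<Sum>x\<in>insert b S. ?c x) * signed_sum p S T"
    unfolding signed_sum_def sum_distrib_left[symmetric] sum_distrib_right[symmetric] by (rule refl)
  also have "(\<Sum>x\<in>insert b S. ?c x) = real p + (\<Sum>x\<in>S. if x \<in> T then - 1 else 0)"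
    using S b by (subst sum.insert) (auto intro!: sum.cong)
  also have "(\<Sum>x\<in>S. if x \<in> T then - 1 else 0) = (\<Sum>x\<in>T. (- 1 :: real))"
    by (rule sum.mono_neutral_cong_right) (use S T in auto)
  finally show ?thesis by simp
qed

lemma signed_sum_eq:
  "finite S \<Longrightarrow> T \<subseteq> S \<Longrightarrow> signed_sum p S T = (\<Prod>i<card T. real p - real i) * pochhammer (real p) (card (S - T))"
proof (induction S arbitrary: T rule: finite_induct)
  case empty
  have "colorings p {} (id :: 'a \<Rightarrow> 'a) = {\<lambda>_. undefined}" by (auto simp: colorings_def)
  moreover have "restrict_id (id :: 'a \<Rightarrow> 'a) {} = id" by (auto simp: restrict_id_def)
  ultimately show ?case using empty by (simp add: signed_sum_def id_def)
next
  case (insert b S)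
  show ?case
  proof (cases "b \<in> T")
    case True
    define U where "U = T - {b}"
    have U: "T = insert b U" "U \<subseteq> S" "b \<notin> U" using True insert.prems by (auto simp: U_def)
    have fU: "finite U" using U insert.hyps finite_subset by blast
    have "signed_sum p (insert b S) T = (real p - card U) * signed_sum p S U"
      unfolding U(1) by (rule signed_sum_insert_inside[OF insert.hyps U(2)])
    moreover have "insert b S - T = S - U" using insert.hyps U by auto
    ultimately show ?thesis using insert.IH[OF U(2)] fU U by simp
  next
    case False
    then have T: "T \<subseteq> S" using insert.prems by auto
    have "signed_sum p (insert b S) T = (real p + card (S - T)) * signed_sum p S T"
      by (rule signed_sum_insert_outside[OF insert.hyps T])
    moreover have "card (insert b S - T) = Suc (card (S - T))"
      using insert.hyps False by (simp add: insert_Diff_if)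
    ultimately show ?thesis using insert.IH[OF T] by (simp add: pochhammer_Suc)
  qed
qed

definition inv_coeff :: "'b set \<Rightarrow> ('b \<Rightarrow> 'b) \<Rightarrow> nat \<Rightarrow> int" where
  "inv_coeff S w k = (\<Sum>T\<in>{T. T \<subseteq> S \<and> card T = k}. if w ` T = T then sign (restrict_id w T) else 0)"

lemma inv_sum_eq_coeffs:
  assumes S: "finite S"
  shows "inv_sum S w a = (\<Sum>k\<le>card S. of_int (inv_coeff S w k) * a ^ k)"
proof -
  let ?f = "\<lambda>T. if w ` T = T then a ^ card T * of_int (sign (restrict_id w T)) else 0"
  have "inv_sum S w a = sum ?f (Pow S)"
    unfolding inv_sum_def using S by (intro sum.mono_neutral_cong_left) auto
  also have "\<dots> = (\<Sum>k\<le>card S. sum ?f {T \<in> Pow S. card T = k})"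
    by (rule sum.group[symmetric]) (use S card_mono in auto)
  also have "\<dots> = (\<Sum>k\<le>card S. of_int (inv_coeff S w k) * a ^ k)"
    unfolding inv_coeff_def of_int_sum sum_distrib_right
    by (intro sum.cong refl) (auto simp: mult.commute)
  finally show ?thesis .
qed

text \<open>Exchanging the sums, every \<open>k\<close>-element set \<open>T\<close> has the same contribution by \<open>signed_sum_eq\<close>.\<close>

lemma sum_inv_coeff:
  fixes S :: "'b set"
  assumes S: "finite S"
  shows "(\<Sum>w\<in>{w. w permutes S}. of_int (inv_coeff S w k) * real (card (colorings p S w))) =
    real (card S choose k) * (\<Prod>i<k. real p - real i) * pochhammer (real p) (card S - k)"
proof -
  let ?K = "{T. T \<subseteq> S \<and> card T = k}"
  have "(\<Sum>w\<in>{w. w permutes S}. of_int (inv_coeff S w k) * real (card (colorings p S w))) =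
    (\<Sum>w\<in>{w. w permutes S}. \<Sum>T\<in>?K. if w ` T = T then of_int (sign (restrict_id w T)) * real (card (colorings p S w)) else 0)"
    unfolding inv_coeff_def of_int_sum sum_distrib_right by (intro sum.cong refl) simp
  also have "\<dots> = (\<Sum>T\<in>?K. signed_sum p S T)"
    unfolding signed_sum_def by (rule sum.swap)
  also have "\<dots> = (\<Sum>T\<in>?K. (\<Prod>i<k. real p - real i) * pochhammer (real p) (card S - k))"
  proof (rule sum.cong)
    fix T assume "T \<in> ?K"
    then have T: "T \<subseteq> S" "card T = k" by auto
    then have "card (S - T) = card S - k" using S finite_subset by (subst card_Diff_subset) auto
    then show "signed_sum p S T = (\<Prod>i<k. real p - real i) * pochhammer (real p) (card S - k)"
      using signed_sum_eq[OF S T(1)] T(2) by simp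
  qed simp
  also have "\<dots> = real (card S choose k) * ((\<Prod>i<k. real p - real i) * pochhammer (real p) (card S - k))"
    by (simp add: n_subsets[OF S])
  finally show ?thesis by simp
qed

section \<open>Weighted compositions\<close>

definition comps_fps :: "real \<Rightarrow> nat \<Rightarrow> real fps" where
  "comps_fps y p = Abs_fps (\<lambda>n. \<Sum>m\<in>comps n p. wt y m)"

definition rising_fps :: "nat \<Rightarrow> real fps" where
  "rising_fps p = Abs_fps (\<lambda>m. pochhammer (real p) m / fact m)"

definition binom_fps :: "real \<Rightarrow> nat \<Rightarrow> real fps" where
  "binom_fps t p = Abs_fps (\<lambda>j. real (p choose j) * t ^ j)"

lemma comps_Suc: "comps n (Suc p) = (\<Union>a\<in>{0..n}. (#) a ` comps (n - a) p)"
proof (intro subset_antisym subsetI)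
  fix m assume m: "m \<in> comps n (Suc p)"
  then obtain a r where "m = a # r" by (cases m) (auto simp: comps_def)
  then show "m \<in> (\<Union>a\<in>{0..n}. (#) a ` comps (n - a) p)" using m by (intro UN_I[of a]) (auto simp: comps_def)
qed (auto simp: comps_def)

text \<open>The first part is zero, with weight \<open>1\<close>, or positive, with weight \<open>y\<close>.\<close>

lemma comps_fps_Suc:
  "comps_fps y (Suc p) = Abs_fps (\<lambda>a. if a = 0 then 1 else y) * comps_fps y p"
proof (rule fps_ext)
  fix n
  have "(\<Sum>m\<in>comps n (Suc p). wt y m) = (\<Sum>a\<in>{0..n}. \<Sum>m\<in>(#) a ` comps (n - a) p. wt y m)"
    unfolding comps_Suc
  proof (rule sum.UNION_disjoint)
    show "\<forall>a\<in>{0..n}. finite ((#) a ` comps (n - a) p)"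
      using finite_compositions by (auto simp: comps_def)
  qed auto
  also have "\<dots> = (\<Sum>a\<in>{0..n}. (if a = 0 then 1 else y) * (\<Sum>m\<in>comps (n - a) p. wt y m))"
    by (intro sum.cong refl) (auto simp: sum.reindex wt_def sum_distrib_left intro!: sum.cong)
  finally show "fps_nth (comps_fps y (Suc p)) n =
    fps_nth (Abs_fps (\<lambda>a. if a = 0 then 1 else y) * comps_fps y p) n"
    by (simp only: comps_fps_def fps_mult_nth fps_nth_Abs_fps)
qed

lemma one_minus_X_nth: "fps_nth ((1 - fps_X) * f) n = fps_nth f n - (if n = 0 then 0 else fps_nth f (n - 1))"
  for f :: "real fps"
  by (simp only: left_diff_distrib distrib_right mult_1 mult.assoc fps_sub_nth fps_add_nth fps_mult_left_const_nth fps_X_mult_nth)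

lemma one_plus_X_nth: "fps_nth ((1 + fps_const t * fps_X) * f) n = fps_nth f n + (if n = 0 then 0 else t * fps_nth f (n - 1))"
  for f :: "real fps"
  by (simp only: left_diff_distrib distrib_right mult_1 mult.assoc fps_sub_nth fps_add_nth fps_mult_left_const_nth fps_X_mult_nth) simp

lemma step_fps: "(1 - fps_X) * Abs_fps (\<lambda>a. if a = 0 then 1 else 1 + t) = 1 + fps_const t * (fps_X :: real fps)"
  by (rule fps_ext) (auto simp: one_minus_X_nth)

lemma rising_fps_Suc: "(1 - fps_X) * rising_fps (Suc p) = rising_fps p"
proof (rule fps_ext)
  fix n show "fps_nth ((1 - fps_X) * rising_fps (Suc p)) n = fps_nth (rising_fps p) n"
  proof (cases n)
    case (Suc m)
    have "pochhammer (real (Suc p)) (Suc m) / fact (Suc m) - pochhammer (real (Suc p)) m / fact m =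
      real p * pochhammer (real p + 1) m / fact (Suc m)"
    proof -
      have "pochhammer (real (Suc p)) m / fact m = pochhammer (real (Suc p)) m * real (Suc m) / fact (Suc m)"
        by simp
      then show ?thesis by (simp add: pochhammer_Suc diff_divide_distrib[symmetric] algebra_simps del: fact_Suc)
    qed
    also have "\<dots> = pochhammer (real p) (Suc m) / fact (Suc m)"
      by (simp add: pochhammer_rec)
    finally show ?thesis using Suc by (simp add: one_minus_X_nth rising_fps_def del: fact_Suc)
  qed (simp add: one_minus_X_nth rising_fps_def)
qed

lemma binom_fps_Suc: "binom_fps t (Suc p) = (1 + fps_const t * fps_X) * binom_fps t p"
proof (rule fps_ext)
  fix n show "fps_nth (binom_fps t (Suc p)) n = fps_nth ((1 + fps_const t * fps_X) * binom_fps t p) n"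
    by (cases n) (simp_all add: one_plus_X_nth binom_fps_def algebra_simps)
qed

text \<open>For one part the generating function is \<open>1 + (1 + t) X / (1 - X) = (1 + t X) / (1 - X)\<close>; the two factors on the right
are the \<open>p\<close>-th powers of the numerator and of \<open>1 / (1 - X)\<close>.\<close>

lemma comps_fps_eq: "comps_fps (1 + t) p = binom_fps t p * rising_fps p"
proof (induction p)
  case 0
  have "comps n 0 = (if n = 0 then {[]} else {})" for n by (auto simp: comps_def)
  then have "comps_fps (1 + t) 0 = 1" by (intro fps_ext) (simp add: comps_fps_def wt_def)
  moreover have "binom_fps t 0 = 1" by (intro fps_ext) (simp add: binom_fps_def)
  moreover have "rising_fps 0 = 1" by (intro fps_ext) (simp add: rising_fps_def pochhammer_0_left)
  ultimately show ?case by simp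
next
  case (Suc p)
  have "(1 - fps_X) * comps_fps (1 + t) (Suc p) = (1 + fps_const t * fps_X) * comps_fps (1 + t) p"
    unfolding comps_fps_Suc mult.assoc[symmetric] step_fps ..
  also have "\<dots> = binom_fps t (Suc p) * ((1 - fps_X) * rising_fps (Suc p))"
    unfolding Suc rising_fps_Suc binom_fps_Suc by (simp add: mult.assoc)
  also have "\<dots> = (1 - fps_X) * (binom_fps t (Suc p) * rising_fps (Suc p))"
    by (simp add: mult_ac)
  finally have "(1 - fps_X) * comps_fps (1 + t) (Suc p) = (1 - fps_X) * (binom_fps t (Suc p) * rising_fps (Suc p))" .
  moreover have "1 - fps_X \<noteq> (0 :: real fps)"
  proof
    assume "1 - fps_X = (0 :: real fps)"
    then have "fps_nth (1 - fps_X :: real fps) 0 = 0" by simp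
    then show False by simp
  qed
  ultimately show ?case by (metis mult_cancel_left)
qed

lemma sum_comps_wt:
  "(\<Sum>m\<in>comps n p. wt (1 + t) m) =
    (\<Sum>i\<le>n. t ^ i * (real (n choose i) * (\<Prod>j<i. real p - real j) * pochhammer (real p) (n - i)) / fact n)"
proof -
  have "(\<Sum>m\<in>comps n p. wt (1 + t) m) = fps_nth (binom_fps t p * rising_fps p) n"
    unfolding comps_fps_eq[symmetric] by (simp add: comps_fps_def)
  also have "\<dots> = (\<Sum>i\<le>n. real (p choose i) * t ^ i * (pochhammer (real p) (n - i) / fact (n - i)))"
    by (simp add: fps_mult_nth binom_fps_def rising_fps_def atLeast0AtMost)
  also have "\<dots> = (\<Sum>i\<le>n. t ^ i * (real (n choose i) * (\<Prod>j<i. real p - real j) * pochhammer (real p) (n - i)) / fact n)"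
  proof (rule sum.cong)
    fix i assume "i \<in> {..n}"
    then have i: "i \<le> n" by simp
    have "(\<Prod>j<i. real p - real j) = real (p choose i) * fact i"
      by (simp add: binomial_gbinomial gbinomial_prod_rev atLeast0LessThan)
    moreover have "real (n choose i) = fact n / (fact i * fact (n - i))" by (rule binomial_fact[OF i])
    ultimately show "real (p choose i) * t ^ i * (pochhammer (real p) (n - i) / fact (n - i)) =
      t ^ i * (real (n choose i) * (\<Prod>j<i. real p - real j) * pochhammer (real p) (n - i)) / fact n"
      by (simp add: field_simps)
  qed simp
  finally show ?thesis .
qed

section \<open>Quotients of determinants\<close>

text \<open>The polynomial \<open>(1 - x ^ (l p)) / (1 - x ^ l)\<close>.\<close>

definition q_int :: "nat \<Rightarrow> nat \<Rightarrow> real poly" where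
  "q_int p l = (\<Sum>i<p. monom 1 (l * i))"

lemma q_int_mult: "(1 - monom 1 l) * q_int p l = 1 - monom 1 (l * p)"
proof -
  have "q_int p l = (\<Sum>i<p. monom 1 l ^ i)" by (simp add: q_int_def monom_power)
  then show ?thesis using one_diff_power_eq[of "monom 1 l :: real poly" p] by (simp add: monom_power mult.commute)
qed

lemma poly_q_int_1: "poly (q_int p l) 1 = real p"
  by (simp add: q_int_def poly_sum poly_monom)

lemma q_int_dvd_diff: "q_int p 1 dvd 1 - monom 1 (p * l)"
proof -
  have "q_int p 1 dvd 1 - monom 1 p" using q_int_mult[of 1 p] by (metis dvd_triv_right mult_1)
  moreover have "1 - monom 1 p dvd (1 - monom 1 (p * l) :: real poly)"
    using q_int_mult[of p l] by (metis dvd_triv_left)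
  ultimately show ?thesis by (rule dvd_trans)
qed

text \<open>Let \<open>f = q_int p 1\<close> and let \<open>Y\<close> be the product. The exponents \<open>k\<close> with \<open>f dvd Y (1 - x ^ k)\<close> are closed under addition
and subtraction and contain \<open>p\<close> and all \<open>l\<close>, because \<open>f\<close> divides \<open>1 - x ^ (p l)\<close>. By Bezout's identity, \<open>1\<close> is such an exponent
too. Finally \<open>1 - x\<close> divides \<open>p - f\<close>, whence \<open>f dvd p Y\<close>.\<close>

lemma q_int_dvd_prod:
  assumes p: "0 < p" and cop: "coprime p (sum_list ls)"
  shows "q_int p 1 dvd (\<Prod>l\<leftarrow>ls. q_int p l)"
proof -
  let ?f = "q_int p 1" and ?Y = "\<Prod>l\<leftarrow>ls. q_int p l"
  have add: "?f dvd ?Y * (1 - monom 1 (a + b))" if "?f dvd ?Y * (1 - monom 1 a)" "?f dvd ?Y * (1 - monom 1 b)" for a b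
  proof -
    have "?Y * (1 - monom 1 (a + b)) = ?Y * (1 - monom 1 a) + monom 1 a * (?Y * (1 - monom 1 b))"
      by (simp add: algebra_simps mult_monom)
    then show ?thesis using that by (metis dvd_add dvd_mult)
  qed
  have zero: "?f dvd ?Y * (1 - monom 1 0)" by (simp add: monom_0 flip: one_pCons)
  have mul: "?f dvd ?Y * (1 - monom 1 (a * k))" if "?f dvd ?Y * (1 - monom 1 a)" for a k
    using zero add[OF that] by (induction k) auto
  have part: "?f dvd ?Y * (1 - monom 1 l)" if l: "l \<in> set ls" for l
  proof -
    obtain xs ys where ls: "ls = xs @ l # ys" using split_list[OF l] by blast
    then have "?Y * (1 - monom 1 l) = ((1 - monom 1 l) * q_int p l) * (\<Prod>x\<leftarrow>xs @ ys. q_int p x)"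
      by (simp add: mult_ac)
    also have "(1 - monom 1 l) * q_int p l = 1 - monom 1 (p * l)" by (simp only: q_int_mult mult.commute[of p l])
    finally show ?thesis using q_int_dvd_diff[of p l] by (metis dvd_mult2)
  qed
  have "?f dvd ?Y * (1 - monom 1 (sum_list xs))" if "set xs \<subseteq> set ls" for xs
    using that zero part add by (induction xs) auto
  then have sum: "?f dvd ?Y * (1 - monom 1 (sum_list ls))" by simp
  have pp: "?f dvd ?Y * (1 - monom 1 p)" using q_int_dvd_diff[of p 1] by simp
  obtain x y where xy: "p * x = sum_list ls * y + 1"
    using bezout_nat[of p "sum_list ls"] p cop by auto
  define k where "k = sum_list ls * y"
  have k: "?f dvd ?Y * (1 - monom 1 k)" unfolding k_def by (rule mul[OF sum])
  have k1: "?f dvd ?Y * (1 - monom 1 (k + 1))" using mul[OF pp, of x] by (simp add: xy k_def)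
  have e: "?Y * (1 - monom 1 1) = ?Y * (1 - monom 1 (k + 1)) - monom 1 1 * (?Y * (1 - monom 1 k))"
    by (simp add: algebra_simps mult_monom)
  have one: "?f dvd ?Y * (1 - monom 1 1)" unfolding e by (rule dvd_diff[OF k1 dvd_mult[OF k]])
  have "[:- 1, 1:] dvd [:real p:] - ?f" by (simp add: dvd_iff_poly_eq_0 poly_q_int_1)
  then obtain r where r: "[:real p:] - ?f = [:- 1, 1:] * r" by (elim dvdE)
  have m: "[:- 1, 1:] = - (1 - monom 1 1 :: real poly)" by (simp add: monom_altdef one_pCons)
  have "smult (real p) ?Y = ?Y * ?f + ?Y * ([:real p:] - ?f)" by (simp add: algebra_simps)
  also have "\<dots> = ?f * ?Y + ?Y * (1 - monom 1 1) * (- r)" unfolding r m by (simp add: algebra_simps)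
  finally have "?f dvd smult (real p) ?Y" using one by (metis dvd_add dvd_mult2 dvd_triv_left)
  then show ?thesis using p by (simp add: dvd_smult_iff)
qed

lemma poly_prod_q_int_1: "poly (\<Prod>l\<leftarrow>ls. q_int p l) 1 = real p ^ length ls"
  by (induction ls) (simp_all add: poly_q_int_1)

lemma to_fract_of_nat: "to_fract (of_nat m) = of_nat m"
  by (induction m) simp_all

lemma to_fract_of_int: "to_fract (of_int m) = of_int m"
  by (cases m) (simp_all add: to_fract_of_nat)

lemma to_fract_power: "to_fract (a ^ m) = to_fract a ^ m"
  by (induction m) simp_all

lemma to_fract_sum: "to_fract (sum f A) = (\<Sum>x\<in>A. to_fract (f x))"
  by (induction A rule: infinite_finite_induct) simp_all

lemma to_fract_prod_list: "to_fract (prod_list (map f xs)) = (\<Prod>x\<leftarrow>xs. to_fract (f x))"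
  by (induction xs) simp_all

lemma ratfun_x_power: "ratfun_x ^ l = to_fract (monom 1 l)"
  by (simp add: ratfun_x_def monom_altdef to_fract_power)

text \<open>Both determinants are products over the cycles, up to the factors \<open>1 - x ^ p\<close> and \<open>1 - x\<close>; so the quotient is
\<open>\<Prod> q_int p l / q_int p 1\<close>, which is \<open>p ^ (c - 1)\<close> at \<open>x = 1\<close> for \<open>c\<close> cycles.\<close>

lemma det_quotient:
  assumes n: "1 \<le> n" and p: "0 < p" and cop: "coprime p n" and w: "w permutes {1..n}"
  obtains Q where "det_dual n (- (ratfun_x ^ p)) w / det_dual n (- ratfun_x) w = to_fract Q"
    and "real p * poly Q 1 = real (card (colorings p {0..<n} (lower n w)))"
proof -
  let ?v = "lower n w"
  obtain ls where ls: "ctype {0..<n} ?v ls" using ctype_exists[OF lower_permutes[OF w]] by auto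
  have pos: "\<forall>l\<in>set ls. 0 < l" and sum: "sum_list ls = n" using ctype_basic[OF ls] by auto
  let ?Y = "\<Prod>l\<leftarrow>ls. q_int p l" and ?D = "\<Prod>l\<leftarrow>ls. 1 - monom 1 l :: real poly"
  obtain Q where Q: "?Y = q_int p 1 * Q" using q_int_dvd_prod[OF p, of ls] cop sum by (auto elim: dvdE)
  have d1: "(1 - ratfun_x) * det_dual n (- ratfun_x) w = to_fract ?D"
  proof -
    have "(1 + - ratfun_x) * det_dual n (- ratfun_x) w = (\<Prod>l\<leftarrow>ls. 1 - (- (- ratfun_x)) ^ l)"
      by (subst det_dual_eq[OF n w]) (rule inv_sum_ctype[OF ls])
    then show ?thesis by (simp add: to_fract_prod_list ratfun_x_power)
  qed
  have d2: "(1 - ratfun_x ^ p) * det_dual n (- (ratfun_x ^ p)) w = to_fract (?D * ?Y)"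
  proof -
    have "(1 + - (ratfun_x ^ p)) * det_dual n (- (ratfun_x ^ p)) w = (\<Prod>l\<leftarrow>ls. 1 - (- (- (ratfun_x ^ p))) ^ l)"
      by (subst det_dual_eq[OF n w]) (rule inv_sum_ctype[OF ls])
    also have "\<dots> = to_fract (\<Prod>l\<leftarrow>ls. (1 - monom 1 l) * q_int p l)"
      unfolding q_int_mult to_fract_prod_list minus_minus power_mult[symmetric]
      by (simp add: ratfun_x_power mult.commute)
    also have "(\<Prod>l\<leftarrow>ls. (1 - monom 1 l) * q_int p l) = ?D * ?Y"
      by (induction ls) (simp_all add: mult_ac)
    finally show ?thesis by simp
  qed
  have m0: "1 - monom 1 l \<noteq> (0 :: real poly)" if "0 < l" for l
  proof
    assume "1 - monom 1 l = (0 :: real poly)"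
    then have "poly (1 - monom 1 l :: real poly) 0 = 0" by simp
    then show False using that by (simp add: poly_monom zero_power)
  qed
  have D0: "?D \<noteq> 0" using pos m0 by (auto simp: prod_list_zero_iff)
  have s: "1 - ratfun_x ^ p = (1 - ratfun_x) * to_fract (q_int p 1)"
    using arg_cong[OF q_int_mult[of 1 p], of to_fract] ratfun_x_power[of 1] by (simp add: ratfun_x_power)
  have x0: "1 - ratfun_x ^ p \<noteq> 0"
  proof -
    have "1 - ratfun_x ^ p = to_fract (1 - monom 1 p)" by (simp add: ratfun_x_power)
    then show ?thesis using m0[OF p] by (simp only: to_fract_eq_0_iff) simp
  qed
  have "(1 - ratfun_x ^ p) * det_dual n (- (ratfun_x ^ p)) w = to_fract ?D * (to_fract (q_int p 1) * to_fract Q)"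
    by (simp only: d2 Q to_fract_mult)
  also have "\<dots> = (1 - ratfun_x) * det_dual n (- ratfun_x) w * (to_fract (q_int p 1) * to_fract Q)"
    by (simp only: d1)
  also have "\<dots> = (1 - ratfun_x ^ p) * (det_dual n (- ratfun_x) w * to_fract Q)"
    unfolding s by (simp only: mult_ac)
  finally have "(1 - ratfun_x ^ p) * det_dual n (- (ratfun_x ^ p)) w =
      (1 - ratfun_x ^ p) * (det_dual n (- ratfun_x) w * to_fract Q)" .
  then have "det_dual n (- (ratfun_x ^ p)) w = det_dual n (- ratfun_x) w * to_fract Q"
    using x0 by (metis mult_cancel_left)
  moreover have "det_dual n (- ratfun_x) w \<noteq> 0" using d1 D0 by auto
  ultimately have r: "det_dual n (- (ratfun_x ^ p)) w / det_dual n (- ratfun_x) w = to_fract Q" by simp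
  have "real p * poly Q 1 = poly ?Y 1" unfolding Q by (simp add: poly_q_int_1)
  then have "real p * poly Q 1 = real (card (colorings p {0..<n} ?v))"
    unfolding poly_prod_q_int_1 colorings_ctype[OF ls] by simp
  with r show ?thesis by (rule that)
qed

section \<open>Kirkman numbers as sums over permutations\<close>

text \<open>The coefficients of \<open>(\<Sum>k. inv_coeff {0..<n} v k \<cdot> a ^ k) / (1 + a)\<close>.\<close>

primrec det_coeff :: "nat \<Rightarrow> (nat \<Rightarrow> nat) \<Rightarrow> nat \<Rightarrow> int" where
  "det_coeff n v 0 = inv_coeff {0..<n} v 0"
| "det_coeff n v (Suc k) = inv_coeff {0..<n} v (Suc k) - det_coeff n v k"

lemma coeff_det_dual:
  fixes w :: "nat \<Rightarrow> nat"
  assumes n: "1 \<le> n" and w: "w permutes {1..n}"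
  shows "k \<le> n \<Longrightarrow> coeff (det_dual n [:0, 1 :: 'a :: idom:] w) k = of_int (det_coeff n (lower n w) k)"
proof -
  let ?D = "det_dual n [:0, 1 :: 'a:] w" and ?v = "lower n w"
  have "(1 + [:0, 1:]) * ?D = (\<Sum>k\<le>n. of_int (inv_coeff {0..<n} ?v k) * [:0, 1:] ^ k)"
    unfolding det_dual_eq[OF n w] by (subst inv_sum_eq_coeffs) simp_all
  also have "\<dots> = (\<Sum>k\<le>n. monom (of_int (inv_coeff {0..<n} ?v k)) k)"
    by (simp add: monom_altdef of_int_poly)
  finally have eq: "[:1, 1:] * ?D = (\<Sum>k\<le>n. monom (of_int (inv_coeff {0..<n} ?v k)) k)"
    by (simp add: one_pCons)
  have c: "coeff (\<Sum>k\<le>n. monom (of_int (inv_coeff {0..<n} ?v k) :: 'a) k) j = of_int (inv_coeff {0..<n} ?v j)" if "j \<le> n" for j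
    using that by (simp add: coeff_sum)
  show "k \<le> n \<Longrightarrow> coeff ?D k = of_int (det_coeff n ?v k)"
  proof (induction k)
    case 0
    then show ?case using c[of 0] unfolding eq[symmetric] by simp
  next
    case (Suc k)
    then show ?case using c[of "Suc k"] unfolding eq[symmetric] by (simp add: eq_diff_eq)
  qed
qed

lemma bij_lower: "bij_betw (lower n) (sym_group n) {v. v permutes {0..<n}}"
proof (rule bij_betw_byWitness[where f' = "\<lambda>v i. if i \<in> {1..n} then Suc (v (i - 1)) else i"])
  show "\<forall>w\<in>sym_group n. (\<lambda>i. if i \<in> {1..n} then Suc (lower n w (i - 1)) else i) = w"
  proof (intro ballI ext)
    fix w i assume "w \<in> sym_group n"
    then have w: "w permutes {1..n}" by (simp add: sym_group_def)
    show "(if i \<in> {1..n} then Suc (lower n w (i - 1)) else i) = w i"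
      using lower_Suc(1)[OF w, of "i - 1"] permutes_not_in[OF w, of i] by auto
  qed
  show "\<forall>v\<in>{v. v permutes {0..<n}}. lower n (\<lambda>i. if i \<in> {1..n} then Suc (v (i - 1)) else i) = v"
  proof (intro ballI ext)
    fix v i assume "v \<in> {v. v permutes {0..<n}}"
    then have v: "v permutes {0..<n}" by simp
    show "lower n (\<lambda>i. if i \<in> {1..n} then Suc (v (i - 1)) else i) i = v i"
      using permutes_not_in[OF v, of i] by (auto simp: lower_def)
  qed
  show "lower n ` sym_group n \<subseteq> {v. v permutes {0..<n}}"
    using lower_permutes by (auto simp: sym_group_def)
  show "(\<lambda>v i. if i \<in> {1..n} then Suc (v (i - 1)) else i) ` {v. v permutes {0..<n}} \<subseteq> sym_group n"
  proof (rule image_subsetI)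
    fix v assume "v \<in> {v. v permutes {0..<n}}"
    then have v: "v permutes {0..<n}" by simp
    let ?w = "\<lambda>i. if i \<in> {1..n} then Suc (v (i - 1)) else i"
    have lt: "v j < n \<longleftrightarrow> j < n" for j using permutes_in_image[OF v, of j] by simp
    have "inj_on ?w {1..n}"
    proof (rule inj_onI)
      fix x y assume xy: "x \<in> {1..n}" "y \<in> {1..n}" "?w x = ?w y"
      then have "v (x - 1) = v (y - 1)" by simp
      then have "x - 1 = y - 1" using permutes_inj[OF v] by (simp only: inj_eq)
      then show "x = y" using xy(1,2) by auto
    qed
    moreover have "?w ` {1..n} \<subseteq> {1..n}"
    proof (rule image_subsetI)
      fix x assume x: "x \<in> {1..n}"
      then have "v (x - 1) < n" using lt[of "x - 1"] by auto
      then show "?w x \<in> {1..n}" using x by simp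
    qed
    ultimately have "bij_betw ?w {1..n} {1..n}"
      unfolding bij_betw_def using endo_inj_surj[of "{1..n}" ?w] by blast
    then have "?w permutes {1..n}" by (rule bij_imp_permutes) auto
    then show "?w \<in> sym_group n" by (simp only: sym_group_def mem_Collect_eq)
  qed
qed

lemma kirk_number_eq:
  assumes n: "1 \<le> n" and p: "0 < p" and cop: "coprime p n" and k: "k \<le> n"
  shows "real p * fact n * kirk_number n p k =
    (\<Sum>v\<in>{v. v permutes {0..<n}}. of_int (det_coeff n v k) * real (card (colorings p {0..<n} v)))"
proof -
  have "\<forall>w\<in>sym_group n. \<exists>Q. det_dual n (- (ratfun_x ^ p)) w / det_dual n (- ratfun_x) w = to_fract Q \<and>
     real p * poly Q 1 = real (card (colorings p {0..<n} (lower n w)))"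
    using det_quotient[OF n p cop] unfolding sym_group_def by blast
  then obtain Q where Q: "\<And>w. w \<in> sym_group n \<Longrightarrow> det_dual n (- (ratfun_x ^ p)) w / det_dual n (- ratfun_x) w = to_fract (Q w)"
    "\<And>w. w \<in> sym_group n \<Longrightarrow> real p * poly (Q w) 1 = real (card (colorings p {0..<n} (lower n w)))"
    unfolding bchoice_iff by blast
  define P where "P = smult (1 / fact n) (\<Sum>w\<in>sym_group n. of_int (det_coeff n (lower n w) k) * Q w)"
  have inv: "1 / of_nat (fact n) = to_fract [:1 / fact n :: real:]"
  proof -
    have "to_fract [:1 / fact n :: real:] * of_nat (fact n) = to_fract ([:1 / fact n :: real:] * of_nat (fact n))"
      by (simp only: to_fract_mult to_fract_of_nat)
    also have "[:1 / fact n :: real:] * of_nat (fact n) = 1" by (simp add: of_nat_poly one_pCons)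
    finally have "to_fract [:1 / fact n :: real:] * of_nat (fact n) = 1" by simp
    then show ?thesis by (simp add: field_simps)
  qed
  have "coeff (kirk_gen n p) k = (1 / of_nat (fact n)) *
     (\<Sum>w\<in>sym_group n. to_fract (Q w) * of_int (det_coeff n (lower n w) k))"
    unfolding kirk_gen_def coeff_smult coeff_sum
    by (intro arg_cong2[where f = "(*)"] refl sum.cong) (auto simp: Q(1) coeff_det_dual[OF n _ k] sym_group_def)
  also have "\<dots> = to_fract ([:1 / fact n:] * (\<Sum>w\<in>sym_group n. of_int (det_coeff n (lower n w) k) * Q w))"
    unfolding inv by (simp only: to_fract_mult to_fract_sum to_fract_of_int mult.commute)
  finally have c: "coeff (kirk_gen n p) k = to_fract P" by (simp add: P_def)
  have "kirk_poly n p k = P" unfolding kirk_poly_def c by (rule the_equality) auto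
  then have "real p * fact n * kirk_number n p k =
      (\<Sum>w\<in>sym_group n. of_int (det_coeff n (lower n w) k) * (real p * poly (Q w) 1))"
    by (simp add: kirk_number_def P_def poly_sum of_int_poly sum_distrib_left mult_ac)
  also have "\<dots> = (\<Sum>w\<in>sym_group n. of_int (det_coeff n (lower n w) k) * real (card (colorings p {0..<n} (lower n w))))"
    by (rule sum.cong) (simp_all add: Q(2))
  also have "\<dots> = (\<Sum>v\<in>{v. v permutes {0..<n}}. of_int (det_coeff n v k) * real (card (colorings p {0..<n} v)))"
    by (rule sum.reindex_bij_betw[OF bij_lower])
  finally show ?thesis .
qed

definition kirk_sum :: "nat \<Rightarrow> nat \<Rightarrow> nat \<Rightarrow> real" where
  "kirk_sum n p k = real (n choose k) * (\<Prod>i<k. real p - real i) * pochhammer (real p) (n - k)"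

lemma kirk_number_0:
  assumes "1 \<le> n" "0 < p" "coprime p n"
  shows "real p * fact n * kirk_number n p 0 = kirk_sum n p 0"
  using sum_inv_coeff[of "{0..<n}" 0 p] kirk_number_eq[OF assms, of 0]
  unfolding kirk_sum_def by simp

text \<open>The sum of neighbouring coefficients undoes the division by \<open>1 + a\<close>.\<close>

lemma kirk_number_Suc:
  assumes "1 \<le> n" "0 < p" "coprime p n" "Suc k \<le> n"
  shows "real p * fact n * (kirk_number n p (Suc k) + kirk_number n p k) = kirk_sum n p (Suc k)"
proof -
  have "real p * fact n * (kirk_number n p (Suc k) + kirk_number n p k) =
    (\<Sum>v\<in>{v. v permutes {0..<n}}. of_int (inv_coeff {0..<n} v (Suc k)) * real (card (colorings p {0..<n} v)))"
    unfolding ring_distribs kirk_number_eq[OF assms(1-3) assms(4)] kirk_number_eq[OF assms(1-3) Suc_leD[OF assms(4)]]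
      sum.distrib[symmetric]
    by (rule sum.cong) (simp_all add: algebra_simps)
  then show ?thesis unfolding kirk_sum_def using sum_inv_coeff[of "{0..<n}" "Suc k" p] by simp
qed

section \<open>Comparison of the two generating functions\<close>

lemma coxeter_word_letters:
  assumes "coxeter_word n c"
  obtains xs where "c = map simple_refl xs" "distinct xs" "set xs = {1..<n}"
proof -
  have c: "distinct c" "set c = simple_refl ` {1..<n}"
    using assms by (auto simp: coxeter_word_def simple_refls_def)
  then have "c \<in> lists (simple_refl ` {1..<n})" by (simp add: in_lists_conv_set)
  then obtain xs where xs: "c = map simple_refl xs" unfolding lists_image by blast
  have "simple_refl ` set xs = simple_refl ` {1..<n}" using c(2) unfolding xs by (simp only: set_map)
  then have "set xs = {1..<n}" using inj_image_eq_iff[of simple_refl] inj_simple_refl by (simp add: inj_def)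
  moreover have "distinct xs" using c(1) unfolding xs by (simp only: distinct_map)
  ultimately show ?thesis using xs that by blast
qed

text \<open>The subword side of the identity, from the coloured trace of the power through the cycle lemma to compositions.\<close>

lemma ascent_counts:
  fixes n p :: nat
  defines "N \<equiv> \<lambda>c k. real (\<Sum>v\<in>{v \<in> sym_group n. Asc n v = I_set n k}. card (M_set n v (word_power c p)))"
  assumes n: "2 \<le> n" and c: "coxeter_word n c" and p: "0 < p" and cop: "coprime p n"
  shows "real p * fact n * ((1 + t) * (\<Sum>k<n. t ^ k * N c k)) = (\<Sum>i\<le>n. t ^ i * kirk_sum n p i)"
proof -
  obtain xs where xs: "c = map simple_refl xs" "distinct xs" "set xs = {1..<n}"
    using c by (rule coxeter_word_letters)
  have w: "word_power c p = map simple_refl (wpow xs p)"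
    by (simp add: word_power_def wpow_def xs(1) map_concat)
  have "set (wpow xs p) \<subseteq> {1..<n}" using xs(3) by (auto simp: wpow_def)
  then have "(1 + t) * (\<Sum>k<n. t ^ k * N c k) = coeff (ctrace n t (W (wpow xs p))) (n - 1)"
    unfolding N_def w by (intro ctrace_eq_ascents[symmetric]) (use n in auto)
  also have "\<dots> = lead n t (cexp n p)"
    unfolding lead_def ctrace_coxeter[OF xs(2,3)] ctrace_coxeter_power[OF n cop] ..
  finally have "real p * ((1 + t) * (\<Sum>k<n. t ^ k * N c k)) = (\<Sum>m\<in>comps n p. wt (1 + t) m)"
    using lead_cexp[of n p t] n p cop by simp
  also have "\<dots> = (\<Sum>i\<le>n. t ^ i * kirk_sum n p i / fact n)"
    unfolding sum_comps_wt kirk_sum_def ..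
  also have "\<dots> = (\<Sum>i\<le>n. t ^ i * kirk_sum n p i) / fact n"
    by (simp only: sum_divide_distrib)
  finally show ?thesis by (simp add: nonzero_eq_divide_eq mult_ac)
qed

theorem corollary1p10:
  fixes n p k :: nat and c :: "(nat \<Rightarrow> nat) list"
  assumes "n \<ge> 2" and "coxeter_word n c" and "p > 0" and "coprime p n" and "k \<le> n - 1"
  shows "kirk_number n p k =
    real (\<Sum>v\<in>{v \<in> sym_group n. Asc n v = I_set n k}. card (M_set n v (word_power c p)))"
proof -
  define N where "N k = real (\<Sum>v\<in>{v \<in> sym_group n. Asc n v = I_set n k}. card (M_set n v (word_power c p)))" for k
  define q where "q = smult (real p * fact n) ([:1, 1:] * (\<Sum>k<n. monom (N k) k))"
  have "poly q t = poly (\<Sum>i\<le>n. monom (kirk_sum n p i) i) t" for t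
    using ascent_counts[OF assms(1-4), of t]
    unfolding q_def N_def by (simp add: poly_sum poly_monom mult.commute distrib_right)
  then have q: "q = (\<Sum>i\<le>n. monom (kirk_sum n p i) i)" by (simp only: poly_eq_poly_eq_iff[symmetric] fun_eq_iff) simp
  have cK: "coeff q i = kirk_sum n p i" if "i \<le> n" for i
    unfolding q using that by (simp add: coeff_sum)
  have cN: "coeff (\<Sum>k<n. monom (N k) k) i = N i" if "i < n" for i
    using that by (simp add: coeff_sum)
  have pos: "real p * fact n \<noteq> 0" using assms by simp
  have "k < n \<Longrightarrow> kirk_number n p k = N k"
  proof (induction k)
    case 0
    have "real p * fact n * kirk_number n p 0 = real p * fact n * N 0"
      using kirk_number_0[of n p] assms cK[of 0] cN[OF 0] by (simp add: q_def)
    then show ?case using pos by (metis mult_cancel_left)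
  next
    case (Suc k)
    have "real p * fact n * (kirk_number n p (Suc k) + kirk_number n p k) = real p * fact n * (N (Suc k) + N k)"
      using kirk_number_Suc[of n p k] assms cK[of "Suc k"] cN[of k] cN[of "Suc k"] Suc.prems
      by (simp add: q_def del: mult_cancel_left)
    then have "kirk_number n p (Suc k) + kirk_number n p k = N (Suc k) + N k" using pos by (metis mult_cancel_left)
    then show ?case using Suc by simp
  qed
  then show ?thesis using assms(1,5) unfolding N_def by simp
qed

end
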